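(* Assume that $(\boldsymbol c_t,\boldsymbol\xi_t)_{2\le t\le T}$ is a sequence of independent random variables (over $t$), with each $\boldsymbol\xi_t=(\boldsymbol A_t,\boldsymbol B_t,\boldsymbol b_t)$ finitely supported and each $\boldsymbol c_t\in L^1(\Omega,\mathcal A,\mathbb P;\mathbb R^{n_t})$ satisfying $\boldsymbol c_t\in-\operatorname{Cone}(\boldsymbol A_t^\top)$ almost surely. For each non-root node $\nu=(N_\tau,\xi_\tau)_{t_0<\tau\le t}$ of the scenario tree $\mathcal T_{t_0}$ put $c_\nu:=\check c_{t,N_t|\xi_t}$ and $p_\nu:=\prod_{t_0<\tau\le t}p_{\xi_\tau}\check p_{\tau,N_\tau|\xi_\tau}$, where $p_{\xi_\tau}:=\mathbb P[\boldsymbol\xi_\tau=\xi_\tau]$. Then for all $1\le t_0\le T-1$ and all $x_0\in\mathbb R^{n_{t_0}}$, $$V_{t_0+1}(x_0)=\min_{(x_\nu)}\ \sum_{\nu\in\mathcal T_{t_0},\ \nu\ne\text{root}}p_\nu c_\nu^\top x_\nu\quad\text{s.t.}\quad Ax_\mu+Bx_\nu\le b\ \ \text{for every non-leaf node }\nu\text{ of }\mathcal T_{t_0}\text{ and every child }\mu=(\nu,N,(A,B,b))\text{ of }\nu,$$ where the minimum is over families $(x_\nu)$ indexed by the nodes of $\mathcal T_{t_0}$ (with $x_\nu\in\mathbb R^{n_t}$ for a node of depth $t-t_0$), the value at the root being fixed equal to $x_0$.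
   Context: Multistage setting: $(\Omega,\mathcal A,\mathbb P)$ is a probability space, $\boldsymbol\xi_t=(\boldsymbol A_t,\boldsymbol B_t,\boldsymbol b_t)$ takes values in $\mathbb R^{q_t\times n_t}\times\mathbb R^{q_t\times n_{t-1}}\times\mathbb R^{q_t}$, $\boldsymbol c_t$ takes values in $\mathbb R^{n_t}$. Define $V_{T+1}\equiv0$ on $\mathbb R^{n_T}$ and for $t\in\{2,\dots,T\}$, $V_t(x_{t-1}):=\mathbb E\big[\min_{x_t\in\mathbb R^{n_t}}\{\boldsymbol c_t^\top x_t+V_{t+1}(x_t):\boldsymbol A_tx_t+\boldsymbol B_tx_{t-1}\le\boldsymbol b_t\}\big]$. $\mathbb I_{\mathtt p}$ equals $0$ if $\mathtt p$ is true, $+\infty$ otherwise. $\operatorname{Cone}(A^\top)$ is the cone generated by the columns of $A^\top$; $\operatorname{ri}$ is the relative interior. A polyhedral complex is a finite collection of polyhedra closed under taking non-empty faces and such that the intersection of two elements is a (possibly empty) face of each; support = union of its elements. $\mathcal C\wedge\mathcal C':=\{C\cap C':C\in\mathcal C,C'\in\mathcal C'\}$ ($\bigwedge$ for a finite family). $\mathcal F(P)$: complex of non-empty faces of $P$ (including $P$); $\mathbb R^k\times\mathcal P:=\{\mathbb R^k\times\sigma:\sigma\in\mathcal P\}$. Chamber complex of a polyhedral complex $\mathcal P$ along a linear projection $\pi$: $\mathcal C(\mathcal P,\pi):=\{\sigma_{\mathcal P,\pi}(x):x\in\pi(\operatorname{supp}\mathcal P)\}$, $\sigma_{\mathcal P,\pi}(x):=\bigcap_{F\in\mathcal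 P,\,x\in\pi(F)}\pi(F)$. For $\xi=(A,B,b)\in\operatorname{supp}(\boldsymbol\xi_t)$ let $P_t(\xi):=\{(x_{t-1},x_t):Ax_t+Bx_{t-1}\le b\}$. Define $\mathcal P_{T+1}:=\{\mathbb R^{n_T}\}$ and, for $t=T,\dots,2$, $\mathcal P_{t,\xi}:=\mathcal C\big((\mathbb R^{n_{t-1}}\times\mathcal P_{t+1})\wedge\mathcal F(P_t(\xi)),\ (x_{t-1},x_t)\mapsto x_{t-1}\big)$, $\mathcal P_t:=\bigwedge_{\xi\in\operatorname{supp}(\boldsymbol\xi_t)}\mathcal P_{t,\xi}$. Let $Q_t^\xi(x_{t-1},x_t):=V_{t+1}(x_t)+\mathbb I_{Ax_t+Bx_{t-1}\le b}$ and $\operatorname{epi}(Q_t^\xi)_{x_{t-1}}:=\{(x_t,z):(x_{t-1},x_t,z)\in\operatorname{epi}(Q_t^\xi)\}$. The normal fan of a convex set $C$ is $\mathcal N(C)=\{N_C(x):x\in C\}$, $N_C(x)=\{\alpha:\alpha^\top(y-x)\le0\ \forall y\in C\}$. For $\sigma\in\mathcal P_{t,\xi}$, the fibers $\operatorname{epi}(Q_t^\xi)_{x_{t-1}}$, $x_{t-1}\in\operatorname{ri}(\sigma)$, all have the same normal fan, denoted $\mathcal N_{t,\xi,\sigma}$; set $\mathcal N_{t,\xi}:=\bigwedge_{\sigma\in\mathcal P_{t,\xi}}-\mathcal N_{t,\xi,\sigma}$ (cones in $\mathbb R^{n_t}\times\mathbb R$). For $N\in\mathcal N_{t,\xi}$: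 $\check p_{t,N|\xi}:=\mathbb P[(\boldsymbol c_t,1)\in\operatorname{ri}N\mid\boldsymbol\xi_t=\xi]$ and $\check c_{t,N|\xi}:=\mathbb E[\boldsymbol c_t\mid(\boldsymbol c_t,1)\in\operatorname{ri}N,\boldsymbol\xi_t=\xi]$ if $\mathbb P[\boldsymbol\xi_t=\xi,(\boldsymbol c_t,1)\in\operatorname{ri}N]\neq0$, $\check c_{t,N|\xi}:=0$ otherwise. Scenario tree $\mathcal T_{t_0}$, $t_0\in\{1,\dots,T-1\}$: its nodes of depth $t-t_0$ ($t_0\le t\le T$) are the sequences $(N_\tau,\xi_\tau)_{t_0<\tau\le t}$ with $\xi_\tau\in\operatorname{supp}(\boldsymbol\xi_\tau)$ and $N_\tau\in\mathcal N_{\tau,\xi_\tau}$; the root is the empty sequence, the children of a node are its one-step extensions, and the leaves are the nodes of depth $T-t_0$.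
   Formalization: The identity is stated only where V_{t_0+1}(x_0) is not -∞ (the value +∞ is included); the cone condition alone does not exclude V = -∞ when T ≥ 3, and there the tree minimum is finite, so the claimed equality fails. *)

theory Defs
  imports "HOL-Probability.Probability"
begin

text \<open>
  The dimensions $n_t$, $q_t$ depend on the stage. The stage-$t$ decision space $R^{n_t}$ is
  rendered as the coordinate subspace of an ambient space of type \<^typ>\<open>real^'n\<close> given by a set
  \<open>J t\<close> of coordinates, so $n_t$ is \<^term>\<open>card (J t)\<close>; likewise the $q_t$ rows are indexed by a
  subset \<open>I t\<close> of the type \<open>'m\<close>. Both index types are arbitrary finite types, hence every finite
  family of dimensions occurs. All objects below are taken in the coordinate subspaces, never in
  the ambient space.
\<close>

definition coord_space :: "'n::finite set \<Rightarrow> (real^'n) set" where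
  "coord_space J = {x. \<forall>j. j \<notin> J \<longrightarrow> x $ j = 0}"

type_synonym ('n, 'm) stage_data = "(real^'n^'m) \<times> (real^'n^'m) \<times> (real^'m)"

definition data_space :: "'m::finite set \<Rightarrow> 'n::finite set \<Rightarrow> 'n set \<Rightarrow> ('n, 'm) stage_data set" where
  "data_space I J' J = {(A, B, b).
     (\<forall>i j. i \<notin> I \<or> j \<notin> J \<longrightarrow> A $ i $ j = 0) \<and>
     (\<forall>i j. i \<notin> I \<or> j \<notin> J' \<longrightarrow> B $ i $ j = 0) \<and>
     b \<in> coord_space I}"

(* The argument order is (previous decision) (current decision); rows outside I read 0 \<le> 0. *)
definition satisfies :: "('n::finite, 'm::finite) stage_data \<Rightarrow> real^'n \<Rightarrow> real^'n \<Rightarrow> bool" where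
  "satisfies \<xi> x y = (case \<xi> of (A, B, b) \<Rightarrow> A *v y + B *v x \<le> b)"

definition rv_support :: "'w measure \<Rightarrow> ('w \<Rightarrow> 'a::topological_space) \<Rightarrow> 'a set" where
  "rv_support M X = {x. \<forall>U. open U \<longrightarrow> x \<in> U \<longrightarrow> measure M {\<omega>\<in>space M. X \<omega> \<in> U} > 0}"

(* Truncation by e2ennreal yields the positive and the negative part. As \<infinity> - \<infinity> = \<infinity> in ereal, an
   infinite positive part prevails (a program that is infeasible with positive probability has
   expected value \<infinity>). *)
definition ereal_expectation :: "'w measure \<Rightarrow> ('w \<Rightarrow> ereal) \<Rightarrow> ereal" where
  "ereal_expectation M f =
     enn2ereal (\<integral>\<^sup>+\<omega>. e2ennreal (f \<omega>) \<partial>M) - enn2ereal (\<integral>\<^sup>+\<omega>. e2ennreal (- f \<omega>) \<partial>M)"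

definition is_minimum :: "ereal set \<Rightarrow> ereal \<Rightarrow> bool" where
  "is_minimum S v = (if S = {} then v = \<infinity> else v \<in> S \<and> (\<forall>s\<in>S. v \<le> s))"

(* E is the ambient space of the cells; {E} is the neutral element of the common refinement and
   therefore its value on the empty family. *)
definition common_refinement :: "'a set \<Rightarrow> 'i set \<Rightarrow> ('i \<Rightarrow> 'a set set) \<Rightarrow> 'a set set" where
  "common_refinement E K \<C> = {E \<inter> (\<Inter>i\<in>K. S i) | S. \<forall>i\<in>K. S i \<in> \<C> i}"

definition meet :: "'a set set \<Rightarrow> 'a set set \<Rightarrow> 'a set set" where
  "meet \<C> \<D> = {C \<inter> D | C D. C \<in> \<C> \<and> D \<in> \<D>}"

definition face_complex :: "'a::real_vector set \<Rightarrow> 'a set set" where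
  "face_complex P = {F. F face_of P \<and> F \<noteq> {}}"

definition chamber :: "'a set set \<Rightarrow> ('a \<Rightarrow> 'b) \<Rightarrow> 'b \<Rightarrow> 'b set" where
  "chamber \<P> \<pi> x = \<Inter> {\<pi> ` F | F. F \<in> \<P> \<and> x \<in> \<pi> ` F}"

definition chamber_complex :: "'a set set \<Rightarrow> ('a \<Rightarrow> 'b) \<Rightarrow> 'b set set" where
  "chamber_complex \<P> \<pi> = chamber \<P> \<pi> ` (\<pi> ` \<Union>\<P>)"

(* E is the linear space that contains C and in which normal vectors are taken. *)
definition normal_cone :: "'a::real_inner set \<Rightarrow> 'a set \<Rightarrow> 'a \<Rightarrow> 'a set" where
  "normal_cone E C x = {\<alpha>\<in>E. \<forall>y\<in>C. \<alpha> \<bullet> (y - x) \<le> 0}"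

definition normal_fan :: "'a::real_inner set \<Rightarrow> 'a set \<Rightarrow> 'a set set" where
  "normal_fan E C = normal_cone E C ` C"

type_synonym ('n, 'm) node = "(((real^'n) \<times> real) set \<times> ('n, 'm) stage_data) list"

locale multistage =
  fixes M :: "'w measure"
    and T :: nat
    and J :: "nat \<Rightarrow> 'n::finite set"
    and c :: "nat \<Rightarrow> 'w \<Rightarrow> real^'n"
    and \<xi> :: "nat \<Rightarrow> 'w \<Rightarrow> ('n, 'm::finite) stage_data"
begin

function V :: "nat \<Rightarrow> real^'n \<Rightarrow> ereal" where
  "V t x = (if t > T then 0
     else ereal_expectation M (\<lambda>\<omega>.
       INF y\<in>{y\<in>coord_space (J t). satisfies (\<xi> t \<omega>) x y}. ereal (c t \<omega> \<bullet> y) + V (t + 1) y))"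
  by auto
termination by (relation "Wellfounded.measure (\<lambda>(t, x). T + 1 - t)") auto

declare V.simps [simp del]

definition coupling_polyhedron :: "nat \<Rightarrow> ('n, 'm) stage_data \<Rightarrow> ((real^'n) \<times> (real^'n)) set" where
  "coupling_polyhedron t d =
     {(x, y). x \<in> coord_space (J (t - 1)) \<and> y \<in> coord_space (J t) \<and> satisfies d x y}"

definition stage_complex ::
    "nat \<Rightarrow> (real^'n) set set \<Rightarrow> ('n, 'm) stage_data \<Rightarrow> (real^'n) set set" where
  "stage_complex t \<P> d =
     chamber_complex
       (meet ((\<lambda>\<sigma>. coord_space (J (t - 1)) \<times> \<sigma>) ` \<P>) (face_complex (coupling_polyhedron t d)))
       fst"

function P_complex :: "nat \<Rightarrow> (real^'n) set set" where
  "P_complex t = (if t > T then {coord_space (J T)}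
     else common_refinement (coord_space (J (t - 1))) (rv_support M (\<xi> t))
            (stage_complex t (P_complex (t + 1))))"
  by auto
termination by (relation "Wellfounded.measure (\<lambda>t. T + 1 - t)") auto

declare P_complex.simps [simp del]

abbreviation P_complex_at :: "nat \<Rightarrow> ('n, 'm) stage_data \<Rightarrow> (real^'n) set set" where
  "P_complex_at t d \<equiv> stage_complex t (P_complex (t + 1)) d"

definition Q :: "nat \<Rightarrow> ('n, 'm) stage_data \<Rightarrow> real^'n \<Rightarrow> real^'n \<Rightarrow> ereal" where
  "Q t d x y = V (t + 1) y + (if satisfies d x y then 0 else \<infinity>)"

definition epi_fiber :: "nat \<Rightarrow> ('n, 'm) stage_data \<Rightarrow> real^'n \<Rightarrow> ((real^'n) \<times> real) set" where
  "epi_fiber t d x = {(y, z). y \<in> coord_space (J t) \<and> Q t d x y \<le> ereal z}"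

(* All fibers over the relative interior of \<sigma> have the same normal fan, so the choice is
   immaterial. *)
definition cell_fan :: "nat \<Rightarrow> ('n, 'm) stage_data \<Rightarrow> (real^'n) set \<Rightarrow> ((real^'n) \<times> real) set set" where
  "cell_fan t d \<sigma> =
     normal_fan (coord_space (J t) \<times> UNIV) (epi_fiber t d (SOME x. x \<in> rel_interior \<sigma>))"

definition N_fan :: "nat \<Rightarrow> ('n, 'm) stage_data \<Rightarrow> ((real^'n) \<times> real) set set" where
  "N_fan t d = common_refinement (coord_space (J t) \<times> UNIV) (P_complex_at t d)
     (\<lambda>\<sigma>. (\<lambda>N. uminus ` N) ` cell_fan t d \<sigma>)"

definition p_data :: "nat \<Rightarrow> ('n, 'm) stage_data \<Rightarrow> real" where
  "p_data t d = \<P>(\<omega> in M. \<xi> t \<omega> = d)"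

definition p_check :: "nat \<Rightarrow> ((real^'n) \<times> real) set \<Rightarrow> ('n, 'm) stage_data \<Rightarrow> real" where
  "p_check t N d = \<P>(\<omega> in M. (c t \<omega>, 1) \<in> rel_interior N \<bar> \<xi> t \<omega> = d)"

definition c_check :: "nat \<Rightarrow> ((real^'n) \<times> real) set \<Rightarrow> ('n, 'm) stage_data \<Rightarrow> real^'n" where
  "c_check t N d =
     (let S = {\<omega>\<in>space M. \<xi> t \<omega> = d \<and> (c t \<omega>, 1) \<in> rel_interior N}
      in if measure M S \<noteq> 0 then (LINT \<omega>:S|M. c t \<omega>) /\<^sub>R measure M S else 0)"

(* The entry at position k of a node of the tree rooted at stage t0 belongs to stage t0 + k + 1. *)
definition nodes :: "nat \<Rightarrow> ('n, 'm) node set" where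
  "nodes t0 = {\<nu>. length \<nu> \<le> T - t0 \<and>
     (\<forall>k<length \<nu>. snd (\<nu> ! k) \<in> rv_support M (\<xi> (t0 + k + 1)) \<and>
                   fst (\<nu> ! k) \<in> N_fan (t0 + k + 1) (snd (\<nu> ! k)))}"

definition node_cost :: "nat \<Rightarrow> ('n, 'm) node \<Rightarrow> real^'n" where
  "node_cost t0 \<nu> = c_check (t0 + length \<nu>) (fst (last \<nu>)) (snd (last \<nu>))"

definition node_prob :: "nat \<Rightarrow> ('n, 'm) node \<Rightarrow> real" where
  "node_prob t0 \<nu> = (\<Prod>k<length \<nu>.
     p_data (t0 + k + 1) (snd (\<nu> ! k)) * p_check (t0 + k + 1) (fst (\<nu> ! k)) (snd (\<nu> ! k)))"

(* A leaf has no one-step extension among the nodes, so the constraint ranges over exactly the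
   pairs of a non-leaf node and a child. *)
definition tree_feasible :: "nat \<Rightarrow> real^'n \<Rightarrow> (('n, 'm) node \<Rightarrow> real^'n) set" where
  "tree_feasible t0 x0 = {X. X [] = x0 \<and>
     (\<forall>\<nu>\<in>nodes t0. X \<nu> \<in> coord_space (J (t0 + length \<nu>))) \<and>
     (\<forall>\<nu>\<in>nodes t0. \<forall>N d. \<nu> @ [(N, d)] \<in> nodes t0 \<longrightarrow> satisfies d (X \<nu>) (X (\<nu> @ [(N, d)])))}"

definition tree_cost :: "nat \<Rightarrow> (('n, 'm) node \<Rightarrow> real^'n) \<Rightarrow> real" where
  "tree_cost t0 X = (\<Sum>\<nu>\<in>nodes t0 - {[]}. node_prob t0 \<nu> * (node_cost t0 \<nu> \<bullet> X \<nu>))"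

end

end

theory Submission
  imports Defs
begin

text \<open>
  The theorem says that one stage of the program can be quantised without error. Fix the data
  \<open>d = (A, B, b)\<close> and the previous decision \<open>x\<close>. The stage problem minimises the linear functional
  \<open>(a, 1)\<close>, with \<open>a\<close> the random cost vector, over the epigraph of \<open>y \<mapsto> V (t + 1) y\<close> restricted to
  the feasible \<open>y\<close>. This epigraph is a polyhedron, and as long as \<open>(a, 1)\<close> stays in one (negated)
  normal cone of it, one and the same decision \<open>y\<close> is optimal. On that event the optimal value is
  affine in \<open>a\<close>, so the cost vector may be replaced by its conditional mean
  (\<open>V_quantised\<close>, \<open>child_value_le\<close>).

  For the tree, a single finite family of cones must work for all \<open>x\<close> simultaneously. This is the
  role of the chamber complex. Let \<open>x1\<close> lie in the relative interior of the chamber of \<open>x0\<close>. Linear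
  programming multipliers (\<open>fiber_minimum_multiplier\<close>) show that a cell of the cost complex with an
  optimal point in its relative interior consists of optimal points; moving from \<open>x1\<close> to \<open>x0\<close> and back
  along such cells proves that every normal cone over \<open>x1\<close> is contained in a normal cone over \<open>x0\<close>
  (\<open>min_cone_transfers_from_chamber\<close>). Hence the fan of one representative per chamber
  suffices, and each cone of the common refinement of these fans has a minimiser over every
  feasible \<open>x\<close> (\<open>common_minimiser\<close>).
  The conditioning events form a partition up to a null set, since the relative interiors of the
  refined cones are disjoint (\<open>refined_fan_relint_disjoint\<close>) and cover all functionals that are
  bounded below (\<open>refined_fan_relint_covers\<close>).

  To go on to the preceding stage, three facts are carried backwards in time
  (\<open>polyhedral_value\<close>): \<open>V t\<close> never takes the value \<open>-\<infinity>\<close> on its domain, its epigraph is a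
  polyhedron, and it is affine on each cell of \<open>P_complex t\<close>. The complexes themselves enter only
  through one property, stable under all constructions in their recursion: every point of a
  cell is a relative interior point of a cell contained in it (\<open>relint_stratified\<close>). The support of
  \<open>P_complex t\<close> is the set of states with feasible continuation; outside it both \<open>V t\<close> and the
  minimum over the tree, which then has no feasible family, are \<open>\<infinity>\<close>. Inside it, a value of
  \<open>V (t0 + 1)\<close> other than \<open>-\<infinity>\<close> at a single point forces \<open>V t \<noteq> -\<infinity>\<close> at all feasible states of all
  later stages, because \<open>-\<infinity>\<close> at a later stage, or a set of positive probability of cost vectors
  outside the fan, would make the value \<open>-\<infinity>\<close> as well. Gluing optimal subtrees
  to the common minimisers then proves the theorem by induction on the depth of the tree
  (\<open>tree_minimum\<close>).
\<close>

section \<open>Polyhedra and their linear images\<close>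

lemma polyhedron_inequalities:
  fixes S :: "'a::euclidean_space set"
  assumes "polyhedron S"
  obtains G :: "('a \<times> real) set" where "finite G" "S = {x. \<forall>(a, b)\<in>G. a \<bullet> x \<le> b}"
proof -
  obtain F where F: "finite F" "S = \<Inter> F" "\<forall>h\<in>F. \<exists>a b. a \<noteq> 0 \<and> h = {x. a \<bullet> x \<le> b}"
    using assms unfolding polyhedron_def by auto
  then obtain a b where ab: "\<forall>h\<in>F. h = {x. a h \<bullet> x \<le> b h}" by metis
  show thesis
  proof
    show "finite ((\<lambda>h. (a h, b h)) ` F)" using F by simp
    show "S = {x. \<forall>(a, b)\<in>(\<lambda>h. (a h, b h)) ` F. a \<bullet> x \<le> b}"
      using F(2) ab by auto
  qed
qed

lemma polyhedron_from_inequalities: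
  fixes G :: "('a::euclidean_space \<times> real) set"
  assumes "finite G"
  shows "polyhedron {x. \<forall>(a, b)\<in>G. a \<bullet> x \<le> b}"
proof -
  have "{x. \<forall>(a, b)\<in>G. a \<bullet> x \<le> b} = (\<Inter>(a,b)\<in>G. {x. a \<bullet> x \<le> b})" by auto
  also have "polyhedron \<dots>"
    using assms by (intro polyhedron_Inter) (auto intro: polyhedron_halfspace_le)
  finally show ?thesis .
qed

lemma polyhedron_affine_vimage:
  fixes f :: "'a::euclidean_space \<Rightarrow> 'b::euclidean_space"
  assumes "linear f" "polyhedron S"
  shows "polyhedron {x. f x + c \<in> S}"
proof -
  obtain G where G: "finite G" "S = {x. \<forall>(a, b)\<in>G. a \<bullet> x \<le> b}"
    using polyhedron_inequalities[OF assms(2)] .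
  let ?H = "(\<lambda>(a,b). (adjoint f a, b - a \<bullet> c)) ` G"
  have "{x. f x + c \<in> S} = {x. \<forall>(a, b)\<in>?H. a \<bullet> x \<le> b}"
    unfolding G(2)
    by (simp add: case_prod_beta adjoint_clauses[OF assms(1)] inner_add_right le_diff_eq)
  then show ?thesis using polyhedron_from_inequalities[of ?H] G(1) by simp
qed

lemma polyhedron_linear_vimage:
  fixes f :: "'a::euclidean_space \<Rightarrow> 'b::euclidean_space"
  assumes "linear f" "polyhedron S"
  shows "polyhedron {x. f x \<in> S}"
  using polyhedron_affine_vimage[OF assms, of 0] by simp

lemma polyhedron_Times_sets:
  fixes S :: "'a::euclidean_space set" and T :: "'b::euclidean_space set"
  assumes "polyhedron S" "polyhedron T"
  shows "polyhedron (S \<times> T)"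
proof -
  have "S \<times> T = {p. fst p \<in> S} \<inter> {p. snd p \<in> T}" by auto
  then show ?thesis
    using polyhedron_Int[OF polyhedron_linear_vimage[OF linear_fst assms(1)]
      polyhedron_linear_vimage[OF linear_snd assms(2)]] by simp
qed

text \<open>
  Farkas' lemma: a finitely generated cone is closed, so a point outside it is strictly separated
  from it, and by homogeneity the separating hyperplane may be moved through the apex.
\<close>
lemma convex_cone_hull_separation:
  fixes A :: "'a::euclidean_space set"
  assumes "finite A" "\<beta> \<notin> convex_cone hull A"
  obtains v where "\<And>a. a \<in> A \<Longrightarrow> v \<bullet> a \<le> 0" "v \<bullet> \<beta> > 0"
proof -
  let ?C = "convex_cone hull A"
  obtain u b where u: "u \<bullet> \<beta> < b" "\<And>x. x \<in> ?C \<Longrightarrow> u \<bullet> x > b"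
    using separating_hyperplane_closed_point[OF convex_convex_cone_hull
      closed_convex_cone_hull[OF assms(1)] assms(2)] by blast
  have b: "b < 0" using u(2)[OF convex_cone_hull_contains_0] by simp
  have pos: "u \<bullet> x \<ge> 0" if x: "x \<in> ?C" for x
  proof (rule ccontr)
    assume n: "\<not> 0 \<le> u \<bullet> x"
    have "(b / (u \<bullet> x)) *\<^sub>R x \<in> ?C"
      using n b by (intro convex_cone_hull_mul x) (auto simp: divide_nonpos_neg)
    from u(2)[OF this] n show False by simp
  qed
  show thesis
  proof (rule that[of "- u"])
    fix a assume "a \<in> A" then show "- u \<bullet> a \<le> 0" using pos[of a] hull_inc[of a A] by simp
  next
    show "- u \<bullet> \<beta> > 0" using u(1) b by simp
  qed
qed

lemma convex_cone_hull_nonpos: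
  assumes "\<And>a. a \<in> A \<Longrightarrow> v \<bullet> a \<le> 0" "x \<in> convex_cone hull A"
  shows "v \<bullet> x \<le> (0::real)"
proof -
  have "convex_cone hull A \<subseteq> {x. v \<bullet> x \<le> 0}"
  proof (rule hull_minimal)
    show "A \<subseteq> {x. v \<bullet> x \<le> 0}" using assms by auto
    have "{x. v \<bullet> x \<le> 0} \<noteq> {}" by (auto intro: exI[of _ 0])
    then show "convex_cone {x. v \<bullet> x \<le> 0}"
      by (auto simp: convex_cone_def convex_halfspace_le conic_def mult_nonneg_nonpos)
  qed
  then show ?thesis using assms by auto
qed

text \<open>
  Half of the Minkowski-Weyl theorem, by duality: the cone generated by \<open>A\<close> is a polyhedron, its
  facet normals generate a cone as well, and the polar of the first cone is the second.
\<close>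
lemma polyhedral_cone_finitely_generated:
  fixes A :: "'a::euclidean_space set"
  assumes "finite A"
  obtains W where "finite W" "{x. \<forall>a\<in>A. a \<bullet> x \<le> 0} = convex_cone hull W"
proof -
  let ?C = "convex_cone hull A"
  have "polyhedron ?C" using polyhedron_convex_cone_hull[OF assms] .
  then obtain G where G: "finite G" "?C = {x. \<forall>(a, b)\<in>G. a \<bullet> x \<le> b}"
    using polyhedron_inequalities by blast
  let ?W = "fst ` G"
  have b: "b \<ge> 0" if "(a,b) \<in> G" for a b
    using G(2) convex_cone_hull_contains_0[of A] that by fastforce
  have W: "v \<bullet> x \<le> 0" if v: "(v,b) \<in> G" and x: "x \<in> ?C" for v b x
  proof (rule ccontr)
    assume n: "\<not> v \<bullet> x \<le> 0"
    have "((b + 1) / (v \<bullet> x)) *\<^sub>R x \<in> ?C"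
      using n b[OF v] by (intro convex_cone_hull_mul x) simp
    then have "v \<bullet> (((b + 1) / (v \<bullet> x)) *\<^sub>R x) \<le> b"
      using G(2) v by fast
    moreover have "v \<bullet> (((b + 1) / (v \<bullet> x)) *\<^sub>R x) = b + 1"
      using n by (simp add: field_simps)
    ultimately show False by simp
  qed
  have "{x. \<forall>a\<in>A. a \<bullet> x \<le> 0} = convex_cone hull ?W"
  proof (rule set_eqI iffI)+
    fix x assume x: "x \<in> {x. \<forall>a\<in>A. a \<bullet> x \<le> 0}"
    show "x \<in> convex_cone hull ?W"
    proof (rule ccontr)
      assume "x \<notin> convex_cone hull ?W"
      then obtain v where v: "\<And>a. a \<in> ?W \<Longrightarrow> v \<bullet> a \<le> 0" "v \<bullet> x > 0"
        using convex_cone_hull_separation[of ?W x] G(1) by blast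
      have "v \<in> ?C" unfolding G(2) using v(1) b by (fastforce simp: inner_commute)
      moreover have "\<And>a. a \<in> A \<Longrightarrow> x \<bullet> a \<le> 0" using x by (auto simp: inner_commute)
      ultimately have "x \<bullet> v \<le> 0" using convex_cone_hull_nonpos[of A x v] by blast
      with v(2) show False by (simp add: inner_commute)
    qed
  next
    fix x assume x: "x \<in> convex_cone hull ?W"
    show "x \<in> {x. \<forall>a\<in>A. a \<bullet> x \<le> 0}"
    proof safe
      fix a assume a: "a \<in> A"
      have "a \<bullet> v \<le> 0" if "v \<in> ?W" for v
        using that W[of v _ a] hull_inc[OF a] by (force simp: inner_commute)
      then show "a \<bullet> x \<le> 0" using convex_cone_hull_nonpos[of ?W a x] x by blast
    qed
  qed
  then show thesis using that[of ?W] G(1) by blast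
qed

text \<open>
  Homogenising turns a polyhedron into a finitely generated cone, and linear images of finitely
  generated cones are finitely generated; the image is the slice of the image cone at height one.
\<close>
lemma polyhedron_linear_image:
  fixes f :: "'a::euclidean_space \<Rightarrow> 'b::euclidean_space"
  assumes f: "linear f" and S: "polyhedron S"
  shows "polyhedron (f ` S)"
proof -
  obtain G where G: "finite G" "S = {x. \<forall>(a, b)\<in>G. a \<bullet> x \<le> b}"
    using polyhedron_inequalities[OF S] .
  let ?A = "insert (0, -1) ((\<lambda>(a, b). (a, - b)) ` G) :: ('a \<times> real) set"
  let ?g = "\<lambda>(x, s::real). (f x, s)"
  have g: "linear ?g"
    using f by (auto simp: linear_iff split: prod.splits)
  obtain W where W: "finite W" "{x. \<forall>a\<in>?A. a \<bullet> x \<le> 0} = convex_cone hull W"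
    using polyhedral_cone_finitely_generated[of ?A] G(1) by auto
  have in_cone: "(x, 1) \<in> convex_cone hull W \<longleftrightarrow> x \<in> S" for x
    unfolding W(2)[symmetric] G(2) by auto
  have "f ` S = {y. (y, 1) \<in> ?g ` (convex_cone hull W)}"
    using in_cone by force
  also have "\<dots> = {y. (y, 0) + (0, 1) \<in> convex_cone hull (?g ` W)}"
    by (simp add: convex_cone_hull_linear_image[OF g])
  also have "polyhedron \<dots>"
    using W(1)
    by (intro polyhedron_affine_vimage[where f = "\<lambda>y. (y, 0)"] polyhedron_convex_cone_hull)
       (auto simp: linear_iff)
  finally show ?thesis .
qed

lemma polyhedron_attains_minimum:
  fixes S :: "'a::euclidean_space set"
  assumes S: "polyhedron S" "S \<noteq> {}" and bd: "\<And>x. x \<in> S \<Longrightarrow> \<alpha> \<bullet> x \<ge> (m::real)"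
  obtains x where "x \<in> S" "\<And>y. y \<in> S \<Longrightarrow> \<alpha> \<bullet> x \<le> \<alpha> \<bullet> y"
proof -
  let ?I = "(\<bullet>) \<alpha> ` S"
  have "closed ?I"
    by (intro polyhedron_imp_closed polyhedron_linear_image S(1) bounded_linear.linear bounded_linear_inner_right)
  moreover have bb: "bdd_below ?I" using bd by (auto simp: bdd_below_def)
  ultimately have "Inf ?I \<in> ?I" using S(2) by (intro closed_contains_Inf) auto
  then obtain x where "x \<in> S" "\<alpha> \<bullet> x = Inf ?I" by force
  then show thesis using that bb by (metis cInf_lower imageI)
qed

text \<open>
  The halfspaces that are tight at \<open>p\<close> describe the cone of feasible directions at \<open>p\<close>; the other
  halfspaces only limit the length of a feasible step. There are finitely many halfspaces, hence
  only finitely many tight sets.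
\<close>
lemma polyhedron_tight_constraints:
  fixes S :: "'a::euclidean_space set"
  assumes S: "polyhedron S"
  obtains \<A> where "finite \<A>"
    "\<And>p. p \<in> S \<Longrightarrow> \<exists>A\<in>\<A>. finite A \<and> (\<forall>a\<in>A. \<forall>q\<in>S. a \<bullet> q \<le> a \<bullet> p) \<and>
       (\<forall>v. (\<forall>a\<in>A. v \<bullet> a \<le> 0) \<longrightarrow> (\<exists>e>0. p + e *\<^sub>R v \<in> S))"
proof -
  obtain G where G: "finite G" "S = {x. \<forall>(a, b)\<in>G. a \<bullet> x \<le> b}"
    using polyhedron_inequalities[OF S] .
  let ?A = "\<lambda>p. fst ` {(a,b)\<in>G. a \<bullet> p = b}"
  show thesis
  proof (rule that[of "Pow (fst ` G)"])
    show "finite (Pow (fst ` G))" using G(1) by simp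
    fix p assume p: "p \<in> S"
    have 1: "?A p \<in> Pow (fst ` G)" by auto
    then have 2: "finite (?A p)" using G(1) finite_subset[of "?A p" "fst ` G"] by auto
    have 3: "\<forall>a\<in>?A p. \<forall>q\<in>S. a \<bullet> q \<le> a \<bullet> p" unfolding G(2) by auto
    have 4: "\<exists>e>0. p + e *\<^sub>R v \<in> S" if v: "\<forall>a\<in>?A p. v \<bullet> a \<le> 0" for v
    proof -
      have "\<forall>\<^sub>F e in at_right (0::real). case g of (a, b) \<Rightarrow> a \<bullet> (p + e *\<^sub>R v) \<le> b" if g: "g \<in> G" for g
      proof -
        obtain a b where ab: "g = (a, b)" by force
        have le: "a \<bullet> p \<le> b" using p g ab unfolding G(2) by auto
        show ?thesis
        proof (cases "a \<bullet> p = b")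
          case True
          then have "v \<bullet> a \<le> 0" using v g ab by force
          then have "a \<bullet> (p + e *\<^sub>R v) \<le> b" if "e > 0" for e
            using True that by (simp add: inner_add_right inner_commute mult_nonneg_nonpos)
          then show ?thesis
            unfolding ab by (auto intro: eventually_mono[OF eventually_at_right_less[of "0::real"]])
        next
          case False
          have "((\<lambda>e. a \<bullet> (p + e *\<^sub>R v)) \<longlongrightarrow> a \<bullet> (p + 0 *\<^sub>R v)) (at_right (0::real))"
            by (intro tendsto_intros)
          then have "\<forall>\<^sub>F e in at_right (0::real). a \<bullet> (p + e *\<^sub>R v) < b"
            using False le by (intro order_tendstoD(2)) auto
          then show ?thesis unfolding ab by (auto elim: eventually_mono)
        qed
      qed
      then have "\<forall>\<^sub>F e in at_right (0::real). \<forall>g\<in>G. case g of (a, b) \<Rightarrow> a \<bullet> (p + e *\<^sub>R v) \<le> b"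
        using G(1) by (simp add: eventually_ball_finite_distrib)
      then have "\<forall>\<^sub>F e in at_right (0::real). 0 < e \<and> p + e *\<^sub>R v \<in> S"
        unfolding G(2) using eventually_at_right_less[of "0::real"] by eventually_elim auto
      then show ?thesis
        using eventually_happens'[of "at_right (0::real)"] trivial_limit_at_right_real by blast
    qed
    show "\<exists>A\<in>Pow (fst ` G). finite A \<and> (\<forall>a\<in>A. \<forall>q\<in>S. a \<bullet> q \<le> a \<bullet> p) \<and>
       (\<forall>v. (\<forall>a\<in>A. v \<bullet> a \<le> 0) \<longrightarrow> (\<exists>e>0. p + e *\<^sub>R v \<in> S))"
      using 1 2 3 4 by (intro bexI[of _ "?A p"] conjI allI impI) auto
  qed
qed

section \<open>Multipliers for minimisation over fibers\<close>

lemma inner_diff_le_0_iff: "(x - y) \<bullet> a \<le> 0 \<longleftrightarrow> a \<bullet> x \<le> a \<bullet> (y::'a::real_inner)"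
  by (simp add: inner_commute[of _ a] inner_diff_right)

text \<open>
  A point that is not a relative interior point lies on a facet, which has smaller dimension.
\<close>
lemma relint_face_exists:
  fixes S :: "'a::euclidean_space set"
  assumes "polyhedron S" "x \<in> S"
  obtains F where "F face_of S" "x \<in> rel_interior F"
proof -
  have "\<exists>F. F face_of S \<and> x \<in> rel_interior F"
    using assms
  proof (induction "nat (aff_dim S + 1)" arbitrary: S rule: less_induct)
    case less
    show ?case
    proof (cases "x \<in> rel_interior S")
      case True
      then show ?thesis
        using face_of_refl polyhedron_imp_convex less.prems(1) by blast
    next
      case False
      then obtain F where F: "F facet_of S" "x \<in> F"
        using rel_interior_of_polyhedron[OF less.prems(1)] less.prems(2) by auto
      have face: "F face_of S" and dim: "F \<noteq> {}" "aff_dim F = aff_dim S - 1"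
        using F(1) by (auto simp: facet_of_def)
      have "nat (aff_dim F + 1) < nat (aff_dim S + 1)"
        using dim(2) aff_dim_geq[of F] by simp
      moreover have "polyhedron F"
        using face_of_polyhedron_polyhedron[OF less.prems(1) face] .
      ultimately obtain F' where "F' face_of F" "x \<in> rel_interior F'"
        using less.hyps[of F] F(2) by auto
      then show ?thesis using face_of_trans face by blast
    qed
  qed
  then show thesis using that by blast
qed

text \<open>
  The Lagrange multiplier of the constraint that fixes \<open>x\<close>: a point that is optimal over its fiber
  is optimal over all of \<open>K\<close> once the cost of moving \<open>x\<close> is charged at the rate \<open>g\<close>. Optimality over
  the fiber places \<open>- \<alpha>\<close> in the cone generated by the \<open>w\<close>-components of the tight constraints;
  \<open>g\<close> collects their \<open>x\<close>-components with the same weights.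
\<close>
lemma fiber_minimum_multiplier:
  fixes K :: "('a::euclidean_space \<times> 'b::euclidean_space) set"
  assumes K: "polyhedron K" and w1: "(x1, w1) \<in> K"
    and min: "\<And>w. (x1, w) \<in> K \<Longrightarrow> \<alpha> \<bullet> w1 \<le> \<alpha> \<bullet> w"
  obtains g where "\<And>x w. (x, w) \<in> K \<Longrightarrow> \<alpha> \<bullet> w1 - g \<bullet> x1 \<le> \<alpha> \<bullet> w - g \<bullet> x"
proof -
  obtain A where A: "finite A" "\<And>a q. a \<in> A \<Longrightarrow> q \<in> K \<Longrightarrow> a \<bullet> q \<le> a \<bullet> (x1, w1)"
    "\<And>v. (\<forall>a\<in>A. v \<bullet> a \<le> 0) \<Longrightarrow> \<exists>e>0. (x1, w1) + e *\<^sub>R v \<in> K"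
    using polyhedron_tight_constraints[OF K] w1 by metis
  have "\<alpha> \<in> convex_cone hull ((\<lambda>a. - snd a) ` A)"
  proof (rule ccontr)
    assume "\<not> ?thesis"
    then obtain v where v: "\<And>a. a \<in> (\<lambda>a. - snd a) ` A \<Longrightarrow> v \<bullet> a \<le> 0" "v \<bullet> \<alpha> > 0"
      using convex_cone_hull_separation[of "(\<lambda>a. - snd a) ` A" \<alpha>] A(1) by blast
    have "\<forall>a\<in>A. (0, - v) \<bullet> a \<le> 0" using v(1) by (force simp: inner_prod_def)
    then obtain e where e: "e > 0" "(x1, w1) + e *\<^sub>R (0, - v) \<in> K" using A(3) by blast
    then have "(x1, w1 - e *\<^sub>R v) \<in> K" by simp
    from min[OF this] e(1) v(2) show False
      by (simp add: inner_diff_right inner_commute mult_le_0_iff)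
  qed
  also have "convex_cone hull ((\<lambda>a. - snd a) ` A) = (\<lambda>a. - snd a) ` (convex_cone hull A)"
    by (intro convex_cone_hull_linear_image) (auto simp: linear_iff)
  finally obtain n where n: "n \<in> convex_cone hull A" "\<alpha> = - snd n" by auto
  show thesis
  proof (rule that[of "fst n"])
    fix x w assume "(x, w) \<in> K"
    then have "((x, w) - (x1, w1)) \<bullet> a \<le> 0" if "a \<in> A" for a
      using A(2)[OF that, of "(x, w)"] by (simp only: inner_diff_le_0_iff)
    then have "((x, w) - (x1, w1)) \<bullet> n \<le> 0"
      using convex_cone_hull_nonpos[OF _ n(1)] by blast
    then show "\<alpha> \<bullet> w1 - fst n \<bullet> x1 \<le> \<alpha> \<bullet> w - fst n \<bullet> x"
      unfolding n(2)
      by (simp add: inner_prod_def inner_diff_left inner_diff_right inner_commute algebra_simps)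
  qed
qed

lemma fiber_minimum_attained:
  fixes K :: "('a::euclidean_space \<times> 'b::euclidean_space) set"
  assumes K: "polyhedron K" and ne: "(x, w) \<in> K"
    and bd: "\<And>w. (x, w) \<in> K \<Longrightarrow> m \<le> \<alpha> \<bullet> w"
  obtains w0 where "(x, w0) \<in> K" "\<And>w. (x, w) \<in> K \<Longrightarrow> \<alpha> \<bullet> w0 \<le> \<alpha> \<bullet> w"
proof -
  have "{w. (0, w) + (x, 0) \<in> K} = {w. (x, w) \<in> K}" by simp
  moreover have "polyhedron {w. (0, w) + (x, 0) \<in> K}"
    by (intro polyhedron_affine_vimage K) (auto simp: linear_iff)
  ultimately have "polyhedron {w. (x, w) \<in> K}" by simp
  from polyhedron_attains_minimum[OF this, where \<alpha> = \<alpha> and m = m] show thesis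
    using ne bd that by auto
qed

text \<open>Boundedness of a linear functional does not depend on the fiber, by the multiplier.\<close>
lemma fiber_minimum_transfer:
  fixes K :: "('a::euclidean_space \<times> 'b::euclidean_space) set"
  assumes K: "polyhedron K" and w1: "(x1, w1) \<in> K"
    and min: "\<And>w. (x1, w) \<in> K \<Longrightarrow> \<alpha> \<bullet> w1 \<le> \<alpha> \<bullet> w" and ne: "(x, w) \<in> K"
  obtains w0 where "(x, w0) \<in> K" "\<And>w. (x, w) \<in> K \<Longrightarrow> \<alpha> \<bullet> w0 \<le> \<alpha> \<bullet> w"
proof -
  obtain g where g: "\<And>x w. (x, w) \<in> K \<Longrightarrow> \<alpha> \<bullet> w1 - g \<bullet> x1 \<le> \<alpha> \<bullet> w - g \<bullet> x"
    using fiber_minimum_multiplier[OF K w1 min] by blast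
  have bd: "\<alpha> \<bullet> w1 - g \<bullet> x1 + g \<bullet> x \<le> \<alpha> \<bullet> w" if "(x, w) \<in> K" for w
    using g[OF that] by simp
  show thesis using fiber_minimum_attained[OF K ne bd] that by blast
qed

section \<open>Cones of functionals with a common minimiser\<close>

text \<open>
  The negative of the normal cone of \<open>C\<close> at \<open>p\<close>. The sign is chosen because the costs \<open>(c t, 1)\<close>
  are minimised.
\<close>
definition min_cone :: "'a::real_inner set \<Rightarrow> 'a set \<Rightarrow> 'a \<Rightarrow> 'a set" where
  "min_cone E C p = {\<alpha>\<in>E. \<forall>y\<in>C. \<alpha> \<bullet> p \<le> \<alpha> \<bullet> y}"

lemma uminus_normal_cone:
  assumes "subspace E"
  shows "uminus ` normal_cone E C p = min_cone E C p"
proof -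
  have neg: "- \<alpha> \<in> E" if "\<alpha> \<in> E" for \<alpha> using assms that by (rule subspace_neg)
  have "\<alpha> \<in> uminus ` normal_cone E C p \<longleftrightarrow> - \<alpha> \<in> normal_cone E C p" for \<alpha>
    by (metis (no_types) image_iff minus_minus)
  moreover have "- \<alpha> \<in> normal_cone E C p \<longleftrightarrow> \<alpha> \<in> min_cone E C p" for \<alpha>
    using neg[of \<alpha>] neg[of "- \<alpha>"] by (auto simp: normal_cone_def min_cone_def inner_diff_right)
  ultimately show ?thesis by blast
qed

lemma min_cone_eq: "min_cone E C p = E \<inter> (\<Inter>y\<in>C. {\<alpha>. (p - y) \<bullet> \<alpha> \<le> 0})"
  by (simp add: min_cone_def inner_diff_le_0_iff) blast

lemma min_cone_convex:
  assumes "convex E" shows "convex (min_cone E C p)"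
  unfolding min_cone_eq by (intro convex_Int convex_INT convex_halfspace_le assms)

lemma zero_in_min_cone: "subspace E \<Longrightarrow> 0 \<in> min_cone E C p"
  by (auto simp: min_cone_def subspace_0)

text \<open>
  The cone is generated by the negated tight constraints at \<open>p\<close>. As there are finitely many tight
  sets, the family \<open>\<B>\<close> can be chosen for all \<open>p\<close> simultaneously, which makes the fan finite.
\<close>
lemma min_cone_finitely_generated:
  fixes C :: "'a::euclidean_space set"
  assumes C: "polyhedron C"
  obtains \<B> where "finite \<B>"
    "\<And>p. p \<in> C \<Longrightarrow> \<exists>B\<in>\<B>. finite B \<and> (\<forall>E. min_cone E C p = E \<inter> convex_cone hull B)"
proof -
  obtain \<A> where \<A>: "finite \<A>"
    "\<And>p. p \<in> C \<Longrightarrow> \<exists>A\<in>\<A>. finite A \<and> (\<forall>a\<in>A. \<forall>q\<in>C. a \<bullet> q \<le> a \<bullet> p) \<and>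
       (\<forall>v. (\<forall>a\<in>A. v \<bullet> a \<le> 0) \<longrightarrow> (\<exists>e>0. p + e *\<^sub>R v \<in> C))"
    using polyhedron_tight_constraints[OF C] by metis
  show thesis
  proof (rule that[of "(`) uminus ` \<A>"])
    show "finite ((`) uminus ` \<A>)" using \<A>(1) by simp
    fix p assume "p \<in> C"
    then obtain A where A: "A \<in> \<A>" "finite A" "\<And>a q. a \<in> A \<Longrightarrow> q \<in> C \<Longrightarrow> a \<bullet> q \<le> a \<bullet> p"
      "\<And>v. (\<forall>a\<in>A. v \<bullet> a \<le> 0) \<Longrightarrow> \<exists>e>0. p + e *\<^sub>R v \<in> C"
      using \<A>(2) by metis
    have "min_cone E C p = E \<inter> convex_cone hull (uminus ` A)" for E
    proof (rule set_eqI iffI)+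
      fix \<beta> assume \<beta>: "\<beta> \<in> min_cone E C p"
      have "\<beta> \<in> convex_cone hull (uminus ` A)"
      proof (rule ccontr)
        assume "\<not> ?thesis"
        then obtain v where v: "\<And>a. a \<in> uminus ` A \<Longrightarrow> v \<bullet> a \<le> 0" "v \<bullet> \<beta> > 0"
          using convex_cone_hull_separation[of "uminus ` A" \<beta>] A(2) by blast
        have "(- v) \<bullet> a \<le> 0" if "a \<in> A" for a using v(1)[of "- a"] that by simp
        then obtain e where "e > 0" "p + e *\<^sub>R (- v) \<in> C" using A(4) by blast
        then have "\<beta> \<bullet> p \<le> \<beta> \<bullet> (p + e *\<^sub>R (- v))" "e > 0"
          using \<beta> unfolding min_cone_def by blast+
        then have "e * (v \<bullet> \<beta>) \<le> 0" by (simp add: inner_diff_right inner_commute[of \<beta> v])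
        with v(2) \<open>e > 0\<close> show False by (simp add: mult_le_0_iff)
      qed
      then show "\<beta> \<in> E \<inter> convex_cone hull (uminus ` A)" using \<beta> unfolding min_cone_def by blast
    next
      fix \<beta> assume \<beta>: "\<beta> \<in> E \<inter> convex_cone hull (uminus ` A)"
      have "(p - y) \<bullet> \<beta> \<le> 0" if "y \<in> C" for y
      proof (rule convex_cone_hull_nonpos[of "uminus ` A"])
        fix a assume "a \<in> uminus ` A"
        then show "(p - y) \<bullet> a \<le> 0"
          using A(3)[OF _ that] unfolding inner_diff_le_0_iff by fastforce
      qed (use \<beta> in auto)
      then show "\<beta> \<in> min_cone E C p" using \<beta> unfolding min_cone_eq by blast
    qed
    moreover have "uminus ` A \<in> (`) uminus ` \<A>" "finite (uminus ` A)" using A(1,2) by auto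
    ultimately show "\<exists>B\<in>(`) uminus ` \<A>. finite B \<and> (\<forall>E. min_cone E C p = E \<inter> convex_cone hull B)"
      by (intro bexI[of _ "uminus ` A"] conjI allI)
  qed
qed

lemma finite_min_cones:
  fixes C :: "'a::euclidean_space set"
  assumes C: "polyhedron C"
  shows "finite (min_cone E C ` C)"
proof -
  obtain \<B> where \<B>: "finite \<B>"
    "\<And>p. p \<in> C \<Longrightarrow> \<exists>B\<in>\<B>. finite B \<and> (\<forall>E. min_cone E C p = E \<inter> convex_cone hull B)"
    using min_cone_finitely_generated[OF C] by metis
  have "min_cone E C ` C \<subseteq> (\<lambda>B. E \<inter> convex_cone hull B) ` \<B>"
  proof (rule image_subsetI)
    fix p assume "p \<in> C"
    from \<B>(2)[OF this] show "min_cone E C p \<in> (\<lambda>B. E \<inter> convex_cone hull B) ` \<B>"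
      by (metis image_eqI)
  qed
  then show ?thesis by (rule finite_surj[OF \<B>(1)])
qed

lemma polyhedron_min_cone:
  fixes C :: "'a::euclidean_space set"
  assumes C: "polyhedron C" "p \<in> C" and E: "subspace E"
  shows "polyhedron (min_cone E C p)"
proof -
  obtain \<B> where "\<And>p. p \<in> C \<Longrightarrow> \<exists>B\<in>\<B>. finite B \<and> (\<forall>E. min_cone E C p = E \<inter> convex_cone hull B)"
    using min_cone_finitely_generated[OF C(1)] by metis
  from this[OF C(2)] obtain B where B: "finite B" "min_cone E C p = E \<inter> convex_cone hull B"
    by (elim bexE conjE allE)
  show ?thesis unfolding B(2) using B(1)
    using affine_imp_polyhedron[OF subspace_imp_affine[OF E]] polyhedron_convex_cone_hull by auto
qed

text \<open>
  An interior functional \<open>\<alpha>\<close> of \<open>N\<close> is a strict mean of any given \<open>\<beta> \<in> N\<close> and another member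
  of \<open>N\<close>. All of \<open>N\<close> is minimised at \<open>p\<close>; if the mean is minimised at \<open>q\<close> as well, then both
  terms must be.
\<close>
lemma min_cone_absorbs:
  fixes E :: "'a::euclidean_space set"
  assumes N: "N \<subseteq> min_cone E C p" "convex N" and \<alpha>: "\<alpha> \<in> rel_interior N"
    and p: "p \<in> C" and q: "q \<in> C" "\<alpha> \<in> min_cone E' C q" and E: "N \<subseteq> E'"
  shows "N \<subseteq> min_cone E' C q"
proof
  fix \<beta> assume \<beta>: "\<beta> \<in> N"
  obtain e where e: "e > 1" "(1 - e) *\<^sub>R \<beta> + e *\<^sub>R \<alpha> \<in> N"
    using convex_rel_interior_iff[OF N(2), of \<alpha>] \<alpha> \<beta> by blast
  have "((1 - e) *\<^sub>R \<beta> + e *\<^sub>R \<alpha>) \<bullet> p \<le> ((1 - e) *\<^sub>R \<beta> + e *\<^sub>R \<alpha>) \<bullet> q"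
    using e(2) N(1) q(1) by (auto simp: min_cone_def)
  then have "(e - 1) * (\<beta> \<bullet> q) - (e - 1) * (\<beta> \<bullet> p) \<le> e * (\<alpha> \<bullet> q) - e * (\<alpha> \<bullet> p)"
    by (simp add: inner_add_left algebra_simps)
  also have "\<dots> \<le> 0" using q(2) p e(1) by (simp add: min_cone_def mult_left_mono)
  finally have "(e - 1) * (\<beta> \<bullet> q) \<le> (e - 1) * (\<beta> \<bullet> p)" by simp
  then have "\<beta> \<bullet> q \<le> \<beta> \<bullet> p" using e(1) by simp
  then show "\<beta> \<in> min_cone E' C q"
    using \<beta> N(1) E by (fastforce simp: min_cone_def)
qed

text \<open>
  The relative interiors of the cones of a fan cover its support: \<open>\<alpha>\<close> is a relative interior point
  of a face of the cone at \<open>p\<close>, that face is exposed by some \<open>v\<close>, which is a feasible direction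
  at \<open>p\<close>, and a short step along \<open>v\<close> leads to a point whose cone is precisely this face.
\<close>
lemma min_cone_relint_exists:
  fixes C :: "'a::euclidean_space set"
  assumes C: "polyhedron C" "C \<subseteq> E" and E: "subspace E" and p: "p \<in> C" "\<alpha> \<in> min_cone E C p"
  obtains q where "q \<in> C" "\<alpha> \<in> rel_interior (min_cone E C q)"
proof -
  let ?K = "min_cone E C p"
  have K: "polyhedron ?K" using polyhedron_min_cone[OF C(1) p(1) E] .
  obtain F where F: "F face_of ?K" "\<alpha> \<in> rel_interior F"
    using relint_face_exists[OF K p(2)] .
  have \<alpha>F: "\<alpha> \<in> F" using F(2) rel_interior_subset by blast
  show thesis
  proof (cases "F = ?K")
    case True then show thesis using that p(1) F(2) by blast
  next
    case False
    have "F exposed_face_of ?K" using exposed_face_of_polyhedron[OF K] F(1) by blast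
    then obtain a b where ab: "?K \<subseteq> {x. a \<bullet> x \<le> b}" "F = ?K \<inter> {x. a \<bullet> x = b}"
      using False \<alpha>F by (auto simp: exposed_face_of)
    \<comment> \<open>The supporting hyperplane passes through the apex of the cone.\<close>
    have b0: "b = 0"
    proof -
      have "2 *\<^sub>R \<alpha> \<in> ?K"
        using p(2) subspace_scale[OF E, of \<alpha> 2] by (auto simp: min_cone_def)
      then have "a \<bullet> (2 *\<^sub>R \<alpha>) \<le> b" using ab(1) by blast
      moreover have "a \<bullet> \<alpha> = b" using ab(2) \<alpha>F by blast
      moreover have "a \<bullet> 0 \<le> b" using ab(1) zero_in_min_cone[OF E, of C p] by blast
      ultimately show ?thesis by simp
    qed
    obtain v z where vz: "v \<in> span E" "\<And>w. w \<in> span E \<Longrightarrow> orthogonal z w" "- a = v + z"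
      using orthogonal_subspace_decomp_exists[of E "- a"] by metis
    have av: "v \<bullet> \<beta> = - (a \<bullet> \<beta>)" if "\<beta> \<in> E" for \<beta>
    proof -
      have "z \<bullet> \<beta> = 0" using vz(2) span_base[OF that] by (simp add: orthogonal_def)
      moreover have "- (a \<bullet> \<beta>) = v \<bullet> \<beta> + z \<bullet> \<beta>"
        using vz(3) by (metis inner_add_left inner_minus_left)
      ultimately show ?thesis by simp
    qed
    have spanE: "span E = E" using E by (simp only: span_eq_iff)
    have vE: "v \<in> E" using vz(1) spanE by simp
    have vK: "v \<bullet> \<beta> \<ge> 0" if "\<beta> \<in> ?K" for \<beta>
      using ab(1) that b0 av[of \<beta>] by (auto simp: min_cone_def)
    have "\<exists>e>0. p + e *\<^sub>R v \<in> C"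
    proof -
      obtain A where A: "finite A" "\<And>a q. a \<in> A \<Longrightarrow> q \<in> C \<Longrightarrow> a \<bullet> q \<le> a \<bullet> p"
        "\<And>v. (\<forall>a\<in>A. v \<bullet> a \<le> 0) \<Longrightarrow> \<exists>e>0. p + e *\<^sub>R v \<in> C"
        using polyhedron_tight_constraints[OF C(1)] p(1) by metis
      have "v \<bullet> d \<le> 0" if d: "d \<in> A" for d
      proof -
        obtain d' y where dy: "d' \<in> span E" "\<And>w. w \<in> span E \<Longrightarrow> orthogonal y w" "d = d' + y"
          using orthogonal_subspace_decomp_exists[of E d] by metis
        have d': "d' \<bullet> w = d \<bullet> w" if "w \<in> E" for w
          using dy(2)[OF span_base[OF that]] dy(3) by (simp add: orthogonal_def inner_add_left)
        have "- d' \<in> ?K"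
          using dy(1) spanE A(2)[OF d] C(2) p(1) d' subspace_neg[OF E]
          by (auto simp: min_cone_def subset_iff)
        then show ?thesis using vK[of "- d'"] d'[OF vE] by (simp add: inner_commute)
      qed
      then show ?thesis using A(3) by blast
    qed
    then obtain e where e: "e > 0" "p + e *\<^sub>R v \<in> C" by blast
    \<comment> \<open>The step is halved so that \<open>q\<close> lies strictly between two points of \<open>C\<close>; this forces the
      functionals minimised at \<open>q\<close> to vanish on \<open>v\<close>.\<close>
    define q where "q = p + (e / 2) *\<^sub>R v"
    have "(1/2) *\<^sub>R p + (1/2) *\<^sub>R (p + e *\<^sub>R v) = (1/2 + 1/2) *\<^sub>R p + (e / 2) *\<^sub>R v"
      unfolding scaleR_add_left scaleR_add_right by simp
    then have "q = (1/2) *\<^sub>R p + (1/2) *\<^sub>R (p + e *\<^sub>R v)" by (simp add: q_def)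
    then have q: "q \<in> C"
      using convexD[OF polyhedron_imp_convex[OF C(1)] p(1) e(2), of "1/2" "1/2"] by simp
    have "min_cone E C q = F"
    proof (rule set_eqI iffI)+
      fix \<beta> assume \<beta>: "\<beta> \<in> min_cone E C q"
      then have 1: "\<beta> \<bullet> q \<le> \<beta> \<bullet> p" "\<beta> \<bullet> q \<le> \<beta> \<bullet> (p + e *\<^sub>R v)"
        using p(1) e(2) by (auto simp: min_cone_def)
      then have "(e/2) * (\<beta> \<bullet> v) \<le> 0" "0 \<le> (e/2) * (\<beta> \<bullet> v)"
        by (auto simp: q_def inner_add_right)
      then have 0: "\<beta> \<bullet> v = 0" using e(1) by (simp add: mult_le_0_iff zero_le_mult_iff)
      then have "\<beta> \<bullet> q = \<beta> \<bullet> p" by (simp add: q_def inner_add_right)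
      then have "\<beta> \<in> ?K" using \<beta> by (auto simp: min_cone_def)
      moreover have "a \<bullet> \<beta> = 0" using av[of \<beta>] 0 \<beta> by (simp add: min_cone_def inner_commute)
      ultimately show "\<beta> \<in> F" using ab(2) b0 by simp
    next
      fix \<beta> assume "\<beta> \<in> F"
      then have \<beta>: "\<beta> \<in> ?K" "a \<bullet> \<beta> = 0" using ab(2) b0 by auto
      then have "v \<bullet> \<beta> = 0" using av[of \<beta>] by (auto simp: min_cone_def)
      then have "\<beta> \<bullet> q = \<beta> \<bullet> p" by (simp add: q_def inner_add_right inner_commute)
      then show "\<beta> \<in> min_cone E C q" using \<beta>(1) by (auto simp: min_cone_def)
    qed
    then show thesis using that[OF q] F(2) by simp
  qed
qed

section \<open>Common refinements\<close>

lemma finite_common_refinement: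
  assumes "finite I" "\<And>i. i \<in> I \<Longrightarrow> finite (\<C> i)"
  shows "finite (common_refinement E I \<C>)"
proof -
  have "common_refinement E I \<C> \<subseteq> (\<lambda>S. E \<inter> (\<Inter>i\<in>I. S i)) ` (PiE I \<C>)"
  proof
    fix X assume "X \<in> common_refinement E I \<C>"
    then obtain S where S: "X = E \<inter> (\<Inter>i\<in>I. S i)" "\<forall>i\<in>I. S i \<in> \<C> i"
      by (auto simp: common_refinement_def)
    then have "X = E \<inter> (\<Inter>i\<in>I. restrict S I i)" "restrict S I \<in> PiE I \<C>" by auto
    then show "X \<in> (\<lambda>S. E \<inter> (\<Inter>i\<in>I. S i)) ` (PiE I \<C>)" by blast
  qed
  then show ?thesis using assms by (meson finite_PiE finite_surj)
qed

lemma convex_common_refinement: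
  assumes "convex E" "\<And>i S. i \<in> I \<Longrightarrow> S \<in> \<C> i \<Longrightarrow> convex S" "X \<in> common_refinement E I \<C>"
  shows "convex X"
  using assms by (auto simp: common_refinement_def intro!: convex_Int convex_INT)

text \<open>
  The set \<open>E\<close> is kept apart from the family because the common refinement of an empty family
  is \<open>{E}\<close>.
\<close>
lemma relint_Int_INT:
  fixes E :: "'a::euclidean_space set"
  assumes I: "finite I" and E: "convex E" "x \<in> rel_interior E"
    and S: "\<And>i. i \<in> I \<Longrightarrow> convex (S i)" "\<And>i. i \<in> I \<Longrightarrow> x \<in> rel_interior (S i)"
  shows "x \<in> rel_interior (E \<inter> (\<Inter>i\<in>I. S i))"
proof -
  have "rel_interior (\<Inter>(insert E (S ` I))) = \<Inter>(rel_interior ` insert E (S ` I))"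
    using assms by (intro convex_rel_interior_finite_Inter) auto
  then show ?thesis using assms by auto
qed

text \<open>
  A functional in both relative interiors is minimised at the points that define either cone, so
  by \<open>min_cone_absorbs\<close> each cone is contained in the other.
\<close>
lemma refined_fan_relint_disjoint:
  fixes E :: "'a::euclidean_space set"
  assumes E: "convex E"
    and N: "N \<in> common_refinement E I (\<lambda>i. min_cone E (C i) ` C i)"
    and N': "N' \<in> common_refinement E I (\<lambda>i. min_cone E (C i) ` C i)"
    and \<alpha>: "\<alpha> \<in> rel_interior N" "\<alpha> \<in> rel_interior N'"
  shows "N = N'"
proof -
  have sub: "N \<subseteq> N'"
    if N: "N \<in> common_refinement E I (\<lambda>i. min_cone E (C i) ` C i)"
    and N': "N' \<in> common_refinement E I (\<lambda>i. min_cone E (C i) ` C i)"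
    and \<alpha>: "\<alpha> \<in> rel_interior N" "\<alpha> \<in> rel_interior N'" for N N'
  proof -
    obtain S where S: "N = E \<inter> (\<Inter>i\<in>I. S i)" "\<forall>i\<in>I. S i \<in> min_cone E (C i) ` C i"
      using N by (auto simp: common_refinement_def)
    obtain S' where S': "N' = E \<inter> (\<Inter>i\<in>I. S' i)" "\<forall>i\<in>I. S' i \<in> min_cone E (C i) ` C i"
      using N' by (auto simp: common_refinement_def)
    have cN: "convex N"
      using convex_common_refinement[OF E _ N] min_cone_convex[OF E] by blast
    have "N \<subseteq> S' i" if i: "i \<in> I" for i
    proof -
      obtain p where p: "p \<in> C i" "S i = min_cone E (C i) p" using S(2) i by auto
      obtain q where q: "q \<in> C i" "S' i = min_cone E (C i) q" using S'(2) i by auto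
      have "\<alpha> \<in> S' i" using \<alpha>(2) rel_interior_subset[of N'] S'(1) i by auto
      then show ?thesis
        using min_cone_absorbs[of N E "C i" p \<alpha> q E] S(1) i p q cN \<alpha>(1) by auto
    qed
    then show ?thesis using S(1) S'(1) by auto
  qed
  show ?thesis using sub[OF N N' \<alpha>] sub[OF N' N \<alpha>(2) \<alpha>(1)] by simp
qed

text \<open>
  Each fan contributes a cone with \<open>\<alpha>\<close> in its relative interior, and finite intersections of convex
  sets that share a relative interior point commute with relative interiors.
\<close>
lemma refined_fan_relint_covers:
  fixes E :: "'a::euclidean_space set"
  assumes E: "subspace E" and I: "finite I"
    and C: "\<And>i. i \<in> I \<Longrightarrow> polyhedron (C i)" "\<And>i. i \<in> I \<Longrightarrow> C i \<subseteq> E"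
    and \<alpha>: "\<alpha> \<in> E" "\<And>i. i \<in> I \<Longrightarrow> \<exists>p\<in>C i. \<alpha> \<in> min_cone E (C i) p"
  obtains N where "N \<in> common_refinement E I (\<lambda>i. min_cone E (C i) ` C i)" "\<alpha> \<in> rel_interior N"
proof -
  have "\<exists>q. q \<in> C i \<and> \<alpha> \<in> rel_interior (min_cone E (C i) q)" if "i \<in> I" for i
    using \<alpha>(2)[OF that] min_cone_relint_exists[OF C[OF that] E] by metis
  then obtain q where q: "\<And>i. i \<in> I \<Longrightarrow> q i \<in> C i \<and> \<alpha> \<in> rel_interior (min_cone E (C i) (q i))"
    by metis
  have cE: "convex E" using E by (rule subspace_imp_convex)
  have "\<alpha> \<in> rel_interior E"
    using \<alpha>(1) rel_interior_affine[OF subspace_imp_affine[OF E]] by simp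
  then have "\<alpha> \<in> rel_interior (E \<inter> (\<Inter>i\<in>I. min_cone E (C i) (q i)))"
    using q I cE min_cone_convex[OF cE] by (intro relint_Int_INT) auto
  moreover have "E \<inter> (\<Inter>i\<in>I. min_cone E (C i) (q i)) \<in> common_refinement E I (\<lambda>i. min_cone E (C i) ` C i)"
    using q by (auto simp: common_refinement_def intro!: exI[of _ "\<lambda>i. min_cone E (C i) (q i)"])
  ultimately show thesis using that by blast
qed

section \<open>Families of convex cells stratified by relative interiors\<close>

text \<open>
  A polyhedral complex has this property, which is weaker: the intersection of two cells need not be
  a face of either. It suffices for the transfer of normal cones between the points of a chamber,
  and unlike the face condition it passes through projections and refinements by elementary
  arguments.
\<close>
definition relint_stratified :: "'a::euclidean_space set set \<Rightarrow> bool" where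
  "relint_stratified \<C> \<longleftrightarrow> finite \<C> \<and>
     (\<forall>C\<in>\<C>. convex C \<and> (\<forall>x\<in>C. \<exists>D\<in>\<C>. D \<subseteq> C \<and> x \<in> rel_interior D))"

lemma relint_stratifiedI:
  assumes "finite \<C>" "\<And>C. C \<in> \<C> \<Longrightarrow> convex C"
    "\<And>C x. C \<in> \<C> \<Longrightarrow> x \<in> C \<Longrightarrow> \<exists>D\<in>\<C>. D \<subseteq> C \<and> x \<in> rel_interior D"
  shows "relint_stratified \<C>"
  using assms by (simp add: relint_stratified_def)

lemma relint_stratifiedD:
  assumes "relint_stratified \<C>"
  shows "finite \<C>" "C \<in> \<C> \<Longrightarrow> convex C"
    "C \<in> \<C> \<Longrightarrow> x \<in> C \<Longrightarrow> \<exists>D\<in>\<C>. D \<subseteq> C \<and> x \<in> rel_interior D"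
  using assms by (simp_all add: relint_stratified_def)

lemma relint_stratified_affine:
  assumes "affine E" shows "relint_stratified {E}"
  using assms by (simp add: relint_stratified_def affine_imp_convex rel_interior_affine)

lemma relint_stratified_face_complex:
  assumes "polyhedron P" shows "relint_stratified (face_complex P)"
proof (rule relint_stratifiedI)
  show "finite (face_complex P)"
    using finite_polyhedron_faces[OF assms] by (rule rev_finite_subset) (auto simp: face_complex_def)
next
  fix F assume "F \<in> face_complex P"
  then have F: "F face_of P" by (simp add: face_complex_def)
  then show "convex F" by (rule face_of_imp_convex)
  fix x assume "x \<in> F"
  then obtain D where D: "D face_of F" "x \<in> rel_interior D"
    using relint_face_exists face_of_polyhedron_polyhedron[OF assms F] by metis
  have "D face_of P" using face_of_trans[OF D(1) F] .
  moreover have "D \<noteq> {}" using D(2) by auto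
  ultimately show "\<exists>D\<in>face_complex P. D \<subseteq> F \<and> x \<in> rel_interior D"
    using D face_of_imp_subset[OF D(1)] by (auto simp: face_complex_def)
qed

lemma relint_stratified_Times:
  fixes X :: "'a::euclidean_space set" and \<C> :: "'b::euclidean_space set set"
  assumes X: "affine X" and \<C>: "relint_stratified \<C>"
  shows "relint_stratified ((\<times>) X ` \<C>)"
proof (rule relint_stratifiedI)
  show "finite ((\<times>) X ` \<C>)" using relint_stratifiedD(1)[OF \<C>] by simp
next
  fix F assume "F \<in> (\<times>) X ` \<C>"
  then obtain C where C: "C \<in> \<C>" "F = X \<times> C" by auto
  show "convex F"
    unfolding C(2) using affine_imp_convex[OF X] relint_stratifiedD(2)[OF \<C> C(1)] by (rule convex_Times)
  fix p assume p: "p \<in> F"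
  then obtain D where D: "D \<in> \<C>" "D \<subseteq> C" "snd p \<in> rel_interior D"
    using relint_stratifiedD(3)[OF \<C> C(1), of "snd p"] C(2) by auto
  have "rel_interior (X \<times> D) = X \<times> rel_interior D"
    using rel_interior_Times[OF affine_imp_convex[OF X] relint_stratifiedD(2)[OF \<C> D(1)]]
      rel_interior_affine[OF X] by simp
  then have "X \<times> D \<in> (\<times>) X ` \<C>" "X \<times> D \<subseteq> F" "p \<in> rel_interior (X \<times> D)"
    using D C(2) p by (auto simp: mem_Times_iff)
  then show "\<exists>D\<in>(\<times>) X ` \<C>. D \<subseteq> F \<and> p \<in> rel_interior D" by (intro bexI[of _ "X \<times> D"] conjI)
qed

lemma relint_stratified_meet:
  assumes \<C>: "relint_stratified \<C>" and \<D>: "relint_stratified \<D>"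
  shows "relint_stratified (meet \<C> \<D>)"
proof (rule relint_stratifiedI)
  have "meet \<C> \<D> = (\<lambda>(C, D). C \<inter> D) ` (\<C> \<times> \<D>)" by (auto simp: meet_def)
  then show "finite (meet \<C> \<D>)" using relint_stratifiedD(1)[OF \<C>] relint_stratifiedD(1)[OF \<D>] by simp
next
  fix F assume "F \<in> meet \<C> \<D>"
  then obtain C D where CD: "C \<in> \<C>" "D \<in> \<D>" "F = C \<inter> D" by (auto simp: meet_def)
  show "convex F"
    unfolding CD(3) using relint_stratifiedD(2)[OF \<C> CD(1)] relint_stratifiedD(2)[OF \<D> CD(2)]
    by (rule convex_Int)
  fix x assume x: "x \<in> F"
  obtain C' where C': "C' \<in> \<C>" "C' \<subseteq> C" "x \<in> rel_interior C'"
    using relint_stratifiedD(3)[OF \<C> CD(1), of x] x CD(3) by auto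
  obtain D' where D': "D' \<in> \<D>" "D' \<subseteq> D" "x \<in> rel_interior D'"
    using relint_stratifiedD(3)[OF \<D> CD(2), of x] x CD(3) by auto
  have "x \<in> rel_interior (C' \<inter> (\<Inter>i\<in>{()}. D'))"
    using relint_stratifiedD(2)[OF \<C> C'(1)] relint_stratifiedD(2)[OF \<D> D'(1)] C'(3) D'(3)
    by (intro relint_Int_INT) auto
  then have "x \<in> rel_interior (C' \<inter> D')" by simp
  moreover have "C' \<inter> D' \<in> meet \<C> \<D>" using C'(1) D'(1) by (auto simp: meet_def)
  moreover have "C' \<inter> D' \<subseteq> F" using C'(2) D'(2) CD(3) by blast
  ultimately show "\<exists>D\<in>meet \<C> \<D>. D \<subseteq> F \<and> x \<in> rel_interior D" by blast
qed

lemma mem_chamber: "x \<in> chamber \<P> \<pi> x"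
  by (auto simp: chamber_def)

lemma chamber_subset: "F \<in> \<P> \<Longrightarrow> x \<in> \<pi> ` F \<Longrightarrow> chamber \<P> \<pi> x \<subseteq> \<pi> ` F"
  by (auto simp: chamber_def)

lemma convex_chamber:
  assumes "linear \<pi>" "\<And>F. F \<in> \<P> \<Longrightarrow> convex F"
  shows "convex (chamber \<P> \<pi> x)"
  unfolding chamber_def using assms by (auto intro!: convex_Inter convex_linear_image)

text \<open>
  Only the cells whose relative interior meets the fiber over \<open>x\<close> matter for the chamber of \<open>x\<close>,
  and \<open>x\<close> is a relative interior point of the projections of those.
\<close>
lemma mem_relint_chamber:
  fixes \<pi> :: "'a::euclidean_space \<Rightarrow> 'b::euclidean_space"
  assumes \<pi>: "linear \<pi>" and \<P>: "relint_stratified \<P>"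
  shows "x \<in> rel_interior (chamber \<P> \<pi> x)"
proof -
  let ?D = "{F\<in>\<P>. x \<in> \<pi> ` rel_interior F}"
  have "chamber \<P> \<pi> x = UNIV \<inter> (\<Inter>F\<in>?D. \<pi> ` F)"
  proof (rule antisym)
    have "x \<in> \<pi> ` F" if "F \<in> ?D" for F using that rel_interior_subset[of F] by auto
    then show "chamber \<P> \<pi> x \<subseteq> UNIV \<inter> (\<Inter>F\<in>?D. \<pi> ` F)"
      using chamber_subset[of _ \<P> x \<pi>] by (intro Int_greatest subset_UNIV INT_greatest) auto
    show "UNIV \<inter> (\<Inter>F\<in>?D. \<pi> ` F) \<subseteq> chamber \<P> \<pi> x"
    proof
      fix z assume z: "z \<in> UNIV \<inter> (\<Inter>F\<in>?D. \<pi> ` F)"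
      have "z \<in> \<pi> ` F" if F: "F \<in> \<P>" "x \<in> \<pi> ` F" for F
      proof -
        obtain y where y: "y \<in> F" "x = \<pi> y" using F(2) by auto
        obtain D where "D \<in> \<P>" "D \<subseteq> F" "y \<in> rel_interior D"
          using relint_stratifiedD(3)[OF \<P> F(1) y(1)] by auto
        then show ?thesis using z y(2) by fastforce
      qed
      then show "z \<in> chamber \<P> \<pi> x" by (auto simp: chamber_def)
    qed
  qed
  moreover have "x \<in> rel_interior (UNIV \<inter> (\<Inter>F\<in>?D. \<pi> ` F))"
  proof (rule relint_Int_INT)
    fix F assume F: "F \<in> ?D"
    then have "convex F" using relint_stratifiedD(2)[OF \<P>] by auto
    then show "convex (\<pi> ` F)" "x \<in> rel_interior (\<pi> ` F)"
      using F \<pi> by (auto intro: convex_linear_image simp flip: rel_interior_convex_linear_image)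
  qed (use relint_stratifiedD(1)[OF \<P>] in auto)
  ultimately show ?thesis by simp
qed

lemma relint_stratified_chamber_complex:
  fixes \<pi> :: "'a::euclidean_space \<Rightarrow> 'b::euclidean_space"
  assumes \<pi>: "linear \<pi>" and \<P>: "relint_stratified \<P>"
  shows "relint_stratified (chamber_complex \<P> \<pi>)"
proof (rule relint_stratifiedI)
  have "chamber_complex \<P> \<pi> \<subseteq> Inter ` Pow ((`) \<pi> ` \<P>)"
    unfolding chamber_complex_def chamber_def by (intro image_subsetI imageI) auto
  then show "finite (chamber_complex \<P> \<pi>)"
    using relint_stratifiedD(1)[OF \<P>] by (meson finite_Pow_iff finite_imageI finite_subset)
next
  fix C assume "C \<in> chamber_complex \<P> \<pi>"
  then obtain x where x: "C = chamber \<P> \<pi> x" "x \<in> \<pi> ` \<Union>\<P>" by (auto simp: chamber_complex_def)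
  show "convex C"
    unfolding x(1) using convex_chamber[OF \<pi>] relint_stratifiedD(2)[OF \<P>] by blast
  fix z assume "z \<in> C"
  then have z: "z \<in> chamber \<P> \<pi> x" using x(1) by simp
  have "chamber \<P> \<pi> z \<subseteq> C" using z unfolding x(1) chamber_def by fastforce
  moreover obtain F where "F \<in> \<P>" "x \<in> \<pi> ` F" using x(2) by auto
  then have "z \<in> \<pi> ` \<Union>\<P>" using z by (fastforce simp: chamber_def)
  then have "chamber \<P> \<pi> z \<in> chamber_complex \<P> \<pi>" by (auto simp: chamber_complex_def)
  ultimately show "\<exists>D\<in>chamber_complex \<P> \<pi>. D \<subseteq> C \<and> z \<in> rel_interior D"
    using mem_relint_chamber[OF \<pi> \<P>] by blast
qed

lemma Union_chamber_complex: "\<Union>(chamber_complex \<P> \<pi>) = \<pi> ` \<Union>\<P>"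
proof
  show "\<pi> ` \<Union>\<P> \<subseteq> \<Union>(chamber_complex \<P> \<pi>)"
    using mem_chamber by (fastforce simp: chamber_complex_def)
  show "\<Union>(chamber_complex \<P> \<pi>) \<subseteq> \<pi> ` \<Union>\<P>"
    by (fastforce simp: chamber_complex_def chamber_def)
qed

lemma relint_stratified_common_refinement:
  fixes E :: "'a::euclidean_space set"
  assumes E: "affine E" and I: "finite I" and \<C>: "\<And>i. i \<in> I \<Longrightarrow> relint_stratified (\<C> i)"
  shows "relint_stratified (common_refinement E I \<C>)"
proof (rule relint_stratifiedI)
  show "finite (common_refinement E I \<C>)"
    using I relint_stratifiedD(1)[OF \<C>] by (rule finite_common_refinement)
next
  fix X assume X: "X \<in> common_refinement E I \<C>"
  then show "convex X"
    using convex_common_refinement[OF affine_imp_convex[OF E]] relint_stratifiedD(2)[OF \<C>] by metis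
  obtain S where S: "X = E \<inter> (\<Inter>i\<in>I. S i)" "\<forall>i\<in>I. S i \<in> \<C> i"
    using X by (auto simp: common_refinement_def)
  fix x assume x: "x \<in> X"
  have "\<exists>D. D \<in> \<C> i \<and> D \<subseteq> S i \<and> x \<in> rel_interior D" if "i \<in> I" for i
    using relint_stratifiedD(3)[OF \<C>[OF that], of "S i" x] S x that by auto
  then obtain D where D: "\<And>i. i \<in> I \<Longrightarrow> D i \<in> \<C> i \<and> D i \<subseteq> S i \<and> x \<in> rel_interior (D i)"
    by metis
  have "x \<in> rel_interior (E \<inter> (\<Inter>i\<in>I. D i))"
    using D x S(1) relint_stratifiedD(2)[OF \<C>] rel_interior_affine[OF E]
    by (intro relint_Int_INT I affine_imp_convex[OF E]) auto
  moreover have "E \<inter> (\<Inter>i\<in>I. D i) \<in> common_refinement E I \<C>"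
    using D by (auto simp: common_refinement_def)
  moreover have "E \<inter> (\<Inter>i\<in>I. D i) \<subseteq> X" using D S(1) by blast
  ultimately show "\<exists>D\<in>common_refinement E I \<C>. D \<subseteq> X \<and> x \<in> rel_interior D" by blast
qed

section \<open>Parametric minimisation over a piecewise affine epigraph\<close>

text \<open>
  If a functional attains its minimum over the fiber of \<open>x1\<close> at a relative interior point of a
  cell \<open>G\<close> on which the cost is affine, then the multiplier makes the reduced cost constant on
  \<open>G\<close>: it is affine, and minimal at a relative interior point. Hence all of \<open>G\<close> is optimal.
\<close>
lemma fiber_minimum_along_cell:
  fixes K :: "('a::euclidean_space \<times> 'b::euclidean_space \<times> real) set"
  assumes K: "polyhedron K" and G: "convex G"
    and graph: "\<And>x y. (x, y) \<in> G \<Longrightarrow> (x, y, f (x, y)) \<in> K"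
    and aff: "\<And>p. p \<in> G \<Longrightarrow> f p = q \<bullet> p + \<beta>"
    and p1: "(x1, y1) \<in> rel_interior G"
    and min: "\<And>w. (x1, w) \<in> K \<Longrightarrow> \<alpha> \<bullet> (y1, f (x1, y1)) \<le> \<alpha> \<bullet> w"
  obtains g where
    "\<And>x y w. (x, y) \<in> G \<Longrightarrow> (x, w) \<in> K \<Longrightarrow> \<alpha> \<bullet> (y, f (x, y)) \<le> \<alpha> \<bullet> w"
    "\<And>x y. (x, y) \<in> G \<Longrightarrow> \<alpha> \<bullet> (y, f (x, y)) = \<alpha> \<bullet> (y1, f (x1, y1)) + g \<bullet> (x - x1)"
proof -
  have p1G: "(x1, y1) \<in> G" using p1 rel_interior_subset by blast
  obtain g where g: "\<And>x w. (x, w) \<in> K \<Longrightarrow> \<alpha> \<bullet> (y1, f (x1, y1)) - g \<bullet> x1 \<le> \<alpha> \<bullet> w - g \<bullet> x"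
    using fiber_minimum_multiplier[OF K graph[OF p1G] min] by blast
  have eq: "\<alpha> \<bullet> (y, f (x, y)) = \<alpha> \<bullet> (y1, f (x1, y1)) + g \<bullet> (x - x1)" if xy: "(x, y) \<in> G" for x y
  proof -
    define h where "h p = (- g, fst \<alpha>) \<bullet> p + snd \<alpha> * (q \<bullet> p + \<beta>)" for p
    have h: "h (x, y) = \<alpha> \<bullet> (y, f (x, y)) - g \<bullet> x" if "(x, y) \<in> G" for x y
      using aff[OF that] by (simp add: h_def inner_prod_def)
    have hmin: "h (x1, y1) \<le> h p" if "p \<in> G" for p
      using g[OF graph, of "fst p" "snd p"] h[of "fst p" "snd p"] h[OF p1G] that by simp
    obtain e where e: "e > 1" "(1 - e) *\<^sub>R (x, y) + e *\<^sub>R (x1, y1) \<in> G"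
      using convex_rel_interior_iff[OF G, of "(x1, y1)"] p1 xy by blast
    have "h ((1 - e) *\<^sub>R (x, y) + e *\<^sub>R (x1, y1)) = (1 - e) * h (x, y) + e * h (x1, y1)"
      unfolding h_def inner_add_right inner_scaleR_right by (simp add: algebra_simps)
    with hmin[OF e(2)] have "(e - 1) * h (x, y) \<le> (e - 1) * h (x1, y1)"
      by (simp add: algebra_simps)
    then have "h (x, y) \<le> h (x1, y1)" using e(1) by simp
    with hmin[OF xy] have "h (x, y) = h (x1, y1)" by simp
    then show ?thesis using h[OF xy] h[OF p1G] by (simp add: inner_diff_right)
  qed
  show thesis
  proof (rule that[OF _ eq])
    fix x y w assume "(x, y) \<in> G" "(x, w) \<in> K"
    then show "\<alpha> \<bullet> (y, f (x, y)) \<le> \<alpha> \<bullet> w"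
      using g[of x w] eq[of x y] by (simp add: inner_diff_right)
  qed
qed

text \<open>
  Here \<open>K\<close> is the epigraph of \<open>f\<close> over the support of \<open>\<R>\<close>, and \<open>(x, y)\<close> consists of the
  parameter and the decision. The convexity of \<open>f\<close> is contained in that of \<open>K\<close>.
\<close>
locale piecewise_affine_epigraph =
  fixes K :: "('a::euclidean_space \<times> 'b::euclidean_space \<times> real) set"
    and \<R> :: "('a \<times> 'b) set set" and f :: "'a \<times> 'b \<Rightarrow> real"
  assumes polyhedron_K: "polyhedron K"
    and stratified: "relint_stratified \<R>"
    and affine_on_cell: "G \<in> \<R> \<Longrightarrow> \<exists>q \<beta>. \<forall>p\<in>G. f p = q \<bullet> p + \<beta>"
    and K_iff: "(x, y, z) \<in> K \<longleftrightarrow> (x, y) \<in> \<Union>\<R> \<and> f (x, y) \<le> z"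
begin

text \<open>
  Fibers of an epigraph are unbounded upwards, which a functional with a minimum must not reward.
\<close>
lemma slope_nonneg:
  assumes "(x, y, z) \<in> K" "\<And>w. (x, w) \<in> K \<Longrightarrow> \<alpha> \<bullet> (y, z) \<le> \<alpha> \<bullet> w"
  shows "snd \<alpha> \<ge> 0"
proof -
  have "(x, y, z + 1) \<in> K" using assms(1) by (simp add: K_iff)
  from assms(2)[OF this] show ?thesis by (simp add: inner_prod_def algebra_simps)
qed

lemma minimum_on_graph:
  assumes "(x, y, z) \<in> K" "\<And>w. (x, w) \<in> K \<Longrightarrow> \<alpha> \<bullet> (y, z) \<le> \<alpha> \<bullet> w"
  shows "\<alpha> \<bullet> (y, f (x, y)) = \<alpha> \<bullet> (y, z)"
proof (rule antisym)
  have "f (x, y) \<le> z" using assms(1) by (simp add: K_iff)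
  then show "\<alpha> \<bullet> (y, f (x, y)) \<le> \<alpha> \<bullet> (y, z)"
    using slope_nonneg[OF assms] by (simp add: inner_prod_def mult_left_mono)
  show "\<alpha> \<bullet> (y, z) \<le> \<alpha> \<bullet> (y, f (x, y))" using assms by (simp add: K_iff)
qed

lemma minimum_along_cell:
  assumes G: "G \<in> \<R>" and p1: "(x1, y1) \<in> rel_interior G"
    and min: "\<And>w. (x1, w) \<in> K \<Longrightarrow> \<alpha> \<bullet> (y1, f (x1, y1)) \<le> \<alpha> \<bullet> w"
  obtains g where
    "\<And>x y w. (x, y) \<in> G \<Longrightarrow> (x, w) \<in> K \<Longrightarrow> \<alpha> \<bullet> (y, f (x, y)) \<le> \<alpha> \<bullet> w"
    "\<And>x y. (x, y) \<in> G \<Longrightarrow> \<alpha> \<bullet> (y, f (x, y)) = \<alpha> \<bullet> (y1, f (x1, y1)) + g \<bullet> (x - x1)"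
proof -
  obtain q \<beta> where q: "\<And>p. p \<in> G \<Longrightarrow> f p = q \<bullet> p + \<beta>" using affine_on_cell[OF G] by auto
  have graph: "(x, y, f (x, y)) \<in> K" if "(x, y) \<in> G" for x y using that G by (auto simp: K_iff)
  show thesis
    using fiber_minimum_along_cell[OF polyhedron_K relint_stratifiedD(2)[OF stratified G] graph q p1 min]
      that by metis
qed

lemma relint_cell:
  assumes "(x, y, z) \<in> K"
  obtains G where "G \<in> \<R>" "(x, y) \<in> rel_interior G"
proof -
  obtain C where "C \<in> \<R>" "(x, y) \<in> C" using assms by (auto simp: K_iff)
  then show thesis using relint_stratifiedD(3)[OF stratified] that by blast
qed

text \<open>
  A cell that is optimal over \<open>x0\<close> projects onto a superset of the chamber of \<open>x0\<close>, so it supplies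
  the minimisers over the whole chamber.
\<close>
lemma minimum_affine_on_chamber:
  assumes K: "(x0, y0, z0) \<in> K" and min: "\<And>w. (x0, w) \<in> K \<Longrightarrow> \<alpha> \<bullet> (y0, z0) \<le> \<alpha> \<bullet> w"
  obtains g where "\<And>x. x \<in> chamber \<R> fst x0 \<Longrightarrow> \<exists>y. (x, y, f (x, y)) \<in> K \<and>
     (\<forall>w. (x, w) \<in> K \<longrightarrow> \<alpha> \<bullet> (y, f (x, y)) \<le> \<alpha> \<bullet> w) \<and>
     \<alpha> \<bullet> (y, f (x, y)) = \<alpha> \<bullet> (y0, z0) + g \<bullet> (x - x0)"
proof -
  obtain G where G: "G \<in> \<R>" "(x0, y0) \<in> rel_interior G" using relint_cell[OF K] .
  have eq: "\<alpha> \<bullet> (y0, f (x0, y0)) = \<alpha> \<bullet> (y0, z0)" using minimum_on_graph[OF K min] by blast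
  obtain g where g:
    "\<And>x y w. (x, y) \<in> G \<Longrightarrow> (x, w) \<in> K \<Longrightarrow> \<alpha> \<bullet> (y, f (x, y)) \<le> \<alpha> \<bullet> w"
    "\<And>x y. (x, y) \<in> G \<Longrightarrow> \<alpha> \<bullet> (y, f (x, y)) = \<alpha> \<bullet> (y0, f (x0, y0)) + g \<bullet> (x - x0)"
    using minimum_along_cell[OF G, of \<alpha>] min eq by metis
  show thesis
  proof (rule that)
    fix x assume x: "x \<in> chamber \<R> fst x0"
    have "x0 \<in> fst ` G" using G(2) rel_interior_subset by force
    from chamber_subset[OF G(1) this] have "x \<in> fst ` G" using x by (rule subsetD)
    then obtain y where y: "(x, y) \<in> G" by auto
    then show "\<exists>y. (x, y, f (x, y)) \<in> K \<and>
     (\<forall>w. (x, w) \<in> K \<longrightarrow> \<alpha> \<bullet> (y, f (x, y)) \<le> \<alpha> \<bullet> w) \<and>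
     \<alpha> \<bullet> (y, f (x, y)) = \<alpha> \<bullet> (y0, z0) + g \<bullet> (x - x0)"
      using g G(1) eq by (intro exI[of _ y] conjI allI impI) (auto simp: K_iff)
  qed
qed

text \<open>
  Let \<open>x1\<close> be a relative interior point of the chamber of \<open>x0\<close>. An interior functional of a normal
  cone \<open>N\<close> over \<open>x1\<close> is also minimised over \<open>x0\<close>, in some cell \<open>G\<close>; as \<open>x1\<close> is a relative interior
  point of the projection of \<open>G\<close>, the cell \<open>G\<close> is optimal over \<open>x1\<close> for that functional, hence for
  all of \<open>N\<close>, and this optimality moves back along \<open>G\<close> to \<open>x0\<close>.
\<close>
lemma min_cone_transfers_from_chamber:
  assumes E: "subspace E" and x0: "x0 \<in> fst ` \<Union>\<R>"
    and x1: "x1 \<in> rel_interior (chamber \<R> fst x0)" "(x1, w1) \<in> K"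
  obtains y0 where "(x0, y0, f (x0, y0)) \<in> K"
    "min_cone E {w. (x1, w) \<in> K} w1 \<subseteq> min_cone E {w. (x0, w) \<in> K} (y0, f (x0, y0))"
proof -
  let ?N = "min_cone E {w. (x1, w) \<in> K} w1"
  have N: "convex ?N" "?N \<noteq> {}"
    using min_cone_convex[OF subspace_imp_convex[OF E]] zero_in_min_cone[OF E] by blast+
  then obtain \<alpha> where \<alpha>: "\<alpha> \<in> rel_interior ?N" using rel_interior_eq_empty by blast
  then have \<alpha>N: "\<alpha> \<in> ?N" using rel_interior_subset by blast
  have \<alpha>1: "\<alpha> \<bullet> w1 \<le> \<alpha> \<bullet> w" if "(x1, w) \<in> K" for w using \<alpha>N that unfolding min_cone_def by blast
  obtain y where "(x0, y) \<in> \<Union>\<R>" using x0 by force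
  then have "(x0, y, f (x0, y)) \<in> K" unfolding K_iff by simp
  then obtain w0 where w0: "(x0, w0) \<in> K" "\<And>w. (x0, w) \<in> K \<Longrightarrow> \<alpha> \<bullet> w0 \<le> \<alpha> \<bullet> w"
    using fiber_minimum_transfer[OF polyhedron_K x1(2) \<alpha>1] by metis
  obtain y0 z0 where yz: "w0 = (y0, z0)" by force
  have eq: "\<alpha> \<bullet> (y0, f (x0, y0)) = \<alpha> \<bullet> w0" using minimum_on_graph[of x0 y0 z0 \<alpha>] w0 yz by blast
  obtain G where G: "G \<in> \<R>" "(x0, y0) \<in> rel_interior G" using relint_cell w0(1) yz by metis
  have G0: "(x0, y0) \<in> G" using G(2) rel_interior_subset by blast
  have cG: "convex G" using relint_stratifiedD(2)[OF stratified G(1)] .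
  have x0ri: "x0 \<in> rel_interior (fst ` G)"
    using G(2) rel_interior_convex_linear_image[OF linear_fst cG] by force
  have x0c: "x0 \<in> chamber \<R> fst x0" by (rule mem_chamber)
  have "rel_interior (chamber \<R> fst x0) \<subseteq> rel_interior (fst ` G)"
  proof (rule subset_rel_interior_convex)
    show "convex (chamber \<R> fst x0)"
      using convex_chamber[OF linear_fst] relint_stratifiedD(2)[OF stratified] by blast
    show "convex (fst ` G)" using convex_linear_image[OF linear_fst cG] .
    have "chamber \<R> fst x0 \<subseteq> fst ` G" using chamber_subset[OF G(1)] G0 by force
    then show "chamber \<R> fst x0 \<subseteq> closure (fst ` G)" using closure_subset by blast
    show "\<not> chamber \<R> fst x0 \<subseteq> rel_frontier (fst ` G)"
      using x0c x0ri by (auto simp: rel_frontier_def)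
  qed
  then obtain y1 where y1: "(x1, y1) \<in> rel_interior G"
    using x1(1) rel_interior_convex_linear_image[OF linear_fst cG] by fastforce
  have G1: "(x1, y1) \<in> G" using y1 rel_interior_subset by blast
  have K1: "(x1, y1, f (x1, y1)) \<in> K" and K0: "(x0, y0, f (x0, y0)) \<in> K"
    using G1 G0 G(1) by (auto simp: K_iff)
  have "\<alpha> \<bullet> (y1, f (x1, y1)) \<le> \<alpha> \<bullet> w" if "(x1, w) \<in> K" for w
    using minimum_along_cell[OF G, of \<alpha>] w0(2) eq G1 that by metis
  then have "\<alpha> \<in> min_cone E {w. (x1, w) \<in> K} (y1, f (x1, y1))"
    using \<alpha>N by (auto simp: min_cone_def)
  then have "?N \<subseteq> min_cone E {w. (x1, w) \<in> K} (y1, f (x1, y1))"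
    using x1(2) K1 by (intro min_cone_absorbs[OF order_refl N(1) \<alpha>]) (auto simp: min_cone_def)
  then have "\<gamma> \<bullet> (y0, f (x0, y0)) \<le> \<gamma> \<bullet> w" if "\<gamma> \<in> ?N" "(x0, w) \<in> K" for \<gamma> w
  proof -
    have "\<gamma> \<bullet> (y1, f (x1, y1)) \<le> \<gamma> \<bullet> w" if "(x1, w) \<in> K" for w
      using \<open>?N \<subseteq> _\<close> \<open>\<gamma> \<in> ?N\<close> that unfolding min_cone_def by blast
    then show ?thesis using minimum_along_cell[OF G(1) y1, of \<gamma>] G0 that(2) by metis
  qed
  then have "?N \<subseteq> min_cone E {w. (x0, w) \<in> K} (y0, f (x0, y0))"
    unfolding min_cone_def by blast
  then show thesis using that[OF K0] by blast
qed

end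

section \<open>Finite supports and extended expectations\<close>

text \<open>
  By the Lindelof property countably many null neighbourhoods cover the complement of the support.
\<close>
lemma (in prob_space) AE_in_rv_support:
  fixes X :: "'a \<Rightarrow> 'b::{second_countable_topology, t2_space}"
  assumes X: "X \<in> borel_measurable M"
  shows "AE \<omega> in M. X \<omega> \<in> rv_support M X"
proof -
  let ?\<U> = "{U. open U \<and> prob {\<omega>\<in>space M. X \<omega> \<in> U} = 0}"
  have meas: "{\<omega>\<in>space M. X \<omega> \<in> U} \<in> events" if "open U" for U
    using measurable_sets[OF X borel_open[OF that]] by (simp add: vimage_def Int_def conj_commute)
  obtain \<V> where \<V>: "\<V> \<subseteq> ?\<U>" "countable \<V>" "\<Union>\<V> = \<Union>?\<U>"
    using Lindelof[of ?\<U>] by auto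
  have "AE \<omega> in M. \<forall>U\<in>\<V>. X \<omega> \<notin> U"
  proof (subst AE_ball_countable[OF \<V>(2)], rule ballI)
    fix U assume "U \<in> \<V>"
    then have U: "open U" "prob {\<omega>\<in>space M. X \<omega> \<in> U} = 0" using \<V>(1) by auto
    then have "{\<omega>\<in>space M. X \<omega> \<in> U} \<in> null_sets M"
      using meas by (simp add: null_sets_def emeasure_eq_measure)
    then show "AE \<omega> in M. X \<omega> \<notin> U" by (rule AE_I'[where N = "{\<omega>\<in>space M. X \<omega> \<in> U}"]) auto
  qed
  then show ?thesis
  proof eventually_elim
    case (elim \<omega>)
    show ?case
    proof (rule ccontr)
      assume "X \<omega> \<notin> rv_support M X"
      then obtain U where "open U" "X \<omega> \<in> U" "\<not> prob {\<omega>\<in>space M. X \<omega> \<in> U} > 0"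
        by (auto simp: rv_support_def)
      then have "X \<omega> \<in> \<Union>?\<U>" using measure_nonneg[of M "{\<omega>\<in>space M. X \<omega> \<in> U}"] by force
      then show False using elim \<V>(3) by blast
    qed
  qed
qed

lemma (in prob_space) prob_pos_of_rv_support:
  fixes X :: "'a \<Rightarrow> 'b::{second_countable_topology, t2_space}"
  assumes X: "X \<in> borel_measurable M" and fin: "finite (rv_support M X)" and d: "d \<in> rv_support M X"
  shows "prob {\<omega>\<in>space M. X \<omega> = d} > 0"
proof -
  let ?U = "- (rv_support M X - {d})"
  have U: "open ?U" using fin by (intro open_Compl finite_imp_closed) auto
  have "prob {\<omega>\<in>space M. X \<omega> \<in> ?U} > 0" using d U unfolding rv_support_def by blast
  also have "prob {\<omega>\<in>space M. X \<omega> \<in> ?U} = prob {\<omega>\<in>space M. X \<omega> = d}"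
  proof (rule finite_measure_eq_AE)
    show "AE \<omega> in M. (\<omega> \<in> {\<omega>\<in>space M. X \<omega> \<in> ?U}) = (\<omega> \<in> {\<omega>\<in>space M. X \<omega> = d})"
      using AE_in_rv_support[OF X] by eventually_elim (use d in auto)
    show "{\<omega>\<in>space M. X \<omega> \<in> ?U} \<in> events"
      using measurable_sets[OF X borel_open[OF U]] by (simp add: vimage_def Int_def conj_commute)
    show "{\<omega>\<in>space M. X \<omega> = d} \<in> events" using X by measurable
  qed
  finally show ?thesis .
qed

lemma ereal_expectation_integrable:
  fixes g :: "'a \<Rightarrow> real"
  assumes f: "AE \<omega> in M. f \<omega> = ereal (g \<omega>)" and g: "integrable M g"
  shows "ereal_expectation M f = ereal (\<integral>\<omega>. g \<omega> \<partial>M)"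
proof -
  have "(\<integral>\<^sup>+\<omega>. e2ennreal (f \<omega>) \<partial>M) = (\<integral>\<^sup>+\<omega>. ennreal (g \<omega>) \<partial>M)"
    by (rule nn_integral_cong_AE) (use f in eventually_elim, simp add: ennreal.rep_eq e2ennreal_ereal)
  moreover have "(\<integral>\<^sup>+\<omega>. e2ennreal (- f \<omega>) \<partial>M) = (\<integral>\<^sup>+\<omega>. ennreal (- g \<omega>) \<partial>M)"
    by (rule nn_integral_cong_AE) (use f in eventually_elim, simp add: ennreal.rep_eq e2ennreal_ereal)
  moreover have "(\<integral>\<^sup>+\<omega>. ennreal (g \<omega>) \<partial>M) < \<infinity>" "(\<integral>\<^sup>+\<omega>. ennreal (- g \<omega>) \<partial>M) < \<infinity>"
    using g by (auto simp: real_integrable_def top.not_eq_extremum)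
  ultimately show ?thesis
    unfolding ereal_expectation_def real_lebesgue_integral_def[OF g]
    by (cases "\<integral>\<^sup>+\<omega>. ennreal (g \<omega>) \<partial>M"; cases "\<integral>\<^sup>+\<omega>. ennreal (- g \<omega>) \<partial>M") auto
qed

lemma nn_integral_infinite_on:
  assumes A: "A \<in> sets M" "emeasure M A > 0" and f: "\<And>\<omega>. \<omega> \<in> A \<Longrightarrow> f \<omega> = (\<infinity>::ennreal)"
  shows "(\<integral>\<^sup>+\<omega>. f \<omega> \<partial>M) = \<infinity>"
proof -
  have "(\<integral>\<^sup>+\<omega>. \<infinity> * indicator A \<omega> \<partial>M) = \<infinity> * emeasure M A"
    by (rule nn_integral_cmult_indicator[OF A(1)])
  also have "\<dots> = \<infinity>" using A(2) by (simp add: ennreal_top_mult)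
  finally have "\<infinity> = (\<integral>\<^sup>+\<omega>. \<infinity> * indicator A \<omega> \<partial>M)" by simp
  also have "\<dots> \<le> (\<integral>\<^sup>+\<omega>. f \<omega> \<partial>M)"
    using f by (intro nn_integral_mono) (auto simp: indicator_def)
  finally show ?thesis by (simp add: top.extremum_unique)
qed

text \<open>
  The convention \<open>\<infinity> - \<infinity> = \<infinity>\<close> makes this hold whatever the negative part of \<open>f\<close> is. The same is not
  true for \<open>-\<infinity>\<close>, where an integrable upper bound is required below.
\<close>
lemma ereal_expectation_infinite:
  assumes "A \<in> sets M" "emeasure M A > 0" "\<And>\<omega>. \<omega> \<in> A \<Longrightarrow> f \<omega> = \<infinity>"
  shows "ereal_expectation M f = \<infinity>"
proof -
  have "(\<integral>\<^sup>+\<omega>. e2ennreal (f \<omega>) \<partial>M) = \<infinity>"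
    using assms by (intro nn_integral_infinite_on[of A]) auto
  then show ?thesis by (simp add: ereal_expectation_def)
qed

lemma positive_part_finite:
  fixes g :: "'a \<Rightarrow> real"
  assumes "AE \<omega> in M. f \<omega> \<le> ereal (g \<omega>)" "integrable M g"
  shows "(\<integral>\<^sup>+\<omega>. e2ennreal (f \<omega>) \<partial>M) < \<infinity>"
proof -
  have "(\<integral>\<^sup>+\<omega>. e2ennreal (f \<omega>) \<partial>M) \<le> (\<integral>\<^sup>+\<omega>. ennreal (g \<omega>) \<partial>M)"
  proof (rule nn_integral_mono_AE, use assms(1) in eventually_elim)
    case (elim \<omega>)
    then show ?case using e2ennreal_mono[OF elim] by (simp add: e2ennreal_ereal)
  qed
  also have "\<dots> < \<infinity>" using assms(2) by (auto simp: real_integrable_def top.not_eq_extremum)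
  finally show ?thesis .
qed

lemma ereal_expectation_less_infinity:
  fixes g :: "'a \<Rightarrow> real"
  assumes "AE \<omega> in M. f \<omega> \<le> ereal (g \<omega>)" "integrable M g"
  shows "ereal_expectation M f < \<infinity>"
proof -
  have "(\<integral>\<^sup>+\<omega>. e2ennreal (f \<omega>) \<partial>M) < \<infinity>" using positive_part_finite[OF assms] .
  then show ?thesis unfolding ereal_expectation_def
    by (cases "\<integral>\<^sup>+\<omega>. e2ennreal (f \<omega>) \<partial>M"; cases "\<integral>\<^sup>+\<omega>. e2ennreal (- f \<omega>) \<partial>M") auto
qed

lemma ereal_expectation_minus_infinity:
  fixes g :: "'a \<Rightarrow> real"
  assumes "AE \<omega> in M. f \<omega> \<le> ereal (g \<omega>)" "integrable M g"
    and "A \<in> sets M" "emeasure M A > 0" "\<And>\<omega>. \<omega> \<in> A \<Longrightarrow> f \<omega> = - \<infinity>"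
  shows "ereal_expectation M f = - \<infinity>"
proof -
  have "(\<integral>\<^sup>+\<omega>. e2ennreal (- f \<omega>) \<partial>M) = \<infinity>"
    using assms(3-5) by (intro nn_integral_infinite_on[of A]) auto
  moreover have "(\<integral>\<^sup>+\<omega>. e2ennreal (f \<omega>) \<partial>M) < \<infinity>" using positive_part_finite[OF assms(1,2)] .
  ultimately show ?thesis unfolding ereal_expectation_def
    by (cases "\<integral>\<^sup>+\<omega>. e2ennreal (f \<omega>) \<partial>M") auto
qed

lemma borel_rel_interior:
  fixes S :: "'a::euclidean_space set"
  shows "rel_interior S \<in> sets borel"
proof -
  have "openin (top_of_set (affine hull S)) (rel_interior S)" by (rule openin_rel_interior)
  then obtain U where "open U" "rel_interior S = affine hull S \<inter> U" by (auto simp: openin_open)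
  then show ?thesis using closed_affine_hull[of S] by (simp add: sets.Int)
qed

section \<open>Chamber complexes of a multistage program\<close>

lemma subspace_coord_space: "subspace (coord_space J)"
  by (auto simp: subspace_def coord_space_def)

lemma polyhedron_coord_space: "polyhedron (coord_space J)"
  by (intro affine_imp_polyhedron subspace_imp_affine subspace_coord_space)

lemma polyhedron_satisfies:
  "polyhedron {p :: (real^'n::finite) \<times> (real^'n). satisfies (d :: ('n, 'm::finite) stage_data) (fst p) (snd p)}"
proof -
  obtain A B b where d: "d = (A, B, b)" by (cases d) auto
  let ?G = "(\<lambda>i. ((row i B, row i A), b $ i)) ` (UNIV :: 'm set)"
  have "{p. satisfies d (fst p) (snd p)} = {p. \<forall>(a, \<beta>)\<in>?G. a \<bullet> p \<le> \<beta>}"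
    by (auto simp: d satisfies_def less_eq_vec_def matrix_vector_mul_component inner_prod_def row_def
        add.commute)
  then show ?thesis using polyhedron_from_inequalities[of ?G] by simp
qed

lemma Union_common_refinement: "\<Union>(common_refinement E I \<C>) = E \<inter> (\<Inter>i\<in>I. \<Union>(\<C> i))"
proof (rule set_eqI iffI)+
  fix x assume x: "x \<in> E \<inter> (\<Inter>i\<in>I. \<Union>(\<C> i))"
  then have "\<forall>i\<in>I. \<exists>S. S \<in> \<C> i \<and> x \<in> S" by auto
  then obtain S where "\<forall>i\<in>I. S i \<in> \<C> i \<and> x \<in> S i" by metis
  then have "x \<in> E \<inter> (\<Inter>i\<in>I. S i)" "E \<inter> (\<Inter>i\<in>I. S i) \<in> common_refinement E I \<C>"
    using x by (auto simp: common_refinement_def)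
  then show "x \<in> \<Union>(common_refinement E I \<C>)" by blast
qed (auto simp: common_refinement_def)

lemma Union_meet: "\<Union>(meet \<C> \<D>) = \<Union>\<C> \<inter> \<Union>\<D>"
  unfolding meet_def by blast

lemma Union_face_complex: "convex P \<Longrightarrow> \<Union>(face_complex P) = P"
  by (auto simp: face_complex_def dest: face_of_imp_subset intro!: bexI[of _ P] face_of_refl)

context multistage
begin

lemma polyhedron_coupling: "polyhedron (coupling_polyhedron t d)"
proof -
  have "coupling_polyhedron t d = (coord_space (J (t - 1)) \<times> coord_space (J t)) \<inter>
      {p. satisfies d (fst p) (snd p)}"
    by (auto simp: coupling_polyhedron_def)
  also have "polyhedron \<dots>"
    by (intro polyhedron_Int polyhedron_Times_sets polyhedron_coord_space polyhedron_satisfies)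
  finally show ?thesis .
qed

text \<open>
  The stage-\<open>t\<close> cost with data \<open>d\<close> is affine on the cells of this complex in the product space if
  \<open>V (t + 1)\<close> is affine on the cells of \<open>P_complex (t + 1)\<close>; its chambers along the first projection
  are \<open>P_complex_at t d\<close>.
\<close>
definition cost_complex :: "nat \<Rightarrow> ('n, 'm) stage_data \<Rightarrow> ((real^'n) \<times> (real^'n)) set set" where
  "cost_complex t d = meet ((\<times>) (coord_space (J (t - 1))) ` P_complex (t + 1))
     (face_complex (coupling_polyhedron t d))"

lemma P_complex_at_eq: "P_complex_at t d = chamber_complex (cost_complex t d) fst"
  by (simp add: stage_complex_def cost_complex_def)

text \<open>The support of \<open>P_complex t\<close> is the set of states from which stages \<open>t\<close> to \<open>T\<close> are feasible.\<close>
abbreviation feasible_states :: "nat \<Rightarrow> (real^'n) set" where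
  "feasible_states t \<equiv> \<Union>(P_complex t)"

lemma feasible_states_final: "feasible_states (T + 1) = coord_space (J T)"
  by (simp add: P_complex.simps)

lemma Union_cost_complex:
  "\<Union>(cost_complex t d) = {(x, y). x \<in> coord_space (J (t - 1)) \<and> y \<in> coord_space (J t) \<and>
     y \<in> feasible_states (t + 1) \<and> satisfies d x y}"
proof -
  have "\<Union>((\<times>) (coord_space (J (t - 1))) ` P_complex (t + 1)) =
    coord_space (J (t - 1)) \<times> feasible_states (t + 1)" by auto
  then show ?thesis
    unfolding cost_complex_def Union_meet
      Union_face_complex[OF polyhedron_imp_convex[OF polyhedron_coupling]]
    by (auto simp: coupling_polyhedron_def)
qed

lemma Union_P_complex_at:
  "\<Union>(P_complex_at t d) = {x \<in> coord_space (J (t - 1)).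
     \<exists>y\<in>coord_space (J t). y \<in> feasible_states (t + 1) \<and> satisfies d x y}"
  unfolding P_complex_at_eq Union_chamber_complex Union_cost_complex
  unfolding image_def by auto

lemma feasible_states_step:
  assumes "t \<le> T"
  shows "feasible_states t = {x \<in> coord_space (J (t - 1)). \<forall>d\<in>rv_support M (\<xi> t).
     \<exists>y\<in>coord_space (J t). y \<in> feasible_states (t + 1) \<and> satisfies d x y}"
  using assms
proof -
  have P: "P_complex t = common_refinement (coord_space (J (t - 1))) (rv_support M (\<xi> t))
      (stage_complex t (P_complex (t + 1)))"
    using assms by (subst P_complex.simps) simp
  show ?thesis
    unfolding P Union_common_refinement Union_P_complex_at by blast
qed

lemma feasible_states_coord:
  assumes "t \<le> T + 1" shows "feasible_states t \<subseteq> coord_space (J (t - 1))"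
proof (cases "t \<le> T")
  case True then show ?thesis using feasible_states_step by blast
next
  case False
  then have "t = T + 1" using assms by simp
  then show ?thesis by (simp add: P_complex.simps)
qed

definition stage_value :: "nat \<Rightarrow> ('n, 'm) stage_data \<Rightarrow> real^'n \<Rightarrow> real^'n \<Rightarrow> ereal" where
  "stage_value t d a x =
     (INF y\<in>{y\<in>coord_space (J t). satisfies d x y}. ereal (a \<bullet> y) + V (t + 1) y)"

lemma V_step: "t \<le> T \<Longrightarrow> V t x = ereal_expectation M (\<lambda>\<omega>. stage_value t (\<xi> t \<omega>) (c t \<omega>) x)"
  by (subst V.simps) (simp add: stage_value_def)

lemma V_final: "V (T + 1) x = 0"
  by (subst V.simps) simp

lemma stage_value_le:
  "y \<in> coord_space (J t) \<Longrightarrow> satisfies d x y \<Longrightarrow> stage_value t d a x \<le> ereal (a \<bullet> y) + V (t + 1) y"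
  unfolding stage_value_def by (rule INF_lower) simp

end

locale finitely_supported_program = prob_space M + multistage M T J c \<xi>
  for M :: "'w measure" and T :: nat and J :: "nat \<Rightarrow> 'n::finite set"
    and c :: "nat \<Rightarrow> 'w \<Rightarrow> real^'n" and \<xi> :: "nat \<Rightarrow> 'w \<Rightarrow> ('n, 'm::finite) stage_data" +
  assumes c_coord: "\<And>t \<omega>. t \<in> {2..T} \<Longrightarrow> \<omega> \<in> space M \<Longrightarrow> c t \<omega> \<in> coord_space (J t)"
    and c_integrable: "\<And>t. t \<in> {2..T} \<Longrightarrow> integrable M (c t)"
    and \<xi>_measurable: "\<And>t. t \<in> {2..T} \<Longrightarrow> \<xi> t \<in> borel_measurable M"
    and finite_support: "\<And>t. t \<in> {2..T} \<Longrightarrow> finite (rv_support M (\<xi> t))"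
begin

lemma AE_in_support: "t \<in> {2..T} \<Longrightarrow> AE \<omega> in M. \<xi> t \<omega> \<in> rv_support M (\<xi> t)"
  by (rule AE_in_rv_support) (rule \<xi>_measurable)

lemma atom_measurable: "t \<in> {2..T} \<Longrightarrow> {\<omega>\<in>space M. \<xi> t \<omega> = d} \<in> events"
  using measurable_sets[OF \<xi>_measurable borel_singleton, of t "{}" d]
  by (simp add: vimage_def Int_def conj_commute)

lemma atom_prob_pos:
  assumes "t \<in> {2..T}" "d \<in> rv_support M (\<xi> t)"
  shows "prob {\<omega>\<in>space M. \<xi> t \<omega> = d} > 0"
  using prob_pos_of_rv_support[OF \<xi>_measurable finite_support assms(2)] assms(1) by simp

lemma stratified_P_complex: "2 \<le> t \<Longrightarrow> t \<le> T + 1 \<Longrightarrow> relint_stratified (P_complex t)"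
proof (induction "T + 1 - t" arbitrary: t)
  case 0
  then have "t = T + 1" by simp
  then show ?case
    by (simp add: P_complex.simps relint_stratified_affine subspace_imp_affine subspace_coord_space)
next
  case (Suc k)
  then have t: "t \<in> {2..T}" by auto
  have IH: "relint_stratified (P_complex (t + 1))" using Suc by simp
  have "relint_stratified (P_complex_at t d)" for d
    unfolding P_complex_at_eq cost_complex_def
    by (intro relint_stratified_chamber_complex linear_fst relint_stratified_meet
        relint_stratified_Times relint_stratified_face_complex polyhedron_coupling IH
        subspace_imp_affine subspace_coord_space)
  then show ?case
    using t finite_support[OF t]
    by (subst P_complex.simps)
      (simp add: relint_stratified_common_refinement subspace_imp_affine subspace_coord_space)
qed

lemma stratified_cost_complex: "t \<in> {2..T} \<Longrightarrow> relint_stratified (cost_complex t d)"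
  unfolding cost_complex_def
  by (intro relint_stratified_meet relint_stratified_Times relint_stratified_face_complex
      polyhedron_coupling stratified_P_complex subspace_imp_affine subspace_coord_space) auto

lemma stratified_P_complex_at: "t \<in> {2..T} \<Longrightarrow> relint_stratified (P_complex_at t d)"
  unfolding P_complex_at_eq
  by (intro relint_stratified_chamber_complex linear_fst stratified_cost_complex)

text \<open>
  Choosing one feasible decision for each of the finitely many data bounds the optimal values by an
  integrable function, which keeps the positive part of the expectation finite.
\<close>
lemma stage_value_bounded_above:
  assumes t: "t \<in> {2..T}" and x: "x \<in> feasible_states t"
    and V: "\<And>y. y \<in> feasible_states (t + 1) \<Longrightarrow> V (t + 1) y < \<infinity>"
  obtains g :: "'w \<Rightarrow> real" where "integrable M g"
    "AE \<omega> in M. stage_value t (\<xi> t \<omega>) (c t \<omega>) x \<le> ereal (g \<omega>)"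
proof -
  let ?S = "rv_support M (\<xi> t)"
  have "\<forall>d\<in>?S. \<exists>y\<in>coord_space (J t). y \<in> feasible_states (t + 1) \<and> satisfies d x y"
    using x feasible_states_step[of t] t unfolding atLeastAtMost_iff by blast
  then obtain y where y: "\<And>d. d \<in> ?S \<Longrightarrow>
      y d \<in> coord_space (J t) \<and> y d \<in> feasible_states (t + 1) \<and> satisfies d x (y d)"
    by metis
  have "\<exists>r. V (t + 1) (y d) \<le> ereal r" if "d \<in> ?S" for d
    using V[of "y d"] y[OF that] by (cases "V (t + 1) (y d)") auto
  then obtain r where r: "\<And>d. d \<in> ?S \<Longrightarrow> V (t + 1) (y d) \<le> ereal (r d)" by metis
  define g where "g \<omega> = norm (c t \<omega>) * (\<Sum>d\<in>?S. norm (y d)) + (\<Sum>d\<in>?S. \<bar>r d\<bar>)" for \<omega>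
  show thesis
  proof
    show "integrable M g" unfolding g_def using c_integrable[OF t] by simp
    show "AE \<omega> in M. stage_value t (\<xi> t \<omega>) (c t \<omega>) x \<le> ereal (g \<omega>)"
      using AE_in_support[OF t]
    proof eventually_elim
      case (elim \<omega>)
      let ?d = "\<xi> t \<omega>"
      have "stage_value t ?d (c t \<omega>) x \<le> ereal (c t \<omega> \<bullet> y ?d) + V (t + 1) (y ?d)"
        using y[OF elim] by (intro stage_value_le) auto
      also have "\<dots> \<le> ereal (c t \<omega> \<bullet> y ?d) + ereal (r ?d)" by (intro add_left_mono r elim)
      also have "c t \<omega> \<bullet> y ?d + r ?d \<le> g \<omega>"
      proof -
        have "c t \<omega> \<bullet> y ?d \<le> norm (c t \<omega>) * norm (y ?d)" by (rule norm_cauchy_schwarz)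
        also have "norm (y ?d) \<le> (\<Sum>d\<in>?S. norm (y d))"
          using elim finite_support[OF t] by (intro member_le_sum) auto
        finally have 1: "c t \<omega> \<bullet> y ?d \<le> norm (c t \<omega>) * (\<Sum>d\<in>?S. norm (y d))"
          by (simp add: mult_left_mono)
        have "r ?d \<le> \<bar>r ?d\<bar>" by simp
        also have "\<dots> \<le> (\<Sum>d\<in>?S. \<bar>r d\<bar>)"
          using elim finite_support[OF t] by (intro member_le_sum) auto
        finally show ?thesis using 1 by (simp add: g_def)
      qed
      then have "ereal (c t \<omega> \<bullet> y ?d) + ereal (r ?d) \<le> ereal (g \<omega>)" by simp
      finally show ?case .
    qed
  qed
qed

lemma V_less_infinity: "2 \<le> t \<Longrightarrow> t \<le> T + 1 \<Longrightarrow> x \<in> feasible_states t \<Longrightarrow> V t x < \<infinity>"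
proof (induction "T + 1 - t" arbitrary: t x)
  case 0
  then have "t = T + 1" by simp
  then show ?case using V_final[of x] by simp
next
  case (Suc k)
  then have t: "t \<in> {2..T}" by auto
  have IH: "\<And>y. y \<in> feasible_states (t + 1) \<Longrightarrow> V (t + 1) y < \<infinity>" using Suc by simp
  obtain g :: "'w \<Rightarrow> real" where g: "integrable M g"
    "AE \<omega> in M. stage_value t (\<xi> t \<omega>) (c t \<omega>) x \<le> ereal (g \<omega>)"
    using stage_value_bounded_above[OF t Suc.prems(3) IH] by metis
  have "t \<le> T" using t by simp
  then show ?case using ereal_expectation_less_infinity[OF g(2,1)] V_step by simp
qed

text \<open>
  An infeasible state is infeasible for some data in the support, and these have positive
  probability because the support is finite.
\<close>
lemma V_infinite:
  "2 \<le> t \<Longrightarrow> t \<le> T + 1 \<Longrightarrow> x \<in> coord_space (J (t - 1)) \<Longrightarrow> x \<notin> feasible_states t \<Longrightarrow> V t x = \<infinity>"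
proof (induction "T + 1 - t" arbitrary: t x)
  case 0
  then have "t = T + 1" by simp
  then have "x \<in> feasible_states t" using "0.prems"(3) feasible_states_final by (simp del: Union_iff)
  then show ?case using "0.prems"(4) by blast
next
  case (Suc k)
  then have t: "t \<in> {2..T}" "t \<le> T" by auto
  obtain d where d: "d \<in> rv_support M (\<xi> t)"
    "\<And>y. y \<in> coord_space (J t) \<Longrightarrow> satisfies d x y \<Longrightarrow> y \<notin> feasible_states (t + 1)"
    using Suc.prems feasible_states_step[OF t(2)] by blast
  have "V (t + 1) y = \<infinity>" if "y \<in> coord_space (J t)" "satisfies d x y" for y
    using Suc.hyps(1)[of "t + 1" y] Suc.hyps(2) that d(2)[OF that] t by simp
  then have "stage_value t d a x = \<infinity>" for a
    by (auto simp: stage_value_def INF_eq_const top_ereal_def intro!: antisym INF_greatest)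
  then show ?case
    unfolding V_step[OF t(2)] using atom_prob_pos[OF t(1) d(1)] atom_measurable[OF t(1)]
    by (intro ereal_expectation_infinite[of "{\<omega>\<in>space M. \<xi> t \<omega> = d}"])
      (auto simp: emeasure_eq_measure)
qed

lemma mem_P_complex_at_coord: "\<sigma> \<in> P_complex_at t d \<Longrightarrow> \<sigma> \<subseteq> coord_space (J (t - 1))"
  using Union_P_complex_at[of t d] by blast

lemma P_complex_at_nonempty: "\<sigma> \<in> P_complex_at t d \<Longrightarrow> \<sigma> \<noteq> {}"
  unfolding P_complex_at_eq chamber_complex_def using mem_chamber by fastforce

text \<open>
  The representative of \<open>\<sigma>\<close> at which \<open>cell_fan\<close> reads off the normal fan.
\<close>
definition cell_point :: "(real^'n) set \<Rightarrow> real^'n" where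
  "cell_point \<sigma> = (SOME x. x \<in> rel_interior \<sigma>)"

lemma cell_point_relint:
  assumes "t \<in> {2..T}" "\<sigma> \<in> P_complex_at t d"
  shows "cell_point \<sigma> \<in> rel_interior \<sigma>"
proof -
  have "convex \<sigma>" using relint_stratifiedD(2)[OF stratified_P_complex_at] assms by blast
  then have "\<exists>x. x \<in> rel_interior \<sigma>"
    using P_complex_at_nonempty[OF assms(2)] rel_interior_eq_empty by blast
  then show ?thesis unfolding cell_point_def by (rule someI_ex)
qed

lemma N_fan_eq:
  "N_fan t d = common_refinement (coord_space (J t) \<times> UNIV) (P_complex_at t d)
     (\<lambda>\<sigma>. min_cone (coord_space (J t) \<times> UNIV) (epi_fiber t d (cell_point \<sigma>)) ` epi_fiber t d (cell_point \<sigma>))"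
proof -
  have E: "subspace (coord_space (J t) \<times> (UNIV :: real set))"
    by (intro subspace_Times subspace_coord_space subspace_UNIV)
  show ?thesis
    unfolding N_fan_def cell_fan_def normal_fan_def cell_point_def[symmetric] image_image
      uminus_normal_cone[OF E] ..
qed

lemma epi_fiber_nonempty:
  assumes t: "t \<in> {2..T}" and x: "x \<in> \<Union>(P_complex_at t d)"
  shows "epi_fiber t d x \<noteq> {}"
proof -
  obtain y where y: "y \<in> coord_space (J t)" "y \<in> feasible_states (t + 1)" "satisfies d x y"
    using x unfolding Union_P_complex_at by auto
  then have "V (t + 1) y < \<infinity>" using V_less_infinity[of "t + 1" y] t by auto
  then obtain z where "V (t + 1) y \<le> ereal z" by (cases "V (t + 1) y") auto
  then have "(y, z) \<in> epi_fiber t d x" using y by (simp add: epi_fiber_def Q_def)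
  then show ?thesis by blast
qed

text \<open>
  Thus every node before the last stage has a child for each data in the support, so that
  feasibility along the tree entails feasibility of the program.
\<close>
lemma N_fan_nonempty:
  assumes t: "t \<in> {2..T}"
  shows "N_fan t d \<noteq> {}"
proof -
  define w where "w \<sigma> = (SOME p. p \<in> epi_fiber t d (cell_point \<sigma>))" for \<sigma>
  have "epi_fiber t d (cell_point \<sigma>) \<noteq> {}" if "\<sigma> \<in> P_complex_at t d" for \<sigma>
    using cell_point_relint[OF t that] rel_interior_subset[of \<sigma>] that
    by (intro epi_fiber_nonempty[OF t]) blast
  then have "\<And>\<sigma>. \<sigma> \<in> P_complex_at t d \<Longrightarrow> w \<sigma> \<in> epi_fiber t d (cell_point \<sigma>)"
    unfolding w_def some_in_eq .
  then have "coord_space (J t) \<times> UNIV \<inter> (\<Inter>\<sigma>\<in>P_complex_at t d.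
      min_cone (coord_space (J t) \<times> UNIV) (epi_fiber t d (cell_point \<sigma>)) (w \<sigma>)) \<in> N_fan t d"
    unfolding N_fan_eq common_refinement_def
    by (intro CollectI exI[of _ "\<lambda>\<sigma>. min_cone (coord_space (J t) \<times> UNIV) (epi_fiber t d (cell_point \<sigma>)) (w \<sigma>)"]) auto
  then show ?thesis by blast
qed

end

section \<open>Exact quantisation of one stage\<close>

text \<open>
  Each summand is added by projecting a polyhedron with one more coordinate. The auxiliary values
  \<open>\<zeta>\<close> are not required to be minimal, so the lemma applies to epigraphs without mentioning minima.
\<close>
lemma polyhedron_weighted_sum_epigraph:
  fixes L :: "'i \<Rightarrow> ('a::euclidean_space \<times> real) set"
  assumes I: "finite I" and D: "polyhedron D" and L: "\<And>i. i \<in> I \<Longrightarrow> polyhedron (L i)"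
  shows "polyhedron {(x, z). x \<in> D \<and> (\<exists>\<zeta>. (\<forall>i\<in>I. (x, \<zeta> i) \<in> L i) \<and> (\<Sum>i\<in>I. w i * \<zeta> i) \<le> z)}"
    (is "polyhedron (?S I)")
  using I L
proof (induction I rule: finite_induct)
  case empty
  have "?S {} = D \<times> {z. 1 \<bullet> z \<ge> (0::real)}" by auto
  also have "polyhedron \<dots>" by (intro polyhedron_Times_sets D polyhedron_halfspace_ge)
  finally show ?case .
next
  case (insert i I)
  let ?P = "{p. (fst p, fst (snd p)) \<in> ?S I} \<inter> {p. (fst p, snd (snd p)) \<in> L i}"
  let ?f = "\<lambda>p :: 'a \<times> real \<times> real. (fst p, fst (snd p) + w i * snd (snd p))"
  have "?S (insert i I) = ?f ` ?P"
  proof (rule set_eqI iffI)+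
    fix p assume "p \<in> ?S (insert i I)"
    then obtain x z \<zeta> where p: "p = (x, z)" "x \<in> D" "\<forall>j\<in>insert i I. (x, \<zeta> j) \<in> L j"
      "(\<Sum>j\<in>insert i I. w j * \<zeta> j) \<le> z" by blast
    have "(x, z - w i * \<zeta> i) \<in> ?S I"
      using p insert.hyps by (auto intro!: exI[of _ \<zeta>])
    then have "(x, z - w i * \<zeta> i, \<zeta> i) \<in> ?P" using p(3) by simp
    moreover have "p = ?f (x, z - w i * \<zeta> i, \<zeta> i)" using p(1) by simp
    ultimately show "p \<in> ?f ` ?P" by (rule rev_image_eqI)
  next
    fix p assume "p \<in> ?f ` ?P"
    then obtain x z s where p: "p = (x, z + w i * s)" "(x, z) \<in> ?S I" "(x, s) \<in> L i" by auto
    then obtain \<zeta> where \<zeta>: "x \<in> D" "\<forall>j\<in>I. (x, \<zeta> j) \<in> L j" "(\<Sum>j\<in>I. w j * \<zeta> j) \<le> z" by blast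
    have "(\<Sum>j\<in>I. w j * (\<zeta>(i := s)) j) = (\<Sum>j\<in>I. w j * \<zeta> j)"
      using insert.hyps by (intro sum.cong) auto
    then have "(\<Sum>j\<in>insert i I. w j * (\<zeta>(i := s)) j) \<le> z + w i * s"
      using insert.hyps \<zeta>(3) by simp
    moreover have "\<forall>j\<in>insert i I. (x, (\<zeta>(i := s)) j) \<in> L j" using \<zeta>(2) p(3) by simp
    ultimately show "p \<in> ?S (insert i I)" using p(1) \<zeta>(1) by blast
  qed
  also have "polyhedron (?f ` ?P)"
  proof (intro polyhedron_linear_image polyhedron_Int polyhedron_linear_vimage)
    show "polyhedron (?S I)" using insert by blast
    show "polyhedron (L i)" using insert.prems by blast
  qed (auto simp: linear_iff algebra_simps)
  finally show ?case .
qed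

context finitely_supported_program
begin

text \<open>
  Polyhedrality provides multipliers and attained minima. The affine pieces must be cells of the
  prescribed complex, because the fans are read off at its chambers.
\<close>
definition polyhedral_value :: "nat \<Rightarrow> bool" where
  "polyhedral_value t \<longleftrightarrow> (\<forall>x\<in>feasible_states t. V t x \<noteq> - \<infinity>) \<and>
     polyhedron {(x, z). x \<in> coord_space (J (t - 1)) \<and> V t x \<le> ereal z} \<and>
     (\<forall>\<sigma>\<in>P_complex t. \<exists>g \<beta>. \<forall>x\<in>\<sigma>. V t x = ereal (g \<bullet> x + \<beta>))"

lemma polyhedral_valueD:
  assumes "polyhedral_value t"
  shows "x \<in> feasible_states t \<Longrightarrow> V t x \<noteq> - \<infinity>"
    and "polyhedron {(x, z). x \<in> coord_space (J (t - 1)) \<and> V t x \<le> ereal z}"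
    and "\<sigma> \<in> P_complex t \<Longrightarrow> \<exists>g \<beta>. \<forall>x\<in>\<sigma>. V t x = ereal (g \<bullet> x + \<beta>)"
  using assms unfolding polyhedral_value_def by (simp_all only: Ball_def) blast+

definition real_value :: "nat \<Rightarrow> real^'n \<Rightarrow> real" where
  "real_value t x = real_of_ereal (V t x)"

lemma V_eq_real_value:
  assumes "2 \<le> t" "t \<le> T + 1" "polyhedral_value t" "x \<in> feasible_states t"
  shows "V t x = ereal (real_value t x)"
proof -
  have "V t x \<noteq> \<infinity>" using V_less_infinity[OF assms(1,2,4)] by simp
  moreover have "V t x \<noteq> - \<infinity>" using polyhedral_valueD(1)[OF assms(3,4)] .
  ultimately show ?thesis unfolding real_value_def by (cases "V t x") auto
qed

text \<open>
  The converse only swaps the components: an entry of a node is a pair of a cone and the data,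
  whereas the family of cones depends on the data.
\<close>
definition children :: "nat \<Rightarrow> (((real^'n) \<times> real) set \<times> ('n, 'm) stage_data) set" where
  "children t = (SIGMA d : rv_support M (\<xi> t). N_fan t d)\<inverse>"

lemma mem_children: "(N, d) \<in> children t \<longleftrightarrow> d \<in> rv_support M (\<xi> t) \<and> N \<in> N_fan t d"
  by (auto simp: children_def)

definition child_event :: "nat \<Rightarrow> ((real^'n) \<times> real) set \<times> ('n, 'm) stage_data \<Rightarrow> 'w set" where
  "child_event t e = {\<omega>\<in>space M. \<xi> t \<omega> = snd e \<and> (c t \<omega>, 1) \<in> rel_interior (fst e)}"

definition child_mean :: "nat \<Rightarrow> ((real^'n) \<times> real) set \<times> ('n, 'm) stage_data \<Rightarrow> real^'n" where
  "child_mean t e = c_check t (fst e) (snd e)"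

lemma cost_measurable: "t \<in> {2..T} \<Longrightarrow> c t \<in> borel_measurable M"
  by (intro borel_measurable_integrable c_integrable)

lemma extended_cost_event:
  assumes "t \<in> {2..T}" "B \<in> sets borel"
  shows "{\<omega>\<in>space M. (c t \<omega>, 1::real) \<in> B} \<in> events"
proof -
  have "(\<lambda>\<omega>. (c t \<omega>, 1::real)) \<in> borel_measurable M"
    using cost_measurable[OF assms(1)] by (intro borel_measurable_Pair) auto
  from measurable_sets[OF this assms(2)] show ?thesis by (simp add: vimage_def Int_def conj_commute)
qed

lemma child_event_measurable:
  assumes t: "t \<in> {2..T}"
  shows "child_event t e \<in> events"
proof -
  have "child_event t e = {\<omega>\<in>space M. \<xi> t \<omega> = snd e} \<inter> {\<omega>\<in>space M. (c t \<omega>, 1) \<in> rel_interior (fst e)}"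
    by (auto simp: child_event_def)
  then show ?thesis
    using atom_measurable[OF t] extended_cost_event[OF t borel_rel_interior] by auto
qed

lemma child_prob:
  assumes "t \<in> {2..T}" "d \<in> rv_support M (\<xi> t)"
  shows "p_data t d * p_check t N d = prob (child_event t (N, d))"
proof -
  have "p_data t d \<noteq> 0" using atom_prob_pos[OF assms] by (simp add: p_data_def)
  then show ?thesis
    by (simp add: p_data_def p_check_def cond_prob_def child_event_def conj_commute)
qed

text \<open>
  The default value in \<open>c_check\<close> is harmless: on an event of probability zero both sides vanish.
\<close>
lemma child_mean_scaled:
  assumes t: "t \<in> {2..T}"
  shows "prob (child_event t e) *\<^sub>R child_mean t e = (LINT \<omega>:child_event t e|M. c t \<omega>)"
proof (cases "prob (child_event t e) = 0")
  case True
  then have "child_event t e \<in> null_sets M"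
    using child_event_measurable[OF t] by (simp add: null_sets_def emeasure_eq_measure)
  then have "AE \<omega> in M. indicator (child_event t e) \<omega> *\<^sub>R c t \<omega> = 0"
    by (rule AE_I'[of "child_event t e"]) (auto simp: indicator_def)
  then have "(LINT \<omega>:child_event t e|M. c t \<omega>) = 0"
    unfolding set_lebesgue_integral_def by (rule integral_eq_zero_AE)
  then show ?thesis using True by simp
next
  case False
  then show ?thesis
    by (simp add: child_mean_def c_check_def Let_def child_event_def[symmetric])
qed

lemma child_integral:
  assumes t: "t \<in> {2..T}"
  shows "integrable M (\<lambda>\<omega>. indicator (child_event t e) \<omega> * (c t \<omega> \<bullet> y + r))" (is ?I)
    and "(\<integral>\<omega>. indicator (child_event t e) \<omega> * (c t \<omega> \<bullet> y + r) \<partial>M) =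
      prob (child_event t e) * (child_mean t e \<bullet> y + r)" (is ?V)
proof -
  let ?A = "child_event t e"
  have int: "integrable M (\<lambda>\<omega>. indicator ?A \<omega> *\<^sub>R c t \<omega>)"
    using c_integrable[OF t] child_event_measurable[OF t] by (rule integrable_mult_indicator[rotated])
  have eq: "(\<lambda>\<omega>. indicator ?A \<omega> * (c t \<omega> \<bullet> y + r)) =
      (\<lambda>\<omega>. (indicator ?A \<omega> *\<^sub>R c t \<omega>) \<bullet> y + indicator ?A \<omega> * r)"
    by (simp add: algebra_simps)
  have i1: "integrable M (\<lambda>\<omega>. (indicator ?A \<omega> *\<^sub>R c t \<omega>) \<bullet> y)"
    using int by (rule integrable_inner_left[rotated]) 
  have i2: "integrable M (\<lambda>\<omega>. indicator ?A \<omega> * r)"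
    using child_event_measurable[OF t, of e] by (intro integrable_mult_left integrable_real_indicator) (auto simp: emeasure_eq_measure)
  show ?I unfolding eq using i1 i2 by (rule Bochner_Integration.integrable_add)
  have "(\<integral>\<omega>. (indicator ?A \<omega> *\<^sub>R c t \<omega>) \<bullet> y \<partial>M) = (LINT \<omega>:?A|M. c t \<omega>) \<bullet> y"
    unfolding set_lebesgue_integral_def using int by (rule integral_inner_left[rotated])
  then show ?V
    unfolding eq Bochner_Integration.integral_add[OF i1 i2] child_mean_scaled[OF t, symmetric]
    using child_event_measurable[OF t] by (simp add: algebra_simps sets.Int_space_eq2)
qed

end

text \<open>One step of the backward recursion, with the induction hypothesis for the next stage.\<close>
locale program_stage = finitely_supported_program M T J c \<xi>
  for M :: "'w measure" and T :: nat and J :: "nat \<Rightarrow> 'n::finite set"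
    and c :: "nat \<Rightarrow> 'w \<Rightarrow> real^'n" and \<xi> :: "nat \<Rightarrow> 'w \<Rightarrow> ('n, 'm::finite) stage_data" +
  fixes t :: nat
  assumes t: "t \<in> {2..T}" and next_value: "polyhedral_value (t + 1)"
begin

abbreviation U :: "real^'n \<Rightarrow> real" where "U \<equiv> real_value (t + 1)"

abbreviation dual_space :: "((real^'n) \<times> real) set" where
  "dual_space \<equiv> coord_space (J t) \<times> UNIV"

definition stage_epigraph :: "('n, 'm) stage_data \<Rightarrow> ((real^'n) \<times> (real^'n) \<times> real) set" where
  "stage_epigraph d = {(x, y, z). x \<in> coord_space (J (t - 1)) \<and> y \<in> coord_space (J t) \<and>
     satisfies d x y \<and> V (t + 1) y \<le> ereal z}"

lemma t_le: "t \<le> T" "2 \<le> t" "2 \<le> t + 1" "t + 1 \<le> T + 1"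
  using t by auto

lemma subspace_dual: "subspace dual_space"
  by (intro subspace_Times subspace_coord_space subspace_UNIV)

lemma V_next: "y \<in> feasible_states (t + 1) \<Longrightarrow> V (t + 1) y = ereal (U y)"
  by (rule V_eq_real_value[OF t_le(3,4) next_value])

lemma next_feasible: "y \<in> coord_space (J t) \<Longrightarrow> V (t + 1) y \<le> ereal z \<Longrightarrow> y \<in> feasible_states (t + 1)"
  using V_infinite[OF t_le(3,4), of y] by fastforce

lemma stage_epigraph_iff:
  "(x, y, z) \<in> stage_epigraph d \<longleftrightarrow> (x, y) \<in> \<Union>(cost_complex t d) \<and> U y \<le> z"
  unfolding Union_cost_complex stage_epigraph_def
proof safe
  assume y: "y \<in> coord_space (J t)" "V (t + 1) y \<le> ereal z"
  show "y \<in> feasible_states (t + 1)" using next_feasible[OF y] .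
  from V_next[OF this] y(2) show "U y \<le> z" by simp
next
  fix \<tau> assume "y \<in> \<tau>" "\<tau> \<in> P_complex (t + 1)" "U y \<le> z"
  then show "V (t + 1) y \<le> ereal z" using V_next[OF UnionI, of \<tau> y] by simp
qed

sublocale epigraph: piecewise_affine_epigraph "stage_epigraph d" "cost_complex t d" "\<lambda>p. U (snd p)" for d
proof
  have "stage_epigraph d = {p. fst p \<in> coord_space (J (t - 1))} \<inter>
      {p. (fst p, fst (snd p)) \<in> {p. satisfies d (fst p) (snd p)}} \<inter>
      {p. snd p \<in> {(x, z). x \<in> coord_space (J (t + 1 - 1)) \<and> V (t + 1) x \<le> ereal z}}"
    by (auto simp: stage_epigraph_def)
  also have "polyhedron \<dots>"
  proof (intro polyhedron_Int polyhedron_linear_vimage)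
    show "polyhedron {(x, z). x \<in> coord_space (J (t + 1 - 1)) \<and> V (t + 1) x \<le> ereal z}"
      by (rule polyhedral_valueD(2)[OF next_value])
  qed (auto simp: linear_iff polyhedron_satisfies polyhedron_coord_space)
  finally show "polyhedron (stage_epigraph d)" .
next
  show "relint_stratified (cost_complex t d)" by (rule stratified_cost_complex[OF t])
next
  fix G assume "G \<in> cost_complex t d"
  then obtain \<tau> where \<tau>: "\<tau> \<in> P_complex (t + 1)" "G \<subseteq> coord_space (J (t - 1)) \<times> \<tau>"
    by (auto simp: cost_complex_def meet_def)
  obtain g \<beta> where g: "\<And>y. y \<in> \<tau> \<Longrightarrow> V (t + 1) y = ereal (g \<bullet> y + \<beta>)"
    using polyhedral_valueD(3)[OF next_value \<tau>(1)] by metis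
  have "U (snd p) = (0, g) \<bullet> p + \<beta>" if "p \<in> G" for p
    using \<tau>(2) that g[of "snd p"] by (auto simp: real_value_def inner_prod_def)
  then show "\<exists>q \<beta>. \<forall>p\<in>G. U (snd p) = q \<bullet> p + \<beta>" by blast
next
  fix x y z
  show "((x, y, z) \<in> stage_epigraph d) = ((x, y) \<in> \<Union>(cost_complex t d) \<and> U (snd (x, y)) \<le> z)"
    using stage_epigraph_iff by simp
qed

lemma epi_fiber_eq:
  assumes "x \<in> coord_space (J (t - 1))"
  shows "epi_fiber t d x = {w. (x, w) \<in> stage_epigraph d}"
  using assms by (auto simp: epi_fiber_def Q_def stage_epigraph_def split: if_splits)

lemma cell_point_coord: "\<sigma> \<in> P_complex_at t d \<Longrightarrow> cell_point \<sigma> \<in> coord_space (J (t - 1))"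
  using cell_point_relint[OF t] rel_interior_subset mem_P_complex_at_coord by blast

lemma polyhedron_epi_fiber:
  assumes "x \<in> coord_space (J (t - 1))"
  shows "polyhedron (epi_fiber t d x)"
proof -
  have "{w. (0, w) + (x, 0) \<in> stage_epigraph d} = epi_fiber t d x"
    by (simp add: epi_fiber_eq[OF assms])
  moreover have "polyhedron {w. (0, w) + (x, 0) \<in> stage_epigraph d}"
    by (intro polyhedron_affine_vimage epigraph.polyhedron_K) (auto simp: linear_iff)
  ultimately show ?thesis by simp
qed

lemma finite_N_fan: "finite (N_fan t d)"
  unfolding N_fan_eq
  using relint_stratifiedD(1)[OF stratified_P_complex_at[OF t]]
  by (intro finite_common_refinement finite_min_cones polyhedron_epi_fiber cell_point_coord)

lemma finite_children: "finite (children t)"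
  unfolding children_def using finite_support[OF t] finite_N_fan by (simp add: finite_SigmaI)

text \<open>
  The representative of the chamber of \<open>x\<close> lies in its relative interior, so the normal cone over
  the representative that contains \<open>N\<close> transfers to \<open>x\<close> by \<open>min_cone_transfers_from_chamber\<close>.
\<close>
lemma common_minimiser:
  assumes x: "x \<in> \<Union>(P_complex_at t d)" and N: "N \<in> N_fan t d"
  obtains y where "(x, y, U y) \<in> stage_epigraph d"
    "\<And>\<alpha> w. \<alpha> \<in> N \<Longrightarrow> (x, w) \<in> stage_epigraph d \<Longrightarrow> \<alpha> \<bullet> (y, U y) \<le> \<alpha> \<bullet> w"
proof -
  let ?\<sigma> = "chamber (cost_complex t d) fst x"
  have xp: "x \<in> fst ` \<Union>(cost_complex t d)"
    using x unfolding P_complex_at_eq Union_chamber_complex .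
  then have \<sigma>: "?\<sigma> \<in> P_complex_at t d" unfolding P_complex_at_eq chamber_complex_def by (rule imageI)
  let ?x1 = "cell_point ?\<sigma>"
  obtain S where S: "N = dual_space \<inter> (\<Inter>\<sigma>\<in>P_complex_at t d. S \<sigma>)"
    "\<forall>\<sigma>\<in>P_complex_at t d. S \<sigma> \<in> min_cone dual_space (epi_fiber t d (cell_point \<sigma>)) ` epi_fiber t d (cell_point \<sigma>)"
    using N unfolding N_fan_eq common_refinement_def mem_Collect_eq by metis
  obtain w1 where w1: "w1 \<in> epi_fiber t d ?x1" "S ?\<sigma> = min_cone dual_space (epi_fiber t d ?x1) w1"
    using bspec[OF S(2) \<sigma>] by (rule imageE)
  have Nw1: "N \<subseteq> min_cone dual_space (epi_fiber t d ?x1) w1"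
    unfolding w1(2)[symmetric] S(1) using \<sigma> by (intro le_infI2 INT_lower)
  have fib: "epi_fiber t d ?x1 = {w. (?x1, w) \<in> stage_epigraph d}"
    by (rule epi_fiber_eq[OF cell_point_coord[OF \<sigma>]])
  have w1K: "(?x1, w1) \<in> stage_epigraph d" using w1(1) fib by simp
  obtain y0 where y0: "(x, y0, U (snd (x, y0))) \<in> stage_epigraph d"
    "min_cone dual_space {w. (?x1, w) \<in> stage_epigraph d} w1 \<subseteq>
     min_cone dual_space {w. (x, w) \<in> stage_epigraph d} (y0, U (snd (x, y0)))"
    using epigraph.min_cone_transfers_from_chamber[OF subspace_dual xp cell_point_relint[OF t \<sigma>] w1K]
    by metis
  show thesis
  proof (rule that)
    show "(x, y0, U y0) \<in> stage_epigraph d" using y0(1) by simp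
    fix \<alpha> w assume "\<alpha> \<in> N" "(x, w) \<in> stage_epigraph d"
    then show "\<alpha> \<bullet> (y0, U y0) \<le> \<alpha> \<bullet> w"
      using y0(2) Nw1 unfolding fib min_cone_def snd_conv by blast
  qed
qed

lemma stage_value_eq:
  assumes K: "(x, y, U y) \<in> stage_epigraph d"
    and min: "\<And>w. (x, w) \<in> stage_epigraph d \<Longrightarrow> (a, 1) \<bullet> (y, U y) \<le> (a, 1) \<bullet> w"
  shows "stage_value t d a x = ereal (a \<bullet> y + U y)"
proof (rule antisym)
  have y: "x \<in> coord_space (J (t - 1))" "y \<in> coord_space (J t)" "satisfies d x y" "y \<in> feasible_states (t + 1)"
    using K next_feasible by (auto simp: stage_epigraph_def)
  show "stage_value t d a x \<le> ereal (a \<bullet> y + U y)"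
    using stage_value_le[OF y(2,3), of a] V_next[OF y(4)] by simp
  show "ereal (a \<bullet> y + U y) \<le> stage_value t d a x"
    unfolding stage_value_def
  proof (rule INF_greatest)
    fix y' assume y': "y' \<in> {y \<in> coord_space (J t). satisfies d x y}"
    show "ereal (a \<bullet> y + U y) \<le> ereal (a \<bullet> y') + V (t + 1) y'"
    proof (cases "y' \<in> feasible_states (t + 1)")
      case True
      then have "(x, y', U y') \<in> stage_epigraph d"
        using y(1) y' V_next by (simp add: stage_epigraph_def)
      from min[OF this] show ?thesis using V_next[OF True] by simp
    next
      case False
      then show ?thesis using V_infinite[OF t_le(3,4), of y'] y' by simp
    qed
  qed
qed

text \<open>
  Boundedness over the fiber of one state carries over to the representatives of all chambers by
  \<open>fiber_minimum_transfer\<close>, so the cost lies in the support of every fan in the refinement.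
\<close>
lemma bounded_cost_in_fan:
  assumes x: "x \<in> \<Union>(P_complex_at t d)" and a: "a \<in> coord_space (J t)"
    and bd: "stage_value t d a x \<noteq> - \<infinity>"
  shows "\<exists>N\<in>N_fan t d. (a, 1) \<in> rel_interior N"
proof -
  obtain y where "(x, y) \<in> \<Union>(cost_complex t d)"
    using x unfolding P_complex_at_eq Union_chamber_complex by force
  then have K: "(x, y, U y) \<in> stage_epigraph d" using stage_epigraph_iff by simp
  have le: "stage_value t d a x \<le> ereal ((a, 1) \<bullet> w)" if w: "(x, w) \<in> stage_epigraph d" for w
  proof -
    obtain y z where yz: "w = (y, z)" by force
    have "y \<in> coord_space (J t)" "satisfies d x y" "V (t + 1) y \<le> ereal z"
      using w unfolding yz stage_epigraph_def by auto
    then have "stage_value t d a x \<le> ereal (a \<bullet> y) + ereal z"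
      using stage_value_le[of y t d x a] by (meson add_left_mono order_trans)
    then show ?thesis by (simp add: yz)
  qed
  then obtain m where "stage_value t d a x = ereal m"
    using bd K by (cases "stage_value t d a x") fastforce+
  then have m: "m \<le> (a, 1) \<bullet> w" if "(x, w) \<in> stage_epigraph d" for w using le[OF that] by simp
  obtain w0 where w0: "(x, w0) \<in> stage_epigraph d"
    "\<And>w. (x, w) \<in> stage_epigraph d \<Longrightarrow> (a, 1) \<bullet> w0 \<le> (a, 1) \<bullet> w"
    using fiber_minimum_attained[OF epigraph.polyhedron_K K m] by metis
  have E: "(a, 1) \<in> dual_space" using a by simp
  have min: "\<exists>p\<in>epi_fiber t d (cell_point \<sigma>). (a, 1) \<in> min_cone dual_space (epi_fiber t d (cell_point \<sigma>)) p"
    if \<sigma>: "\<sigma> \<in> P_complex_at t d" for \<sigma>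
  proof -
    let ?x1 = "cell_point \<sigma>"
    have fib: "epi_fiber t d ?x1 = {w. (?x1, w) \<in> stage_epigraph d}"
      by (rule epi_fiber_eq[OF cell_point_coord[OF \<sigma>]])
    have "epi_fiber t d ?x1 \<noteq> {}"
      using cell_point_relint[OF t \<sigma>] rel_interior_subset[of \<sigma>] \<sigma> by (intro epi_fiber_nonempty[OF t]) blast
    then obtain w where "(?x1, w) \<in> stage_epigraph d" using fib by auto
    then obtain w1 where "(?x1, w1) \<in> stage_epigraph d"
      "\<And>w. (?x1, w) \<in> stage_epigraph d \<Longrightarrow> (a, 1) \<bullet> w1 \<le> (a, 1) \<bullet> w"
      using fiber_minimum_transfer[OF epigraph.polyhedron_K w0] by metis
    then show ?thesis unfolding fib min_cone_def using E by blast
  qed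
  have fin: "finite (P_complex_at t d)" using relint_stratifiedD(1)[OF stratified_P_complex_at[OF t]] .
  have poly: "polyhedron (epi_fiber t d (cell_point \<sigma>))" if "\<sigma> \<in> P_complex_at t d" for \<sigma>
    using that by (intro polyhedron_epi_fiber cell_point_coord)
  have sub: "epi_fiber t d (cell_point \<sigma>) \<subseteq> dual_space" for \<sigma> by (auto simp: epi_fiber_def)
  obtain N where "N \<in> common_refinement dual_space (P_complex_at t d)
     (\<lambda>\<sigma>. min_cone dual_space (epi_fiber t d (cell_point \<sigma>)) ` epi_fiber t d (cell_point \<sigma>))"
    "(a, 1) \<in> rel_interior N"
    by (rule refined_fan_relint_covers[OF subspace_dual fin poly sub E min])
  then show ?thesis unfolding N_fan_eq by (rule bexI[rotated])
qed

lemma feasible_state_at: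
  assumes "x \<in> feasible_states t" "d \<in> rv_support M (\<xi> t)"
  shows "x \<in> \<Union>(P_complex_at t d)"
  using assms feasible_states_step[OF t_le(1)] unfolding Union_P_complex_at by blast

text \<open>
  The costs outside the relative interiors of the cones have stage value \<open>-\<infinity>\<close>, and the event of
  such costs is measurable; with positive probability it would give \<open>V t x = -\<infinity>\<close>.
\<close>
lemma AE_cost_in_fan:
  assumes x: "x \<in> feasible_states t" and V: "V t x \<noteq> - \<infinity>"
  shows "AE \<omega> in M. \<exists>e\<in>children t. \<omega> \<in> child_event t e"
proof -
  let ?bad = "\<lambda>d. {\<omega>\<in>space M. \<xi> t \<omega> = d} - (\<Union>N\<in>N_fan t d. child_event t (N, d))"
  have meas: "?bad d \<in> events" for d
    using atom_measurable[OF t] child_event_measurable[OF t] finite_N_fan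
    by (intro sets.Diff sets.finite_UN) auto
  have "?bad d \<in> null_sets M" if d: "d \<in> rv_support M (\<xi> t)" for d
  proof (rule ccontr)
    assume "\<not> ?thesis"
    then have pos: "emeasure M (?bad d) > 0"
      using meas[of d] by (auto simp: null_sets_def zero_less_iff_neq_zero)
    have inf: "stage_value t (\<xi> t \<omega>) (c t \<omega>) x = - \<infinity>" if \<omega>: "\<omega> \<in> ?bad d" for \<omega>
    proof (rule ccontr)
      assume "stage_value t (\<xi> t \<omega>) (c t \<omega>) x \<noteq> - \<infinity>"
      then have "\<exists>N\<in>N_fan t d. (c t \<omega>, 1) \<in> rel_interior N"
        using bounded_cost_in_fan[OF feasible_state_at[OF x d]] c_coord[OF t] \<omega> by auto
      then show False using \<omega> by (auto simp: child_event_def)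
    qed
    obtain g :: "'w \<Rightarrow> real" where g: "integrable M g"
      "AE \<omega> in M. stage_value t (\<xi> t \<omega>) (c t \<omega>) x \<le> ereal (g \<omega>)"
      using stage_value_bounded_above[OF t x V_less_infinity[OF t_le(3,4)]] by metis
    have "V t x = - \<infinity>"
      unfolding V_step[OF t_le(1)] using ereal_expectation_minus_infinity[OF g(2,1) meas pos inf] .
    with V show False by simp
  qed
  then have "AE \<omega> in M. \<omega> \<notin> ?bad d" if "d \<in> rv_support M (\<xi> t)" for d
    using AE_not_in that by blast
  then have "AE \<omega> in M. \<forall>d\<in>rv_support M (\<xi> t). \<omega> \<notin> ?bad d"
    using finite_support[OF t] by (intro AE_finite_allI)
  then show ?thesis
    using AE_in_support[OF t] AE_space
  proof eventually_elim
    case (elim \<omega>)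
    then obtain N where "N \<in> N_fan t (\<xi> t \<omega>)" "\<omega> \<in> child_event t (N, \<xi> t \<omega>)" by blast
    then show ?case using elim(2) by (intro bexI[of _ "(N, \<xi> t \<omega>)"]) (auto simp: mem_children)
  qed
qed

lemma child_event_unique:
  assumes e: "e \<in> children t" "\<omega> \<in> child_event t e" and e': "e' \<in> children t" "\<omega> \<in> child_event t e'"
  shows "e = e'"
proof -
  obtain N d where Nd: "e = (N, d)" by (rule prod.exhaust)
  obtain N' d' where Nd': "e' = (N', d')" by (rule prod.exhaust)
  have "d = d'" using e(2) e'(2) by (simp add: Nd Nd' child_event_def)
  moreover have "N = N'"
  proof (rule refined_fan_relint_disjoint)
    show "convex dual_space" by (rule subspace_imp_convex[OF subspace_dual])
    show "N \<in> common_refinement dual_space (P_complex_at t d)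
     (\<lambda>\<sigma>. min_cone dual_space (epi_fiber t d (cell_point \<sigma>)) ` epi_fiber t d (cell_point \<sigma>))"
      using e(1) unfolding Nd mem_children N_fan_eq by blast
    show "N' \<in> common_refinement dual_space (P_complex_at t d)
     (\<lambda>\<sigma>. min_cone dual_space (epi_fiber t d (cell_point \<sigma>)) ` epi_fiber t d (cell_point \<sigma>))"
      using e'(1) \<open>d = d'\<close> unfolding Nd' mem_children N_fan_eq by blast
    show "(c t \<omega>, 1) \<in> rel_interior N" "(c t \<omega>, 1) \<in> rel_interior N'"
      using e(2) e'(2) by (auto simp: Nd Nd' child_event_def)
  qed
  ultimately show ?thesis using Nd Nd' by simp
qed

end

context program_stage
begin

definition minimiser :: "real^'n \<Rightarrow> ((real^'n) \<times> real) set \<times> ('n, 'm) stage_data \<Rightarrow> real^'n" where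
  "minimiser x e = (SOME y. (x, y, U y) \<in> stage_epigraph (snd e) \<and>
     (\<forall>\<alpha>\<in>fst e. \<forall>w. (x, w) \<in> stage_epigraph (snd e) \<longrightarrow> \<alpha> \<bullet> (y, U y) \<le> \<alpha> \<bullet> w))"

definition child_value :: "real^'n \<Rightarrow> ((real^'n) \<times> real) set \<times> ('n, 'm) stage_data \<Rightarrow> real" where
  "child_value x e = child_mean t e \<bullet> minimiser x e + U (minimiser x e)"

lemma minimiser:
  assumes x: "x \<in> feasible_states t" and e: "e \<in> children t"
  shows "(x, minimiser x e, U (minimiser x e)) \<in> stage_epigraph (snd e)"
    and "\<And>\<alpha> w. \<alpha> \<in> fst e \<Longrightarrow> (x, w) \<in> stage_epigraph (snd e) \<Longrightarrow>
      \<alpha> \<bullet> (minimiser x e, U (minimiser x e)) \<le> \<alpha> \<bullet> w"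
proof -
  obtain N d where Nd: "e = (N, d)" by (rule prod.exhaust)
  have d: "d \<in> rv_support M (\<xi> t)" "N \<in> N_fan t d" using e unfolding Nd mem_children by blast+
  obtain y where "(x, y, U y) \<in> stage_epigraph d"
    "\<And>\<alpha> w. \<alpha> \<in> N \<Longrightarrow> (x, w) \<in> stage_epigraph d \<Longrightarrow> \<alpha> \<bullet> (y, U y) \<le> \<alpha> \<bullet> w"
    using common_minimiser[OF feasible_state_at[OF x d(1)] d(2)] by metis
  then have "\<exists>y. (x, y, U y) \<in> stage_epigraph (snd e) \<and>
     (\<forall>\<alpha>\<in>fst e. \<forall>w. (x, w) \<in> stage_epigraph (snd e) \<longrightarrow> \<alpha> \<bullet> (y, U y) \<le> \<alpha> \<bullet> w)"
    unfolding Nd fst_conv snd_conv by (intro exI[of _ y] conjI ballI allI impI)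
  from someI_ex[OF this, folded minimiser_def]
  show "(x, minimiser x e, U (minimiser x e)) \<in> stage_epigraph (snd e)"
    and "\<And>\<alpha> w. \<alpha> \<in> fst e \<Longrightarrow> (x, w) \<in> stage_epigraph (snd e) \<Longrightarrow>
      \<alpha> \<bullet> (minimiser x e, U (minimiser x e)) \<le> \<alpha> \<bullet> w"
    by blast+
qed

text \<open>
  On the event of a child the optimal decision does not depend on the cost vector, so the optimal
  value is affine in it and may be evaluated at the conditional mean.
\<close>
lemma V_quantised:
  assumes x1: "x1 \<in> feasible_states t" "V t x1 \<noteq> - \<infinity>" and x: "x \<in> feasible_states t"
  shows "V t x = ereal (\<Sum>e\<in>children t. prob (child_event t e) * child_value x e)"
proof -
  let ?f = "\<lambda>e \<omega>. indicator (child_event t e) \<omega> * (c t \<omega> \<bullet> minimiser x e + U (minimiser x e))"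
  have ae: "AE \<omega> in M. stage_value t (\<xi> t \<omega>) (c t \<omega>) x = ereal (\<Sum>e\<in>children t. ?f e \<omega>)"
    using AE_cost_in_fan[OF x1]
  proof eventually_elim
    case (elim \<omega>)
    then obtain e where e: "e \<in> children t" "\<omega> \<in> child_event t e" by blast
    have d: "\<xi> t \<omega> = snd e" "(c t \<omega>, 1) \<in> fst e"
      using e(2) rel_interior_subset[of "fst e"] by (auto simp: child_event_def)
    have "?f e' \<omega> = (if e' = e then c t \<omega> \<bullet> minimiser x e + U (minimiser x e) else 0)"
      if "e' \<in> children t" for e'
      using child_event_unique[OF e that] e(2) by (cases "\<omega> \<in> child_event t e'") auto
    then have "(\<Sum>e\<in>children t. ?f e \<omega>) = c t \<omega> \<bullet> minimiser x e + U (minimiser x e)"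
      using e(1) finite_children by (simp add: sum.delta cong: sum.cong)
    then show ?case
      unfolding d(1) using stage_value_eq[OF minimiser(1)[OF x e(1)] minimiser(2)[OF x e(1) d(2)]] by simp
  qed
  have int: "integrable M (\<lambda>\<omega>. \<Sum>e\<in>children t. ?f e \<omega>)"
    by (intro Bochner_Integration.integrable_sum child_integral(1)[OF t])
  have "(\<integral>\<omega>. (\<Sum>e\<in>children t. ?f e \<omega>) \<partial>M) =
      (\<Sum>e\<in>children t. prob (child_event t e) * child_value x e)"
    by (subst Bochner_Integration.integral_sum)
      (simp_all add: child_integral[OF t] child_value_def)
  then show ?thesis
    unfolding V_step[OF t_le(1)] ereal_expectation_integrable[OF ae int] by simp
qed

text \<open>
  Optimality of the common minimiser for each cost vector of the event integrates to optimality for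
  the mean. The factor is the probability of the child: at probability zero the
  conditional mean is a default value and need not be minimised there.
\<close>
lemma child_value_le:
  assumes x: "x \<in> feasible_states t" and e: "e \<in> children t" and w: "(x, y, z) \<in> stage_epigraph (snd e)"
  shows "prob (child_event t e) * child_value x e \<le> prob (child_event t e) * (child_mean t e \<bullet> y + z)"
  unfolding child_value_def child_integral(2)[OF t, symmetric]
proof (rule integral_mono[OF child_integral(1)[OF t] child_integral(1)[OF t]])
  fix \<omega>
  show "indicator (child_event t e) \<omega> * (c t \<omega> \<bullet> minimiser x e + U (minimiser x e))
    \<le> indicator (child_event t e) \<omega> * (c t \<omega> \<bullet> y + z)"
  proof (cases "\<omega> \<in> child_event t e")
    case True
    then have "(c t \<omega>, 1) \<in> fst e"
      using rel_interior_subset[of "fst e"] by (auto simp: child_event_def)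
    from minimiser(2)[OF x e this w] show ?thesis using True by simp
  qed simp
qed

lemma feasible_states_coord_space: "x \<in> feasible_states t \<Longrightarrow> x \<in> coord_space (J (t - 1))"
  using feasible_states_coord[of t] t by auto

text \<open>
  For a child of positive probability the value is the minimum of the mean cost over the fiber,
  which is affine on the chamber of the child's data that contains \<open>\<sigma>\<close>.
\<close>
lemma child_value_affine:
  assumes \<sigma>: "\<sigma> \<in> P_complex t" and e: "e \<in> children t"
  shows "\<exists>g \<beta>. \<forall>x\<in>\<sigma>. prob (child_event t e) * child_value x e = g \<bullet> x + \<beta>"
proof (cases "prob (child_event t e) = 0 \<or> \<sigma> = {}")
  case True
  then show ?thesis by (intro exI[of _ 0]) auto
next
  case False
  then have p: "prob (child_event t e) > 0" using measure_nonneg[of M "child_event t e"] by linarith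
  obtain N d where Nd: "e = (N, d)" by (rule prod.exhaust)
  have d: "d \<in> rv_support M (\<xi> t)" using e unfolding Nd mem_children by blast
  let ?\<alpha> = "(child_mean t e, 1 :: real)"
  have feas: "x \<in> feasible_states t" if "x \<in> \<sigma>" for x using \<sigma> that by blast
  have opt: "?\<alpha> \<bullet> (minimiser x e, U (minimiser x e)) \<le> ?\<alpha> \<bullet> w"
    if "x \<in> \<sigma>" "(x, w) \<in> stage_epigraph d" for x w
    using child_value_le[OF feas[OF that(1)] e, of "fst w" "snd w"] that(2) p
    by (simp add: Nd child_value_def inner_prod_def)
  have P: "P_complex t = common_refinement (coord_space (J (t - 1))) (rv_support M (\<xi> t))
      (stage_complex t (P_complex (t + 1)))"
    using t_le(1) by (subst P_complex.simps) simp
  obtain S where S: "\<sigma> = coord_space (J (t - 1)) \<inter> (\<Inter>d\<in>rv_support M (\<xi> t). S d)"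
    "\<forall>d\<in>rv_support M (\<xi> t). S d \<in> P_complex_at t d"
    using \<sigma> unfolding P common_refinement_def mem_Collect_eq by metis
  have "S d \<in> P_complex_at t d" using S(2) d by blast
  then obtain xd where xd: "S d = chamber (cost_complex t d) fst xd" "xd \<in> fst ` \<Union>(cost_complex t d)"
    unfolding P_complex_at_eq chamber_complex_def by (rule imageE)
  obtain yd where "(xd, yd) \<in> \<Union>(cost_complex t d)" using xd(2) by force
  then have Kd: "(xd, yd, U yd) \<in> stage_epigraph d" using stage_epigraph_iff by simp
  obtain x0 where x0: "x0 \<in> \<sigma>" using False by blast
  have "(x0, minimiser x0 e, U (minimiser x0 e)) \<in> stage_epigraph d"
    using minimiser(1)[OF feas[OF x0] e] by (simp add: Nd)
  from fiber_minimum_transfer[OF epigraph.polyhedron_K this opt[OF x0] Kd]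
  obtain w0 where w0: "(xd, w0) \<in> stage_epigraph d" "\<And>w. (xd, w) \<in> stage_epigraph d \<Longrightarrow> ?\<alpha> \<bullet> w0 \<le> ?\<alpha> \<bullet> w"
    by metis
  obtain y0 z0 where yz: "w0 = (y0, z0)" by (rule prod.exhaust)
  obtain g where g: "\<And>x. x \<in> chamber (cost_complex t d) fst xd \<Longrightarrow> \<exists>y. (x, y, U (snd (x, y))) \<in> stage_epigraph d \<and>
     (\<forall>w. (x, w) \<in> stage_epigraph d \<longrightarrow> ?\<alpha> \<bullet> (y, U (snd (x, y))) \<le> ?\<alpha> \<bullet> w) \<and>
     ?\<alpha> \<bullet> (y, U (snd (x, y))) = ?\<alpha> \<bullet> (y0, z0) + g \<bullet> (x - xd)"
    using epigraph.minimum_affine_on_chamber[OF w0[unfolded yz]] by metis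
  show ?thesis
  proof (intro exI ballI)
    fix x assume x: "x \<in> \<sigma>"
    then have "x \<in> chamber (cost_complex t d) fst xd" using S(1) d xd(1) by blast
    from g[OF this] obtain y where y: "(x, y, U y) \<in> stage_epigraph d"
      "\<And>w. (x, w) \<in> stage_epigraph d \<Longrightarrow> ?\<alpha> \<bullet> (y, U y) \<le> ?\<alpha> \<bullet> w"
      "?\<alpha> \<bullet> (y, U y) = ?\<alpha> \<bullet> (y0, z0) + g \<bullet> (x - xd)" by auto
    have "(x, minimiser x e, U (minimiser x e)) \<in> stage_epigraph d"
      using minimiser(1)[OF feas[OF x] e] by (simp add: Nd)
    then have "?\<alpha> \<bullet> (minimiser x e, U (minimiser x e)) = ?\<alpha> \<bullet> (y, U y)"
      using opt[OF x y(1)] y(2) by (intro antisym)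
    then have cv: "child_value x e = ?\<alpha> \<bullet> (y0, z0) + g \<bullet> (x - xd)"
      using y(3) by (simp add: child_value_def)
    show "prob (child_event t e) * child_value x e =
      (prob (child_event t e) *\<^sub>R g) \<bullet> x + prob (child_event t e) * (?\<alpha> \<bullet> (y0, z0) - g \<bullet> xd)"
      unfolding cv inner_scaleR_left inner_diff_right by (simp add: algebra_simps)
  qed
qed

text \<open>
  The auxiliary values \<open>\<zeta>\<close> range over the epigraphs of the child problems with mean costs,
  which are linear images of polyhedra. If they exist, \<open>x\<close> is a feasible state, since every data
  in the support occurs in some child.
\<close>
lemma V_le_iff:
  assumes x1: "x1 \<in> feasible_states t" "V t x1 \<noteq> - \<infinity>"
  shows "x \<in> coord_space (J (t - 1)) \<and> V t x \<le> ereal z \<longleftrightarrow> x \<in> coord_space (J (t - 1)) \<and>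
    (\<exists>\<zeta>. (\<forall>e\<in>children t. (x, \<zeta> e) \<in>
        (\<lambda>p. (fst p, child_mean t e \<bullet> fst (snd p) + snd (snd p))) ` stage_epigraph (snd e)) \<and>
      (\<Sum>e\<in>children t. prob (child_event t e) * \<zeta> e) \<le> z)"
proof (intro conj_cong refl iffI)
  assume x: "x \<in> coord_space (J (t - 1))" "V t x \<le> ereal z"
  then have feas: "x \<in> feasible_states t" using V_infinite[of t x] t_le by fastforce
  have "(x, child_value x e) \<in>
        (\<lambda>p. (fst p, child_mean t e \<bullet> fst (snd p) + snd (snd p))) ` stage_epigraph (snd e)"
    if "e \<in> children t" for e
    using minimiser(1)[OF feas that] by (rule rev_image_eqI) (simp add: child_value_def)
  moreover have "(\<Sum>e\<in>children t. prob (child_event t e) * child_value x e) \<le> z"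
    using V_quantised[OF x1 feas] x(2) by simp
  ultimately show "\<exists>\<zeta>. (\<forall>e\<in>children t. (x, \<zeta> e) \<in>
        (\<lambda>p. (fst p, child_mean t e \<bullet> fst (snd p) + snd (snd p))) ` stage_epigraph (snd e)) \<and>
      (\<Sum>e\<in>children t. prob (child_event t e) * \<zeta> e) \<le> z"
    by (intro exI[of _ "child_value x"] conjI ballI)
next
  assume x: "x \<in> coord_space (J (t - 1))" and "\<exists>\<zeta>. (\<forall>e\<in>children t. (x, \<zeta> e) \<in>
        (\<lambda>p. (fst p, child_mean t e \<bullet> fst (snd p) + snd (snd p))) ` stage_epigraph (snd e)) \<and>
      (\<Sum>e\<in>children t. prob (child_event t e) * \<zeta> e) \<le> z"
  then obtain \<zeta> where \<zeta>: "\<forall>e\<in>children t. (x, \<zeta> e) \<in>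
        (\<lambda>p. (fst p, child_mean t e \<bullet> fst (snd p) + snd (snd p))) ` stage_epigraph (snd e)"
      "(\<Sum>e\<in>children t. prob (child_event t e) * \<zeta> e) \<le> z" by (elim exE conjE)
  have K: "\<exists>y v. (x, y, v) \<in> stage_epigraph (snd e) \<and> \<zeta> e = child_mean t e \<bullet> y + v"
    if "e \<in> children t" for e using bspec[OF \<zeta>(1) that] by force
  have "\<exists>y\<in>coord_space (J t). y \<in> feasible_states (t + 1) \<and> satisfies d x y"
    if d: "d \<in> rv_support M (\<xi> t)" for d
  proof -
    obtain N where "N \<in> N_fan t d" using N_fan_nonempty[OF t] by blast
    then have "(N, d) \<in> children t" using d by (simp add: mem_children)
    from K[OF this] obtain y v where "(x, y, v) \<in> stage_epigraph d" by auto
    then show ?thesis using next_feasible unfolding stage_epigraph_def by blast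
  qed
  then have feas: "x \<in> feasible_states t" using x feasible_states_step[OF t_le(1)] by blast
  have "(\<Sum>e\<in>children t. prob (child_event t e) * child_value x e) \<le>
      (\<Sum>e\<in>children t. prob (child_event t e) * \<zeta> e)"
  proof (rule sum_mono)
    fix e assume e: "e \<in> children t"
    from K[OF e] obtain y v where "(x, y, v) \<in> stage_epigraph (snd e)" "\<zeta> e = child_mean t e \<bullet> y + v"
      by blast
    then show "prob (child_event t e) * child_value x e \<le> prob (child_event t e) * \<zeta> e"
      using child_value_le[OF feas e] by simp
  qed
  then show "V t x \<le> ereal z" using V_quantised[OF x1 feas] \<zeta>(2) by simp
qed

lemma polyhedral_value_stage:
  assumes x1: "x1 \<in> feasible_states t" "V t x1 \<noteq> - \<infinity>"
  shows "polyhedral_value t"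
  unfolding polyhedral_value_def
proof (intro conjI ballI)
  fix x assume "x \<in> feasible_states t"
  then show "V t x \<noteq> - \<infinity>" using V_quantised[OF x1] by simp
next
  let ?L = "\<lambda>e. (\<lambda>p. (fst p, child_mean t e \<bullet> fst (snd p) + snd (snd p))) ` stage_epigraph (snd e)"
  have "polyhedron (?L e)" for e
    by (intro polyhedron_linear_image epigraph.polyhedron_K)
      (auto simp: linear_iff inner_add_right algebra_simps)
  then have "polyhedron {(x, z). x \<in> coord_space (J (t - 1)) \<and>
      (\<exists>\<zeta>. (\<forall>e\<in>children t. (x, \<zeta> e) \<in> ?L e) \<and> (\<Sum>e\<in>children t. prob (child_event t e) * \<zeta> e) \<le> z)}"
    by (intro polyhedron_weighted_sum_epigraph finite_children polyhedron_coord_space)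
  then show "polyhedron {(x, z). x \<in> coord_space (J (t - 1)) \<and> V t x \<le> ereal z}"
    unfolding V_le_iff[OF x1] .
next
  fix \<sigma> assume \<sigma>: "\<sigma> \<in> P_complex t"
  then obtain g \<beta> where g: "\<And>e x. e \<in> children t \<Longrightarrow> x \<in> \<sigma> \<Longrightarrow>
      prob (child_event t e) * child_value x e = g e \<bullet> x + \<beta> e"
    using child_value_affine by metis
  have "V t x = ereal ((\<Sum>e\<in>children t. g e) \<bullet> x + (\<Sum>e\<in>children t. \<beta> e))" if "x \<in> \<sigma>" for x
  proof -
    have "x \<in> feasible_states t" using that \<sigma> by blast
    from V_quantised[OF x1 this] show ?thesis
      using g[OF _ that] by (simp add: inner_sum_left sum.distrib cong: sum.cong)
  qed
  then show "\<exists>g \<beta>. \<forall>x\<in>\<sigma>. V t x = ereal (g \<bullet> x + \<beta>)" by blast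
qed

end

context finitely_supported_program
begin

lemma polyhedral_value_final: "1 \<le> T \<Longrightarrow> polyhedral_value (T + 1)"
proof -
  have "{(x, z). x \<in> coord_space (J (T + 1 - 1)) \<and> V (T + 1) x \<le> ereal z} =
      coord_space (J T) \<times> {z. 1 \<bullet> z \<ge> (0::real)}"
    unfolding V_final by (auto simp: zero_ereal_def)
  moreover have "polyhedron \<dots>"
    by (intro polyhedron_Times_sets polyhedron_coord_space polyhedron_halfspace_ge)
  moreover have "\<exists>g \<beta>. \<forall>x\<in>\<sigma>. V (T + 1) x = ereal (g \<bullet> x + \<beta>)" for \<sigma>
    unfolding V_final by (intro exI[of _ 0]) (simp add: zero_ereal_def)
  ultimately show ?thesis unfolding polyhedral_value_def by (simp only: V_final) simp
qed

text \<open>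
  Some data has positive probability, and a feasible decision of value \<open>-\<infinity>\<close> for it would make
  \<open>V t x\<close> equal to \<open>-\<infinity>\<close>.
\<close>
lemma next_value_finite:
  assumes t: "t \<in> {2..T}" and x: "x \<in> feasible_states t" "V t x \<noteq> - \<infinity>"
  shows "\<exists>y\<in>feasible_states (t + 1). V (t + 1) y \<noteq> - \<infinity>"
proof -
  have tle: "t \<le> T" "2 \<le> t + 1" "t + 1 \<le> T + 1" using t by auto
  have "\<exists>\<omega>. \<xi> t \<omega> \<in> rv_support M (\<xi> t)"
    using AE_in_support[OF t] ae_filter_bot by (rule eventually_happens'[rotated])
  then obtain d where d: "d \<in> rv_support M (\<xi> t)" by blast
  obtain y where y: "y \<in> coord_space (J t)" "y \<in> feasible_states (t + 1)" "satisfies d x y"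
    using x(1) d feasible_states_step[OF tle(1)] by blast
  have "V (t + 1) y \<noteq> - \<infinity>"
  proof
    assume Vy: "V (t + 1) y = - \<infinity>"
    have inf: "stage_value t (\<xi> t \<omega>) (c t \<omega>) x = - \<infinity>" if "\<omega> \<in> {\<omega>\<in>space M. \<xi> t \<omega> = d}" for \<omega>
    proof -
      have "satisfies (\<xi> t \<omega>) x y" using that y(3) by simp
      from stage_value_le[OF y(1) this, of "c t \<omega>"] show ?thesis unfolding Vy by simp
    qed
    obtain g :: "'w \<Rightarrow> real" where g: "integrable M g"
      "AE \<omega> in M. stage_value t (\<xi> t \<omega>) (c t \<omega>) x \<le> ereal (g \<omega>)"
      by (rule stage_value_bounded_above[OF t x(1) V_less_infinity[OF tle(2,3)]])
    have "emeasure M {\<omega>\<in>space M. \<xi> t \<omega> = d} > 0"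
      using atom_prob_pos[OF t d] by (simp add: emeasure_eq_measure)
    then have "V t x = - \<infinity>"
      unfolding V_step[OF tle(1)]
      using ereal_expectation_minus_infinity[OF g(2,1) atom_measurable[OF t] _ inf] by blast
    with x(2) show False by simp
  qed
  then show ?thesis using y(2) by blast
qed

lemma polyhedral_value_if_finite:
  "2 \<le> t \<Longrightarrow> t \<le> T + 1 \<Longrightarrow> x \<in> feasible_states t \<Longrightarrow> V t x \<noteq> - \<infinity> \<Longrightarrow> polyhedral_value t"
proof (induction "T + 1 - t" arbitrary: t x)
  case 0
  then have "t = T + 1" by simp
  then show ?case using polyhedral_value_final 0 by simp
next
  case (Suc k)
  then have t: "t \<in> {2..T}" by auto
  obtain y where "y \<in> feasible_states (t + 1)" "V (t + 1) y \<noteq> - \<infinity>"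
    using next_value_finite[OF t Suc.prems(3,4)] by blast
  moreover have "k = T + 1 - (t + 1)" "2 \<le> t + 1" "t + 1 \<le> T + 1" using Suc.hyps(2) t by auto
  ultimately have "polyhedral_value (t + 1)" using Suc.hyps(1) by blast
  then interpret program_stage M T J c \<xi> t using t by unfold_locales
  show ?case using polyhedral_value_stage Suc.prems(3,4) by blast
qed

section \<open>Recursion over the scenario tree\<close>

lemma nodes_final: "nodes T = {[]}"
  by (auto simp: nodes_def)

lemma Cons_mem_nodes:
  assumes "t0 < T"
  shows "e # \<nu> \<in> nodes t0 \<longleftrightarrow> e \<in> children (t0 + 1) \<and> \<nu> \<in> nodes (t0 + 1)"
proof -
  obtain N d where Nd: "e = (N, d)" by (rule prod.exhaust)
  show ?thesis
    using assms unfolding nodes_def Nd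
    by (auto simp: mem_children All_less_Suc2)
qed

lemma Nil_mem_nodes: "[] \<in> nodes t0"
  by (simp add: nodes_def)

lemma nodes_minus_root:
  assumes "t0 < T"
  shows "nodes t0 - {[]} = (\<lambda>(e, \<nu>). e # \<nu>) ` (children (t0 + 1) \<times> nodes (t0 + 1))"
proof (rule set_eqI iffI)+
  fix \<mu> assume \<mu>: "\<mu> \<in> nodes t0 - {[]}"
  then obtain e \<nu> where "\<mu> = e # \<nu>" by (cases \<mu>) auto
  then show "\<mu> \<in> (\<lambda>(e, \<nu>). e # \<nu>) ` (children (t0 + 1) \<times> nodes (t0 + 1))"
    using \<mu> Cons_mem_nodes[OF assms, of e \<nu>] by (intro image_eqI[of _ _ "(e, \<nu>)"]) auto
qed (use Cons_mem_nodes[OF assms] in auto)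

lemma node_prob_Cons:
  assumes t0: "t0 + 1 \<in> {2..T}" and e: "e \<in> children (t0 + 1)"
  shows "node_prob t0 (e # \<nu>) = prob (child_event (t0 + 1) e) * node_prob (t0 + 1) \<nu>"
proof -
  obtain N d where Nd: "e = (N, d)" by (rule prod.exhaust)
  have d: "d \<in> rv_support M (\<xi> (t0 + 1))" using e unfolding Nd mem_children by blast
  show ?thesis
    unfolding node_prob_def Nd using child_prob[OF t0 d, of N]
    by (simp add: prod.lessThan_Suc_shift del: prod.lessThan_Suc)
qed

lemma node_cost_Cons:
  "node_cost t0 (e # \<nu>) = (if \<nu> = [] then child_mean (t0 + 1) e else node_cost (t0 + 1) \<nu>)"
  by (simp add: node_cost_def child_mean_def)

lemma tree_cost_step:
  assumes t0: "t0 + 1 \<in> {2..T}" and fin: "finite (nodes (t0 + 1))"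
  shows "tree_cost t0 X = (\<Sum>e\<in>children (t0 + 1). prob (child_event (t0 + 1) e) *
     (child_mean (t0 + 1) e \<bullet> X [e] + tree_cost (t0 + 1) (\<lambda>\<nu>. X (e # \<nu>))))"
proof -
  have lt: "t0 < T" using t0 by simp
  let ?h = "\<lambda>e \<nu>. node_prob t0 (e # \<nu>) * (node_cost t0 (e # \<nu>) \<bullet> X (e # \<nu>))"
  have "inj_on (\<lambda>(e, \<nu>). e # \<nu>) (children (t0 + 1) \<times> nodes (t0 + 1))"
    by (auto simp: inj_on_def)
  then have "tree_cost t0 X = (\<Sum>(e, \<nu>)\<in>children (t0 + 1) \<times> nodes (t0 + 1). ?h e \<nu>)"
    unfolding tree_cost_def nodes_minus_root[OF lt]
    by (subst sum.reindex) (auto intro!: sum.cong)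
  also have "\<dots> = (\<Sum>e\<in>children (t0 + 1). \<Sum>\<nu>\<in>nodes (t0 + 1). ?h e \<nu>)"
    by (rule sum.cartesian_product[symmetric])
  also have "\<dots> = (\<Sum>e\<in>children (t0 + 1). prob (child_event (t0 + 1) e) *
     (child_mean (t0 + 1) e \<bullet> X [e] + tree_cost (t0 + 1) (\<lambda>\<nu>. X (e # \<nu>))))"
  proof (rule sum.cong[OF refl])
    fix e assume e: "e \<in> children (t0 + 1)"
    have "(\<Sum>\<nu>\<in>nodes (t0 + 1). ?h e \<nu>) = ?h e [] + (\<Sum>\<nu>\<in>nodes (t0 + 1) - {[]}. ?h e \<nu>)"
      using fin Nil_mem_nodes by (rule sum.remove)
    also have "?h e [] = prob (child_event (t0 + 1) e) * (child_mean (t0 + 1) e \<bullet> X [e])"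
      unfolding node_prob_Cons[OF t0 e] node_cost_Cons by (simp add: node_prob_def)
    also have "(\<Sum>\<nu>\<in>nodes (t0 + 1) - {[]}. ?h e \<nu>) =
        prob (child_event (t0 + 1) e) * tree_cost (t0 + 1) (\<lambda>\<nu>. X (e # \<nu>))"
      unfolding tree_cost_def sum_distrib_left node_prob_Cons[OF t0 e] node_cost_Cons
      by (intro sum.cong) (auto simp: mult.assoc)
    finally show "(\<Sum>\<nu>\<in>nodes (t0 + 1). ?h e \<nu>) = prob (child_event (t0 + 1) e) *
     (child_mean (t0 + 1) e \<bullet> X [e] + tree_cost (t0 + 1) (\<lambda>\<nu>. X (e # \<nu>)))"
      by (simp add: distrib_left)
  qed
  finally show ?thesis .
qed

lemma tree_feasible_step:
  assumes t0: "t0 < T"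
  shows "X \<in> tree_feasible t0 x0 \<longleftrightarrow> X [] = x0 \<and> x0 \<in> coord_space (J t0) \<and>
    (\<forall>e\<in>children (t0 + 1). satisfies (snd e) x0 (X [e]) \<and>
       (\<lambda>\<nu>. X (e # \<nu>)) \<in> tree_feasible (t0 + 1) (X [e]))" (is "?L \<longleftrightarrow> ?R")
proof
  assume L: ?L
  have root: "X [] = x0" and coord: "\<And>\<nu>. \<nu> \<in> nodes t0 \<Longrightarrow> X \<nu> \<in> coord_space (J (t0 + length \<nu>))"
    and sat: "\<And>\<nu> N d. \<nu> \<in> nodes t0 \<Longrightarrow> \<nu> @ [(N, d)] \<in> nodes t0 \<Longrightarrow> satisfies d (X \<nu>) (X (\<nu> @ [(N, d)]))"
    using L unfolding tree_feasible_def by blast+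
  have "x0 \<in> coord_space (J t0)" using coord[OF Nil_mem_nodes] root by simp
  moreover have "satisfies (snd e) x0 (X [e])" if "e \<in> children (t0 + 1)" for e
    using sat[OF Nil_mem_nodes, of "fst e" "snd e"] that Cons_mem_nodes[OF t0, of e "[]"] Nil_mem_nodes root
    by simp
  moreover have "(\<lambda>\<nu>. X (e # \<nu>)) \<in> tree_feasible (t0 + 1) (X [e])" if e: "e \<in> children (t0 + 1)" for e
    unfolding tree_feasible_def mem_Collect_eq
  proof (intro conjI ballI allI impI)
    fix \<nu> assume "\<nu> \<in> nodes (t0 + 1)"
    then have \<nu>: "e # \<nu> \<in> nodes t0" using Cons_mem_nodes[OF t0] e by blast
    show "X (e # \<nu>) \<in> coord_space (J (t0 + 1 + length \<nu>))" using coord[OF \<nu>] by simp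
    fix N d assume "\<nu> @ [(N, d)] \<in> nodes (t0 + 1)"
    then have "(e # \<nu>) @ [(N, d)] \<in> nodes t0" using Cons_mem_nodes[OF t0] e by simp
    from sat[OF \<nu> this] show "satisfies d (X (e # \<nu>)) (X (e # \<nu> @ [(N, d)]))" by simp
  qed simp
  ultimately show ?R using root by blast
next
  assume R: ?R
  have coord: "\<And>e \<nu>. e \<in> children (t0 + 1) \<Longrightarrow> \<nu> \<in> nodes (t0 + 1) \<Longrightarrow> X (e # \<nu>) \<in> coord_space (J (t0 + 1 + length \<nu>))"
    and sat: "\<And>e \<nu> N d. e \<in> children (t0 + 1) \<Longrightarrow> \<nu> \<in> nodes (t0 + 1) \<Longrightarrow> \<nu> @ [(N, d)] \<in> nodes (t0 + 1) \<Longrightarrow>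
      satisfies d (X (e # \<nu>)) (X (e # \<nu> @ [(N, d)]))"
    using R unfolding tree_feasible_def by blast+
  show ?L
    unfolding tree_feasible_def mem_Collect_eq
  proof (intro conjI ballI allI impI)
    show "X [] = x0" using R by blast
    fix \<nu> assume \<nu>: "\<nu> \<in> nodes t0"
    show "X \<nu> \<in> coord_space (J (t0 + length \<nu>))"
    proof (cases \<nu>)
      case Nil then show ?thesis using R by simp
    next
      case (Cons e \<nu>')
      then show ?thesis using coord[of e \<nu>'] \<nu> Cons_mem_nodes[OF t0, of e \<nu>'] by simp
    qed
    fix N d assume \<mu>: "\<nu> @ [(N, d)] \<in> nodes t0"
    show "satisfies d (X \<nu>) (X (\<nu> @ [(N, d)]))"
    proof (cases \<nu>)
      case Nil
      then have "(N, d) \<in> children (t0 + 1)" using \<mu> Cons_mem_nodes[OF t0, of "(N, d)" "[]"] by simp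
      then have "satisfies (snd (N, d)) x0 (X [(N, d)])" using R by blast
      then show ?thesis using Nil R by simp
    next
      case (Cons e \<nu>')
      have "e \<in> children (t0 + 1)" "\<nu>' \<in> nodes (t0 + 1)" "\<nu>' @ [(N, d)] \<in> nodes (t0 + 1)"
        using \<nu> \<mu> Cons_mem_nodes[OF t0, of e] unfolding Cons append_Cons by blast+
      from sat[OF this] show ?thesis by (simp add: Cons)
    qed
  qed
qed

lemma tree_feasible_imp_feasible_state:
  "1 \<le> t0 \<Longrightarrow> t0 \<le> T \<Longrightarrow> X \<in> tree_feasible t0 x0 \<Longrightarrow> x0 \<in> feasible_states (t0 + 1)"
proof (induction "T - t0" arbitrary: t0 X x0)
  case 0
  then have t0: "t0 = T" by simp
  then have "X [] = x0" "X [] \<in> coord_space (J T)"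
    using 0(4) Nil_mem_nodes[of T] by (auto simp: tree_feasible_def)
  then show ?case unfolding t0 feasible_states_final by simp
next
  case (Suc k)
  then have t0: "t0 < T" "t0 + 1 \<le> T" "t0 + 1 \<in> {2..T}" by auto
  have IH: "y \<in> feasible_states (t0 + 1 + 1)" if "Y \<in> tree_feasible (t0 + 1) y" for Y y
    using Suc.hyps(1)[OF _ _ t0(2) that] Suc.hyps(2) by simp
  have R: "x0 \<in> coord_space (J t0)" "\<And>e. e \<in> children (t0 + 1) \<Longrightarrow> satisfies (snd e) x0 (X [e]) \<and>
       (\<lambda>\<nu>. X (e # \<nu>)) \<in> tree_feasible (t0 + 1) (X [e])"
    using Suc.prems(3) tree_feasible_step[OF t0(1)] by blast+
  have "\<exists>y\<in>coord_space (J (t0 + 1)). y \<in> feasible_states (t0 + 1 + 1) \<and> satisfies d x0 y"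
    if d: "d \<in> rv_support M (\<xi> (t0 + 1))" for d
  proof -
    obtain N where "N \<in> N_fan (t0 + 1) d" using N_fan_nonempty[OF t0(3)] by blast
    then have e: "(N, d) \<in> children (t0 + 1)" using d by (simp add: mem_children)
    have y: "X [(N, d)] \<in> feasible_states (t0 + 1 + 1)" using IH R(2)[OF e] by blast
    moreover have "X [(N, d)] \<in> coord_space (J (t0 + 1))"
      using feasible_states_coord[of "t0 + 1 + 1"] t0(2) y by auto
    ultimately show ?thesis using R(2)[OF e] by auto
  qed
  then show ?case using R(1) feasible_states_step[OF t0(2)] by simp
qed

text \<open>
  A feasible family restricts to feasible families on the subtrees, which bounds its cost from below
  stage by stage; equality holds when the common minimisers are extended by optimal subtrees. For a
  child of probability zero any feasible extension would do. Finiteness of the tree belongs to the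
  induction because the cost is a sum over the nodes, which would be zero over an infinite set.
\<close>
lemma tree_minimum:
  "1 \<le> t0 \<Longrightarrow> t0 \<le> T \<Longrightarrow> x0 \<in> feasible_states (t0 + 1) \<Longrightarrow> V (t0 + 1) x0 \<noteq> - \<infinity> \<Longrightarrow>
     finite (nodes t0) \<and>
     (\<forall>X\<in>tree_feasible t0 x0. real_value (t0 + 1) x0 \<le> tree_cost t0 X) \<and>
     (\<exists>X\<in>tree_feasible t0 x0. tree_cost t0 X = real_value (t0 + 1) x0)"
proof (induction "T - t0" arbitrary: t0 x0)
  case 0
  then have t0: "t0 = T" by simp
  have x0: "x0 \<in> coord_space (J T)" using "0.prems"(3) unfolding t0 feasible_states_final .
  have V0: "real_value (T + 1) x0 = 0" unfolding real_value_def V_final by simp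
  have "tree_cost T X = 0" for X by (simp add: tree_cost_def nodes_final)
  moreover have "(\<lambda>_. x0) \<in> tree_feasible T x0"
    using x0 by (simp add: tree_feasible_def nodes_final)
  ultimately show ?case unfolding t0 V0 nodes_final by auto
next
  case (Suc k)
  then have t0: "t0 < T" "t0 + 1 \<le> T" "t0 + 1 \<in> {2..T}" by auto
  let ?t = "t0 + 1"
  obtain y1 where y1: "y1 \<in> feasible_states (?t + 1)" "V (?t + 1) y1 \<noteq> - \<infinity>"
    using next_value_finite[OF t0(3) Suc.prems(3,4)] by blast
  have next_value: "polyhedral_value (?t + 1)"
    using polyhedral_value_if_finite[OF _ _ y1] t0 by simp
  interpret program_stage M T J c \<xi> ?t using t0(3) next_value by unfold_locales
  have IH: "finite (nodes ?t) \<and> (\<forall>X\<in>tree_feasible ?t y. real_value (?t + 1) y \<le> tree_cost ?t X) \<and>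
     (\<exists>X\<in>tree_feasible ?t y. tree_cost ?t X = real_value (?t + 1) y)"
    if "y \<in> feasible_states (?t + 1)" for y
    using Suc.hyps(1)[OF _ _ t0(2) that] Suc.hyps(2) polyhedral_valueD(1)[OF next_value that] by simp
  have fin: "finite (nodes ?t)" using IH[OF y1(1)] by blast
  have finT: "finite (nodes t0)"
  proof -
    have "finite (nodes t0 - {[]})"
      unfolding nodes_minus_root[OF t0(1)] using fin finite_children by blast
    then show ?thesis by simp
  qed
  have val: "real_value ?t x0 = (\<Sum>e\<in>children ?t. prob (child_event ?t e) * child_value x0 e)"
    using V_quantised[OF Suc.prems(3,4,3)] by (simp add: real_value_def)
  have x0: "x0 \<in> coord_space (J t0)" using feasible_states_coord_space[OF Suc.prems(3)] by simp
  have lower: "real_value ?t x0 \<le> tree_cost t0 X" if X: "X \<in> tree_feasible t0 x0" for X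
    unfolding val tree_cost_step[OF t0(3) fin]
  proof (rule sum_mono)
    fix e assume e: "e \<in> children ?t"
    have X': "satisfies (snd e) x0 (X [e])" "(\<lambda>\<nu>. X (e # \<nu>)) \<in> tree_feasible ?t (X [e])"
      using X tree_feasible_step[OF t0(1)] e by blast+
    have y: "X [e] \<in> feasible_states (?t + 1)"
      using tree_feasible_imp_feasible_state[OF _ t0(2) X'(2)] by simp
    then have "X [e] \<in> coord_space (J ?t)" using feasible_states_coord[of "?t + 1"] t0(2) by auto
    then have "(x0, X [e], U (X [e])) \<in> stage_epigraph (snd e)"
      unfolding stage_epigraph_def using x0 X'(1) V_next[OF y] by simp
    then have "prob (child_event ?t e) * child_value x0 e \<le>
        prob (child_event ?t e) * (child_mean ?t e \<bullet> X [e] + U (X [e]))"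
      by (rule child_value_le[OF Suc.prems(3) e])
    also have "\<dots> \<le> prob (child_event ?t e) *
        (child_mean ?t e \<bullet> X [e] + tree_cost ?t (\<lambda>\<nu>. X (e # \<nu>)))"
      using IH[OF y] X'(2) by (intro mult_left_mono) auto
    finally show "prob (child_event ?t e) * child_value x0 e \<le> prob (child_event ?t e) *
        (child_mean ?t e \<bullet> X [e] + tree_cost ?t (\<lambda>\<nu>. X (e # \<nu>)))" .
  qed
  have opt: "satisfies (snd e) x0 (minimiser x0 e)" "minimiser x0 e \<in> feasible_states (?t + 1)"
    if e: "e \<in> children ?t" for e
    using minimiser(1)[OF Suc.prems(3) e] next_feasible unfolding stage_epigraph_def by auto
  have "\<exists>Y. Y \<in> tree_feasible ?t (minimiser x0 e) \<and> tree_cost ?t Y = U (minimiser x0 e)"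
    if e: "e \<in> children ?t" for e
    using IH[OF opt(2)[OF e]] by blast
  then obtain Y where Y: "\<And>e. e \<in> children ?t \<Longrightarrow>
      Y e \<in> tree_feasible ?t (minimiser x0 e) \<and> tree_cost ?t (Y e) = U (minimiser x0 e)" by metis
  define X where "X \<nu> = (case \<nu> of [] \<Rightarrow> x0 | e # \<nu>' \<Rightarrow> Y e \<nu>')" for \<nu>
  have Xe: "X [e] = minimiser x0 e" if "e \<in> children ?t" for e
    using Y[OF that] by (simp add: X_def tree_feasible_def)
  have "X \<in> tree_feasible t0 x0"
    unfolding tree_feasible_step[OF t0(1)]
    using x0 Y Xe opt(1) by (simp add: X_def)
  moreover have "tree_cost t0 X = real_value ?t x0"
    unfolding val tree_cost_step[OF t0(3) fin]
  proof (rule sum.cong[OF refl])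
    fix e assume e: "e \<in> children ?t"
    have "(\<lambda>\<nu>. X (e # \<nu>)) = Y e" by (simp add: X_def)
    then show "prob (child_event ?t e) * (child_mean ?t e \<bullet> X [e] + tree_cost ?t (\<lambda>\<nu>. X (e # \<nu>))) =
        prob (child_event ?t e) * child_value x0 e"
      unfolding child_value_def Xe[OF e] using Y[OF e] by simp
  qed
  ultimately show ?case using finT lower by blast
qed

end

theorem corollary19:
  fixes M :: "'w measure"
    and T :: nat
    and I :: "nat \<Rightarrow> 'm::finite set"
    and J :: "nat \<Rightarrow> 'n::finite set"
    and c :: "nat \<Rightarrow> 'w \<Rightarrow> real^'n"
    and \<xi> :: "nat \<Rightarrow> 'w \<Rightarrow> ('n, 'm) stage_data"
  assumes "prob_space M"
    and "\<And>t \<omega>. t \<in> {2..T} \<Longrightarrow> \<omega> \<in> space M \<Longrightarrow> c t \<omega> \<in> coord_space (J t)"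
    and "\<And>t \<omega>. t \<in> {2..T} \<Longrightarrow> \<omega> \<in> space M \<Longrightarrow> \<xi> t \<omega> \<in> data_space (I t) (J (t - 1)) (J t)"
    and "prob_space.indep_vars M (\<lambda>_. borel) (\<lambda>t \<omega>. (c t \<omega>, \<xi> t \<omega>)) {2..T}"
    and "\<And>t. t \<in> {2..T} \<Longrightarrow> finite (rv_support M (\<xi> t))"
    and "\<And>t. t \<in> {2..T} \<Longrightarrow> integrable M (c t)"
    and "\<And>t. t \<in> {2..T} \<Longrightarrow>
           AE \<omega> in M. c t \<omega> \<in> uminus ` (convex_cone hull columns (transpose (fst (\<xi> t \<omega>))))"
  shows "\<forall>t0\<in>{1..T-1}. \<forall>x0\<in>coord_space (J t0).
           multistage.V M T J c \<xi> (t0 + 1) x0 \<noteq> -\<infinity> \<longrightarrow>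
           is_minimum
             ((\<lambda>X. ereal (multistage.tree_cost M T J c \<xi> t0 X)) ` multistage.tree_feasible M T J c \<xi> t0 x0)
             (multistage.V M T J c \<xi> (t0 + 1) x0)"
proof -
  interpret prob_space M by fact
  have "\<xi> t \<in> borel_measurable M" if "t \<in> {2..T}" for t
  proof -
    have "(\<lambda>\<omega>. (c t \<omega>, \<xi> t \<omega>)) \<in> borel_measurable M"
      using assms(4) that unfolding indep_vars_def by blast
    moreover have "snd \<in> borel_measurable (borel :: ((real^'n) \<times> ('n, 'm) stage_data) measure)"
      by (intro borel_measurable_continuous_onI continuous_on_snd continuous_on_id)
    ultimately have "(\<lambda>\<omega>. snd (c t \<omega>, \<xi> t \<omega>)) \<in> borel_measurable M" by (rule measurable_compose)
    then show ?thesis by simp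
  qed
  then interpret finitely_supported_program M T J c \<xi>
    using assms(2,5,6) by unfold_locales
  show ?thesis
  proof (intro ballI impI)
    fix t0 x0 assume t0: "t0 \<in> {1..T-1}" and x0: "x0 \<in> coord_space (J t0)"
      and V: "V (t0 + 1) x0 \<noteq> - \<infinity>"
    have t0': "1 \<le> t0" "t0 \<le> T" "2 \<le> t0 + 1" "t0 + 1 \<le> T + 1" using t0 by auto
    show "is_minimum ((\<lambda>X. ereal (tree_cost t0 X)) ` tree_feasible t0 x0) (V (t0 + 1) x0)"
    proof (cases "x0 \<in> feasible_states (t0 + 1)")
      case True
      have val: "V (t0 + 1) x0 = ereal (real_value (t0 + 1) x0)"
        using V_eq_real_value[OF t0'(3,4) polyhedral_value_if_finite[OF t0'(3,4) True V] True] .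
      have lower: "\<And>X. X \<in> tree_feasible t0 x0 \<Longrightarrow> real_value (t0 + 1) x0 \<le> tree_cost t0 X"
        using tree_minimum[OF t0'(1,2) True V] by blast
      obtain X where X: "X \<in> tree_feasible t0 x0" "tree_cost t0 X = real_value (t0 + 1) x0"
        using tree_minimum[OF t0'(1,2) True V] by blast
      have "ereal (real_value (t0 + 1) x0) \<in> (\<lambda>X. ereal (tree_cost t0 X)) ` tree_feasible t0 x0"
        using X(1) by (rule rev_image_eqI) (simp add: X(2))
      then show ?thesis
        unfolding is_minimum_def val using lower by auto
    next
      case False
      then have "tree_feasible t0 x0 = {}"
        using tree_feasible_imp_feasible_state[OF t0'(1,2)] by blast
      moreover have "V (t0 + 1) x0 = \<infinity>" using V_infinite[OF t0'(3,4) _ False] x0 by simp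
      ultimately show ?thesis by (simp add: is_minimum_def)
    qed
  qed
qed

end
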